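(* Let $\Omega \subset \mathbb{R}^N$, $N \ge 2$, be a bounded domain, let $1 < p < N$ and $p^\ast = Np/(N-p)$, let $h : [0,\infty) \to [0,\infty)$ be continuous and nondecreasing, and let $f : \Omega \times \mathbb{R} \to \mathbb{R}$ be a Carathéodory function such that $$|f(x,t)| \le a_1 |t|^{q-1} + a_2 \quad \text{for a.a. } x \in \Omega \text{ and all } t \in \mathbb{R}$$ for some constants $a_1, a_2 > 0$ and $1 < q < p^\ast$. Assume that $$h(t) > S_{N,p}^{-p^\ast/p}\, t^{p^\ast/p - 1} \quad \text{for all } t > 0.$$ Then every bounded sequence $(u_j) \subset W^{1,p}_0(\Omega)$ such that $E'(u_j) \to 0$ (in the dual space of $W^{1,p}_0(\Omega)$) has a subsequence that converges (strongly) in $W^{1,p}_0(\Omega)$.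
   Context: $S_{N,p}$ denotes the best Sobolev constant $$S_{N,p} = \inf_{u \in W^{1,p}_0(\Omega) \setminus \{0\}} \frac{\int_\Omega |\nabla u|^p\, dx}{\left(\int_\Omega |u|^{p^\ast} dx\right)^{p/p^\ast}}.$$ Set $H(t) = \int_0^t h(s)\, ds$ for $t \ge 0$ and $F(x,t) = \int_0^t f(x,s)\, ds$. The $C^1$-functional $E : W^{1,p}_0(\Omega) \to \mathbb{R}$ is $$E(u) = \frac{1}{p}\, H\left(\int_\Omega |\nabla u|^p\, dx\right) - \int_\Omega F(x,u)\, dx - \frac{1}{p^\ast} \int_\Omega |u|^{p^\ast} dx.$$ Its derivative is given by $$E'(u)v = h\left(\int_\Omega |\nabla u|^p\, dx\right) \int_\Omega |\nabla u|^{p-2} \nabla u \cdot \nabla v\, dx - \int_\Omega f(x,u)\, v\, dx - \int_\Omega |u|^{p^\ast-2} u\, v\, dx.$$ The space $W^{1,p}_0(\Omega)$ carries the norm $\|u\| = \left(\int_\Omega |\nabla u|^p\, dx\right)^{1/p}$. *)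

theory Defs
  imports "HOL-Analysis.Analysis"
begin

section \<open>Test functions\<close>

text \<open>
  The function space is realised by representatives \<open>u :: 'a \<Rightarrow> real\<close>: only the values on
  \<open>\<Omega>\<close> matter, and functions agreeing almost everywhere on \<open>\<Omega>\<close> stand for the same element.
\<close>

primrec C_k :: "nat \<Rightarrow> ('a::euclidean_space \<Rightarrow> real) \<Rightarrow> bool" where
  "C_k 0 \<phi> \<longleftrightarrow> continuous_on UNIV \<phi>"
| "C_k (Suc k) \<phi> \<longleftrightarrow> (\<forall>x. \<phi> differentiable (at x)) \<and>
     (\<forall>b\<in>Basis. C_k k (\<lambda>x. frechet_derivative \<phi> (at x) b))"

definition test_functions :: "'a::euclidean_space set \<Rightarrow> ('a \<Rightarrow> real) set" where
  "test_functions \<Omega> =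
     {\<phi>. (\<forall>k. C_k k \<phi>) \<and> compact (closure {x. \<phi> x \<noteq> 0}) \<and> closure {x. \<phi> x \<noteq> 0} \<subseteq> \<Omega>}"

section \<open>Weak gradients and Sobolev spaces\<close>

definition locally_integrable_on ::
    "'a::euclidean_space set \<Rightarrow> ('a \<Rightarrow> 'b::euclidean_space) \<Rightarrow> bool" where
  "locally_integrable_on \<Omega> g \<longleftrightarrow> (\<forall>K. compact K \<and> K \<subseteq> \<Omega> \<longrightarrow> set_integrable lebesgue K g)"

definition has_weak_gradient ::
    "'a::euclidean_space set \<Rightarrow> ('a \<Rightarrow> real) \<Rightarrow> ('a \<Rightarrow> 'a) \<Rightarrow> bool" where
  "has_weak_gradient \<Omega> u g \<longleftrightarrow> locally_integrable_on \<Omega> u \<and> locally_integrable_on \<Omega> g \<and>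
     (\<forall>\<phi>\<in>test_functions \<Omega>. \<forall>b\<in>Basis.
        (\<integral>x. u x * frechet_derivative \<phi> (at x) b \<partial>lebesgue_on \<Omega>) =
        - (\<integral>x. (g x \<bullet> b) * \<phi> x \<partial>lebesgue_on \<Omega>))"

text \<open>A weak gradient is unique up to a null subset of \<open>\<Omega>\<close>, so the choice below is immaterial.\<close>

definition weak_grad :: "'a::euclidean_space set \<Rightarrow> ('a \<Rightarrow> real) \<Rightarrow> 'a \<Rightarrow> 'a" where
  "weak_grad \<Omega> u = (SOME g. has_weak_gradient \<Omega> u g)"

definition Lp_space ::
    "'a::euclidean_space set \<Rightarrow> real \<Rightarrow> ('a \<Rightarrow> 'b::euclidean_space) set" where
  "Lp_space \<Omega> p = {g. g \<in> borel_measurable (lebesgue_on \<Omega>) \<and>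
                      integrable (lebesgue_on \<Omega>) (\<lambda>x. norm (g x) powr p)}"

definition W1p :: "'a::euclidean_space set \<Rightarrow> real \<Rightarrow> ('a \<Rightarrow> real) set" where
  "W1p \<Omega> p = {u \<in> Lp_space \<Omega> p. \<exists>g \<in> Lp_space \<Omega> p. has_weak_gradient \<Omega> u g}"

definition grad_energy :: "'a::euclidean_space set \<Rightarrow> real \<Rightarrow> ('a \<Rightarrow> real) \<Rightarrow> real" where
  "grad_energy \<Omega> p u = (\<integral>x. norm (weak_grad \<Omega> u x) powr p \<partial>lebesgue_on \<Omega>)"

definition W1p_norm :: "'a::euclidean_space set \<Rightarrow> real \<Rightarrow> ('a \<Rightarrow> real) \<Rightarrow> real" where
  "W1p_norm \<Omega> p u = ((\<integral>x. \<bar>u x\<bar> powr p \<partial>lebesgue_on \<Omega>) + grad_energy \<Omega> p u) powr (1 / p)"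

text \<open>The closure of the test functions in \<open>W1p\<close> with respect to its full norm.\<close>

definition W01p :: "'a::euclidean_space set \<Rightarrow> real \<Rightarrow> ('a \<Rightarrow> real) set" where
  "W01p \<Omega> p = {u \<in> W1p \<Omega> p. \<exists>\<phi>. (\<forall>n::nat. \<phi> n \<in> test_functions \<Omega>) \<and>
                  (\<lambda>n. W1p_norm \<Omega> p (\<lambda>x. \<phi> n x - u x)) \<longlonglongrightarrow> 0}"

definition W01p_norm :: "'a::euclidean_space set \<Rightarrow> real \<Rightarrow> ('a \<Rightarrow> real) \<Rightarrow> real" where
  "W01p_norm \<Omega> p u = grad_energy \<Omega> p u powr (1 / p)"

text \<open>The operator norm on the dual of \<open>W01p\<close>, with value \<open>\<infinity>\<close> on unbounded functionals.\<close>

definition dual_norm ::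
    "'a::euclidean_space set \<Rightarrow> real \<Rightarrow> (('a \<Rightarrow> real) \<Rightarrow> real) \<Rightarrow> ennreal" where
  "dual_norm \<Omega> p L = (SUP v \<in> {v \<in> W01p \<Omega> p. W01p_norm \<Omega> p v \<le> 1}. ennreal \<bar>L v\<bar>)"

section \<open>Critical exponent and best Sobolev constant\<close>

definition crit_exp :: "'a::euclidean_space itself \<Rightarrow> real \<Rightarrow> real" where
  "crit_exp _ p = real DIM('a) * p / (real DIM('a) - p)"

definition sobolev_const :: "'a::euclidean_space set \<Rightarrow> real \<Rightarrow> real" where
  "sobolev_const \<Omega> p =
     (let ps = crit_exp TYPE('a) p in
      INF u \<in> {u \<in> W01p \<Omega> p. \<not> (AE x in lebesgue_on \<Omega>. u x = 0)}.
        grad_energy \<Omega> p u / (\<integral>x. \<bar>u x\<bar> powr ps \<partial>lebesgue_on \<Omega>) powr (p / ps))"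

section \<open>The nonlocal energy functional\<close>

definition caratheodory :: "'a::euclidean_space set \<Rightarrow> ('a \<Rightarrow> real \<Rightarrow> real) \<Rightarrow> bool" where
  "caratheodory \<Omega> f \<longleftrightarrow> (\<forall>t. (\<lambda>x. f x t) \<in> borel_measurable (lebesgue_on \<Omega>)) \<and>
     (AE x in lebesgue_on \<Omega>. continuous_on UNIV (f x))"

definition energy ::
    "'a::euclidean_space set \<Rightarrow> real \<Rightarrow> (real \<Rightarrow> real) \<Rightarrow> ('a \<Rightarrow> real \<Rightarrow> real) \<Rightarrow> ('a \<Rightarrow> real) \<Rightarrow> real"
  where
  "energy \<Omega> p h f u =
     (let ps = crit_exp TYPE('a) p in
      1 / p * (LBINT s=0..grad_energy \<Omega> p u. h s)
      - (\<integral>x. (LBINT s=0..u x. f x s) \<partial>lebesgue_on \<Omega>)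
      - 1 / ps * (\<integral>x. \<bar>u x\<bar> powr ps \<partial>lebesgue_on \<Omega>))"

text \<open>
  The derivative of \<^const>\<open>energy\<close> at \<open>u\<close> in direction \<open>v\<close>, given by its explicit formula.
  With \<open>0 powr a = 0\<close> the terms \<open>\<bar>\<nabla>u\<bar>^(p-2) \<nabla>u\<close> and \<open>\<bar>u\<bar>^(p*-2) u\<close> vanish where their
  base does, also for exponents below 2.
\<close>

definition energy_deriv ::
    "'a::euclidean_space set \<Rightarrow> real \<Rightarrow> (real \<Rightarrow> real) \<Rightarrow> ('a \<Rightarrow> real \<Rightarrow> real) \<Rightarrow>
     ('a \<Rightarrow> real) \<Rightarrow> ('a \<Rightarrow> real) \<Rightarrow> real" where
  "energy_deriv \<Omega> p h f u v =
     (let ps = crit_exp TYPE('a) p in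
      h (grad_energy \<Omega> p u) *
        (\<integral>x. norm (weak_grad \<Omega> u x) powr (p - 2) * (weak_grad \<Omega> u x \<bullet> weak_grad \<Omega> v x)
           \<partial>lebesgue_on \<Omega>)
      - (\<integral>x. f x (u x) * v x \<partial>lebesgue_on \<Omega>)
      - (\<integral>x. \<bar>u x\<bar> powr (ps - 2) * u x * v x \<partial>lebesgue_on \<Omega>))"

end

theory Submission
  imports Defs "HOL-Library.Diagonal_Subsequence"
begin

text \<open>
  A bounded sequence \<open>u\<^sub>j\<close> with \<open>E'(u\<^sub>j) \<rightarrow> 0\<close> has, by Rellich's theorem and a convexity argument, a
  subsequence converging almost everywhere and weakly to some \<open>v\<close> in the space. Testing \<open>E'(u\<^sub>j)\<close> with
  \<open>arctan (u\<^sub>j - v)\<close>, for which the critical term vanishes in the limit, and using the strict monotonicity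
  of the \<open>p\<close>-Laplacian gives almost everywhere convergence of the gradients. Testing with \<open>u\<^sub>j - v\<close> and
  splitting all terms in the manner of Brezis and Lieb yields
  \<open>h(\<parallel>u\<^sub>j\<parallel>^p) \<parallel>u\<^sub>j - v\<parallel>^p - \<integral>\<bar>u\<^sub>j - v\<bar>^{p*} \<rightarrow> 0\<close> and \<open>\<parallel>u\<^sub>j\<parallel>^p = \<parallel>u\<^sub>j - v\<parallel>^p + \<parallel>v\<parallel>^p + o(1)\<close>.
  If \<open>\<parallel>u\<^sub>j - v\<parallel>^p \<rightarrow> t > 0\<close>, the Sobolev inequality and the monotonicity of \<open>h\<close> give
  \<open>h(t) \<le> S^{-p*/p} t^{p*/p - 1}\<close>, contrary to the growth assumption on \<open>h\<close>.
\<close>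

section \<open>Homogeneous inequalities\<close>

text \<open>Neither the critical term nor the flux of the \<open>p\<close>-Laplacian is weakly
  continuous, so weak convergence alone identifies no limits; almost everywhere convergence of the
  gradients is what makes both terms split. \<open>arctan\<close> serves because a bounded test
  function lowers the critical integrand from order \<open>ps\<close> to order
  \<open>ps - 1\<close>, which the bound in \<open>L^ps\<close> controls. The threshold on
  \<open>h\<close> is the Sobolev inequality raised to the power \<open>ps / p\<close> and divided
  by \<open>t\<close>. Testing produces \<open>h\<close> at the limit \<open>e\<close> of the full
  energies, while the threshold concerns the energy \<open>t \<le> e\<close> of the lost part;
  monotonicity of \<open>h\<close> bridges the two. The growth assumption also gives
  \<open>h e > 0\<close> for \<open>e > 0\<close>, so this factor can be divided out. Uniform
  convexity, coercivity of the flux and the Brezis-Lieb remainders all come from one compactness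
  argument for homogeneous functions, with no distinction between exponents below and above 2. Weak
  compactness is never invoked: limits are taken almost everywhere, and strongly convergent
  gradients come from uniform convexity.\<close>

lemma homogeneous_interpolation:
  fixes \<Phi> \<Psi> N :: "'c::euclidean_space \<Rightarrow> real"
  assumes c: "continuous_on UNIV \<Phi>" "continuous_on UNIV \<Psi>" "continuous_on UNIV N"
    and h\<Phi>: "\<And>c z. c > 0 \<Longrightarrow> \<Phi> (c *\<^sub>R z) = c powr r * \<Phi> z"
    and h\<Psi>: "\<And>c z. c > 0 \<Longrightarrow> \<Psi> (c *\<^sub>R z) = c powr r * \<Psi> z"
    and hN: "\<And>c z. c > 0 \<Longrightarrow> N (c *\<^sub>R z) = c powr r * N z"
    and N: "\<And>z. z \<noteq> 0 \<Longrightarrow> N z > 0"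
    and \<Psi>: "\<And>z. \<Psi> z \<ge> 0"
    and zero: "\<And>z. \<Psi> z = 0 \<Longrightarrow> \<Phi> z \<le> 0"
    and r: "r > 0" and e: "\<epsilon> > 0"
  shows "\<exists>C\<ge>0. \<forall>z. \<Phi> z \<le> \<epsilon> * N z + C * \<Psi> z"
proof -
  \<comment> \<open>Were no constant good enough on the unit sphere, points violating the bound with
    the constants \<open>n\<close> would accumulate at some \<open>l\<close>. Convergence of
    \<open>\<Phi>\<close> along them forces \<open>\<Psi> l = 0\<close>, so
    \<open>\<Phi> l \<le> 0\<close> by assumption, whereas the violated bounds give
    \<open>\<epsilon> * N l \<le> \<Phi> l\<close> with \<open>N l > 0\<close>. Homogeneity later
    carries the bound from the sphere to all nonzero vectors.\<close>
  have "\<exists>C\<ge>0. \<forall>z\<in>sphere 0 1. \<Phi> z \<le> \<epsilon> * N z + C * \<Psi> z"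
  proof (rule ccontr)
    assume "\<not> ?thesis"
    then have "\<forall>n::nat. \<exists>z\<in>sphere 0 1. \<Phi> z > \<epsilon> * N z + real n * \<Psi> z"
      by (meson not_le of_nat_0_le_iff)
    then obtain z where z: "\<And>n. z n \<in> sphere 0 1" "\<And>n. \<Phi> (z n) > \<epsilon> * N (z n) + real n * \<Psi> (z n)"
      by metis
    obtain l \<rho> where l: "l \<in> sphere (0::'c) 1" "strict_mono (\<rho>::nat\<Rightarrow>nat)" "(z \<circ> \<rho>) \<longlonglongrightarrow> l"
      using compact_sphere[of "0::'c" 1] z(1) unfolding compact_def by meson
    have lim: "(\<lambda>n. F (z (\<rho> n))) \<longlonglongrightarrow> F l" if "continuous_on UNIV F" for F :: "'c \<Rightarrow> real"
      using continuous_on_tendsto_compose[OF that l(3)] by (simp add: o_def)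
    have pos: "N (z n) > 0" for n using z(1)[of n] by (intro N) auto
    have "l \<noteq> 0" using l(1) by auto
    have b: "real n * \<Psi> (z (\<rho> n)) \<le> \<Phi> (z (\<rho> n))" for n
    proof -
      have "real n * \<Psi> (z (\<rho> n)) \<le> real (\<rho> n) * \<Psi> (z (\<rho> n))"
        using seq_suble[OF l(2)] \<Psi> by (intro mult_right_mono) auto
      also have "\<dots> \<le> \<Phi> (z (\<rho> n))" using z(2)[of "\<rho> n"] mult_pos_pos[OF e pos[of "\<rho> n"]]
        by linarith
      finally show ?thesis .
    qed
    have "(\<lambda>n. (1 / real n) * \<Phi> (z (\<rho> n))) \<longlonglongrightarrow> 0 * \<Phi> l"
      by (intro tendsto_mult lim c lim_1_over_n)
    moreover have "\<forall>\<^sub>F n in sequentially. \<Psi> (z (\<rho> n)) \<le> (1 / real n) * \<Phi> (z (\<rho> n))"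
      using eventually_gt_at_top[of 0] by eventually_elim (use b in \<open>simp add: field_simps\<close>)
    ultimately have "\<Psi> l \<le> 0 * \<Phi> l"
      using lim[OF c(2)] tendsto_le[OF sequentially_bot] by blast
    then have "\<Phi> l \<le> 0" using \<Psi>[of l] zero by force
    moreover have "\<epsilon> * N l \<le> \<Phi> l"
    proof (rule tendsto_le[OF sequentially_bot lim[OF c(1)] tendsto_mult_left[OF lim[OF c(3)]]])
      show "\<forall>\<^sub>F n in sequentially. \<epsilon> * N (z (\<rho> n)) \<le> \<Phi> (z (\<rho> n))"
      proof (intro always_eventually allI)
        fix n
        have "0 \<le> real (\<rho> n) * \<Psi> (z (\<rho> n))" using \<Psi> by simp
        then show "\<epsilon> * N (z (\<rho> n)) \<le> \<Phi> (z (\<rho> n))" using z(2)[of "\<rho> n"] by linarith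
      qed
    qed
    ultimately show False using mult_pos_pos[OF e N[OF \<open>l \<noteq> 0\<close>]] by linarith
  qed
  then obtain C where C: "C \<ge> 0" "\<And>z. z \<in> sphere 0 1 \<Longrightarrow> \<Phi> z \<le> \<epsilon> * N z + C * \<Psi> z" by blast
  have "\<Phi> z \<le> \<epsilon> * N z + C * \<Psi> z" for z
  proof (cases "z = 0")
    case True
    \<comment> \<open>At the origin, homogeneity with the factor 2 forces all three functions to
      vanish.\<close>
    have "2 powr r > 1" using r by simp
    then have "F 0 = 0" if "\<And>c z. c > 0 \<Longrightarrow> F (c *\<^sub>R z) = c powr r * F z" for F :: "'c \<Rightarrow> real"
      using that[of 2 0] by auto
    then show ?thesis using True h\<Phi> h\<Psi> hN by (metis add_0 mult_zero_right order_refl)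
  next
    case False
    define w where "w = inverse (norm z) *\<^sub>R z"
    have w: "z = norm z *\<^sub>R w" "w \<in> sphere 0 1" using False by (auto simp: w_def)
    have "norm z powr r * \<Phi> w \<le> norm z powr r * (\<epsilon> * N w + C * \<Psi> w)"
      using C(2)[OF w(2)] by (intro mult_left_mono) auto
    then show ?thesis
      using h\<Phi>[of "norm z" w] h\<Psi>[of "norm z" w] hN[of "norm z" w] False w(1)
      by (auto simp: algebra_simps)
  qed
  with C(1) show ?thesis by blast
qed

text \<open>The duality map of the \<open>r\<close>-th power, that is, the gradient of
  \<open>norm a powr r / r\<close>. The same map on vectors with \<open>r = p\<close> is the flux of
  the \<open>p\<close>-Laplacian and on reals with \<open>r = ps\<close> the critical nonlinearity,
  so both terms share their estimates.\<close>

definition dual_pow :: "real \<Rightarrow> 'b::real_inner \<Rightarrow> 'b" where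
  "dual_pow r a = norm a powr (r - 2) *\<^sub>R a"

lemma dual_pow_0 [simp]: "dual_pow r 0 = 0"
  by (simp add: dual_pow_def)

lemma norm_dual_pow: "norm (dual_pow r a) = norm a powr (r - 1)"
proof (cases "a = 0")
  case False
  have "norm a powr (r - 2) * norm a powr 1 = norm a powr (r - 1)"
    by (subst powr_add[symmetric]) simp
  then show ?thesis using False by (simp add: dual_pow_def)
qed (simp add: dual_pow_def)

lemma dual_pow_scale: "c > 0 \<Longrightarrow> dual_pow r (c *\<^sub>R a) = c powr (r - 1) *\<^sub>R dual_pow r a"
proof -
  assume c: "c > 0"
  have "c powr (r - 2) * c powr 1 = c powr (r - 1)"
    by (subst powr_add[symmetric]) simp
  with c show ?thesis by (simp add: dual_pow_def powr_mult mult_ac)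
qed

lemma dual_pow_inner_self: "dual_pow r a \<bullet> a = norm a powr r"
proof (cases "a = 0")
  case False
  have "norm a powr (r - 2) * norm a powr 2 = norm a powr r"
    by (subst powr_add[symmetric]) simp
  then show ?thesis using False by (simp add: dual_pow_def dot_square_norm)
qed simp

text \<open>Away from the origin the formula is continuous. At the origin the factor with exponent
  \<open>r - 2\<close> may blow up, so the limit is read off from the norm, a power with the
  positive exponent \<open>r - 1\<close>.\<close>

lemma continuous_dual_pow:
  assumes "r > 1" shows "continuous_on UNIV (dual_pow r :: 'b::real_inner \<Rightarrow> 'b)"
proof (intro continuous_at_imp_continuous_on ballI)
  fix a :: 'b
  show "isCont (dual_pow r) a"
  proof (cases "a = 0")
    case False
    then show ?thesis unfolding dual_pow_def
      by (intro continuous_intros) auto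
  next
    case True
    have "((\<lambda>b::'b. norm b powr (r - 1)) \<longlongrightarrow> norm (0::'b) powr (r - 1)) (at 0)"
      using assms by (intro tendsto_powr2 tendsto_norm tendsto_const tendsto_ident_at always_eventually) auto
    then have "((\<lambda>b::'b. norm (dual_pow r b)) \<longlongrightarrow> 0) (at 0)"
      by (simp add: norm_dual_pow)
    then show ?thesis using True by (simp add: isCont_def tendsto_norm_zero_iff)
  qed
qed

text \<open>The Cauchy-Schwarz inequality in the mixed terms reduces the claim to the norms
  \<open>s\<close> and \<open>t\<close>, where it says that \<open>x powr (r - 1)\<close> is
  increasing. Equality forces \<open>s = t\<close>, and then the difference of the duality maps is
  \<open>s powr (r - 2)\<close> times \<open>a - b\<close>.\<close>

lemma dual_pow_strict_mono:
  fixes a b :: "'b::real_inner"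
  assumes r: "r > 1"
  shows "(dual_pow r a - dual_pow r b) \<bullet> (a - b) \<ge> 0"
    and "(dual_pow r a - dual_pow r b) \<bullet> (a - b) = 0 \<Longrightarrow> a = b"
proof -
  define s t where "s = norm a" and "t = norm b"
  have st: "s \<ge> 0" "t \<ge> 0" by (auto simp: s_def t_def)
  have pw: "x powr (r - 1) * x = x powr r" if "x \<ge> 0" for x :: real
    using that powr_mult_base[of x "r-1"] by (simp add: mult.commute)
  have expand: "(dual_pow r a - dual_pow r b) \<bullet> (a - b)
      = s powr r + t powr r - dual_pow r a \<bullet> b - dual_pow r b \<bullet> a"
    by (simp add: inner_diff_left inner_diff_right dual_pow_inner_self s_def t_def)
  have c1: "dual_pow r a \<bullet> b \<le> s powr (r - 1) * t"
    using norm_cauchy_schwarz[of "dual_pow r a" b] by (simp add: norm_dual_pow s_def t_def)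
  have c2: "dual_pow r b \<bullet> a \<le> t powr (r - 1) * s"
    using norm_cauchy_schwarz[of "dual_pow r b" a] by (simp add: norm_dual_pow s_def t_def)
  have fac: "s powr r + t powr r - s powr (r - 1) * t - t powr (r - 1) * s
      = (s powr (r - 1) - t powr (r - 1)) * (s - t)"
    using pw st by (simp add: algebra_simps flip: pw)
  have pos: "(s powr (r - 1) - t powr (r - 1)) * (s - t) \<ge> 0"
  proof (cases "s \<le> t")
    case True
    then have "s powr (r-1) \<le> t powr (r-1)" using st r by (intro powr_mono2) auto
    with True show ?thesis by (intro mult_nonpos_nonpos) auto
  next
    case False
    then have "t powr (r-1) \<le> s powr (r-1)" using st r by (intro powr_mono2) auto
    with False show ?thesis by (intro mult_nonneg_nonneg) auto
  qed
  show ge: "(dual_pow r a - dual_pow r b) \<bullet> (a - b) \<ge> 0"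
    using expand c1 c2 fac pos by linarith
  assume z: "(dual_pow r a - dual_pow r b) \<bullet> (a - b) = 0"
  have "(s powr (r - 1) - t powr (r - 1)) * (s - t) = 0"
    using expand c1 c2 fac pos z by linarith
  then have eq: "s = t"
    using st r powr_less_mono2[of "r-1" s t] powr_less_mono2[of "r-1" t s] by fastforce
  show "a = b"
  proof (cases "s = 0")
    case True then show ?thesis using eq by (simp add: s_def t_def)
  next
    case False
    have "s powr (r - 2) * (norm (a - b))^2 = 0"
    proof -
      have "dual_pow r a - dual_pow r b = s powr (r - 2) *\<^sub>R (a - b)"
        using eq by (simp add: dual_pow_def s_def t_def scaleR_diff_right)
      then show ?thesis using z by (simp add: power2_norm_eq_inner)
    qed
    then show ?thesis using False by simp
  qed
qed

text \<open>Mean value theorem on the two halves of the interval: the slope on the left half is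
  strictly smaller, because \<open>r - 1 > 0\<close> makes the derivative strictly
  increasing.\<close>

lemma powr_midpoint:
  fixes s t :: real
  assumes "s \<ge> 0" "t \<ge> 0" "r > 1"
  shows "((s + t) / 2) powr r \<le> (s powr r + t powr r) / 2"
    and "((s + t) / 2) powr r = (s powr r + t powr r) / 2 \<Longrightarrow> s = t"
proof -
  have strict: "((s + t) / 2) powr r < (s powr r + t powr r) / 2" if "0 \<le> s" "s < t" for s t :: real
  proof -
    define m where "m = (s + t) / 2"
    have m: "s < m" "m < t" using that by (auto simp: m_def)
    have cont: "continuous_on {x..y} (\<lambda>x. x powr r)" if "x \<ge> 0" for x y :: real
      using that assms(3) by (intro continuous_on_powr' continuous_intros) auto
    have der: "((\<lambda>x. x powr r) has_real_derivative r * x powr (r - 1)) (at x)" if "x > 0" for x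
      using that assms(3) by (auto intro!: derivative_eq_intros simp: powr_diff)
    have "\<exists>z>m. z < t \<and> t powr r - m powr r = (t - m) * (r * z powr (r - 1))"
      using m that by (intro MVT2 der) auto
    then obtain \<xi> where \<xi>: "m < \<xi>" "\<xi> < t" "t powr r - m powr r = (t - m) * (r * \<xi> powr (r - 1))"
      by blast
    \<comment> \<open>The left end \<open>s\<close> may be 0, outside the range of the derivative
      rule \<open>der\<close>, so this half uses the version of the mean value theorem that asks for
      continuity on the closed interval and derivatives only inside.\<close>
    have "\<exists>\<eta>. s < \<eta> \<and> \<eta> < m \<and> m powr r - s powr r = (m - s) * (r * \<eta> powr (r - 1))"
    proof -
      have "\<exists>l z. s < z \<and> z < m \<and> ((\<lambda>x. x powr r) has_real_derivative l) (at z) \<and> m powr r - s powr r = (m - s) * l"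
        using m that der by (intro MVT cont) (auto simp: real_differentiable_def intro!: exI der)
      then obtain l z where lz: "s < z" "z < m" "((\<lambda>x. x powr r) has_real_derivative l) (at z)" "m powr r - s powr r = (m - s) * l" by blast
      moreover have "l = r * z powr (r - 1)" using lz that by (intro DERIV_unique[OF lz(3) der]) auto
      ultimately show ?thesis by blast
    qed
    then obtain \<eta> where \<eta>: "s < \<eta>" "\<eta> < m" "m powr r - s powr r = (m - s) * (r * \<eta> powr (r - 1))" by blast
    have "\<eta> powr (r-1) < \<xi> powr (r-1)" using \<xi> \<eta> that assms(3) by (intro powr_less_mono2) auto
    then have "(t - m) * (r * \<eta> powr (r - 1)) < (t - m) * (r * \<xi> powr (r - 1))"
      using m assms(3) by simp
    moreover have "m - s = t - m" by (simp add: m_def field_simps)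
    ultimately have "m powr r - s powr r < t powr r - m powr r"
      using \<xi>(3) \<eta>(3) by metis
    then show ?thesis by (simp add: m_def field_simps)
  qed
  show "((s + t) / 2) powr r \<le> (s powr r + t powr r) / 2"
    using strict[of s t] strict[of t s] assms by (cases s t rule: linorder_cases) (auto simp: add.commute)
  show "s = t" if "((s + t) / 2) powr r = (s powr r + t powr r) / 2"
    using strict[of s t] strict[of t s] assms that by (cases s t rule: linorder_cases) (auto simp: add.commute)
qed

text \<open>The triangle inequality followed by scalar convexity. Equality in the scalar step gives
  equal norms, equality in the triangle inequality gives vectors in the same direction, and together
  they give \<open>a = b\<close>.\<close>

lemma norm_powr_midpoint:
  fixes a b :: "'b::real_inner"
  assumes "r > 1"
  shows "norm ((1/2) *\<^sub>R (a + b)) powr r \<le> (norm a powr r + norm b powr r) / 2"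
    and "norm ((1/2) *\<^sub>R (a + b)) powr r = (norm a powr r + norm b powr r) / 2 \<Longrightarrow> a = b"
proof -
  have 1: "norm ((1/2) *\<^sub>R (a + b)) powr r \<le> ((norm a + norm b) / 2) powr r"
    using norm_triangle_ineq[of a b] assms by (intro powr_mono2) auto
  have 2: "((norm a + norm b) / 2) powr r \<le> (norm a powr r + norm b powr r) / 2"
    using assms by (intro powr_midpoint) auto
  show "norm ((1/2) *\<^sub>R (a + b)) powr r \<le> (norm a powr r + norm b powr r) / 2" using 1 2 by simp
  assume eq: "norm ((1/2) *\<^sub>R (a + b)) powr r = (norm a powr r + norm b powr r) / 2"
  then have e1: "((norm a + norm b) / 2) powr r = (norm a powr r + norm b powr r) / 2"
    and e2: "norm ((1/2) *\<^sub>R (a + b)) powr r = ((norm a + norm b) / 2) powr r"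
    using 1 2 by linarith+
  have n: "norm a = norm b" by (rule powr_midpoint(2)[OF norm_ge_zero norm_ge_zero assms e1])
  have "norm ((1/2) *\<^sub>R (a + b)) = (norm a + norm b) / 2"
    using powr_less_mono2[of r "norm ((1/2) *\<^sub>R (a + b))" "(norm a + norm b) / 2"] assms e2
      norm_triangle_ineq[of a b] by fastforce
  then have "norm (a + b) = norm a + norm b" by simp
  from iffD1[OF norm_triangle_eq this] show "a = b" using n by (cases "b = 0") auto
qed

section \<open>Homogeneous inequalities for pairs of vectors\<close>

lemma continuous_norm_powr:
  fixes f :: "'c::topological_space \<Rightarrow> 'b::real_normed_vector"
  assumes "continuous_on S f" "r > 0" shows "continuous_on S (\<lambda>x. norm (f x) powr r)"
  using assms by (intro continuous_on_powr' continuous_intros) auto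

lemma norm_powr_scaleR: "c > 0 \<Longrightarrow> norm (c *\<^sub>R a) powr r = c powr r * norm a powr r"
  by (simp add: powr_mult)

text \<open>The interpolation on the product space, with
  \<open>norm a powr r + norm b powr r\<close> as the reference function that is positive away from
  the origin. Each application only has to know where \<open>\<Psi>\<close> vanishes.\<close>

lemma pair_interpolation:
  fixes \<Phi> \<Psi> :: "'b::euclidean_space \<Rightarrow> 'b \<Rightarrow> real"
  assumes c: "continuous_on UNIV (\<lambda>z. \<Phi> (fst z) (snd z))" "continuous_on UNIV (\<lambda>z. \<Psi> (fst z) (snd z))"
    and h\<Phi>: "\<And>c a b. c > 0 \<Longrightarrow> \<Phi> (c *\<^sub>R a) (c *\<^sub>R b) = c powr r * \<Phi> a b"
    and h\<Psi>: "\<And>c a b. c > 0 \<Longrightarrow> \<Psi> (c *\<^sub>R a) (c *\<^sub>R b) = c powr r * \<Psi> a b"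
    and \<Psi>: "\<And>a b. \<Psi> a b \<ge> 0"
    and zero: "\<And>a b. \<Psi> a b = 0 \<Longrightarrow> \<Phi> a b \<le> 0"
    and r: "r > 0" and e: "\<epsilon> > 0"
  shows "\<exists>C\<ge>0. \<forall>a b. \<Phi> a b \<le> \<epsilon> * (norm a powr r + norm b powr r) + C * \<Psi> a b"
proof -
  have "\<exists>C\<ge>0. \<forall>z. \<Phi> (fst z) (snd z) \<le> \<epsilon> * (norm (fst z) powr r + norm (snd z) powr r) + C * \<Psi> (fst z) (snd z)"
  proof (rule homogeneous_interpolation[where r = r])
    show "continuous_on UNIV (\<lambda>z::'b\<times>'b. norm (fst z) powr r + norm (snd z) powr r)"
      using r by (intro continuous_on_add continuous_norm_powr continuous_intros) auto
    show "norm (fst z) powr r + norm (snd z) powr r > 0" if "z \<noteq> 0" for z :: "'b \<times> 'b"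
      using that by (cases z) (auto simp: zero_prod_def add_pos_nonneg add_nonneg_pos)
  qed (use assms in \<open>auto simp: powr_mult algebra_simps\<close>)
  then show ?thesis by auto
qed

text \<open>The midpoint defect of a strictly convex power vanishes only on the diagonal, so it
  dominates the distance up to a small error. Integrated, this is uniform convexity of
  \<open>L^r\<close>, in place of Clarkson's inequalities and their case distinction at
  \<open>r = 2\<close>.\<close>

lemma uniform_convexity_powr:
  fixes r :: real assumes r: "r > 1" and e: "\<epsilon> > 0"
  shows "\<exists>C\<ge>0. \<forall>a b::'b::euclidean_space. norm (a - b) powr r \<le> \<epsilon> * (norm a powr r + norm b powr r)
     + C * ((norm a powr r + norm b powr r) / 2 - norm ((1/2) *\<^sub>R (a + b)) powr r)"
proof (rule pair_interpolation[where r = r])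
  show "continuous_on UNIV (\<lambda>z::'b\<times>'b. norm (fst z - snd z) powr r)"
    using r by (intro continuous_norm_powr continuous_intros) auto
  show "continuous_on UNIV (\<lambda>z::'b\<times>'b. (norm (fst z) powr r + norm (snd z) powr r) / 2 - norm ((1/2) *\<^sub>R (fst z + snd z)) powr r)"
    using r by (intro continuous_on_diff continuous_on_divide continuous_on_add continuous_norm_powr continuous_intros) auto
  fix a b :: 'b
  show "(norm a powr r + norm b powr r) / 2 - norm ((1/2) *\<^sub>R (a + b)) powr r \<ge> 0"
    using norm_powr_midpoint[OF r, of a b] by simp
  show "norm (a - b) powr r \<le> 0" if "(norm a powr r + norm b powr r) / 2 - norm ((1/2) *\<^sub>R (a + b)) powr r = 0"
    using norm_powr_midpoint(2)[OF r, of a b] that by simp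
  fix c :: real assume c: "c > 0"
  show "norm (c *\<^sub>R a - c *\<^sub>R b) powr r = c powr r * norm (a - b) powr r"
    using c norm_powr_scaleR[OF c, of "a - b" r] by (simp add: scaleR_diff_right)
  have "norm ((1/2) *\<^sub>R (c *\<^sub>R a + c *\<^sub>R b)) powr r = c powr r * norm ((1/2) *\<^sub>R (a + b)) powr r"
    using norm_powr_scaleR[OF c, of "(1/2) *\<^sub>R (a + b)" r] by (simp add: scaleR_add_right mult.commute)
  then show "(norm (c *\<^sub>R a) powr r + norm (c *\<^sub>R b) powr r) / 2 - norm ((1/2) *\<^sub>R (c *\<^sub>R a + c *\<^sub>R b)) powr r =
     c powr r * ((norm a powr r + norm b powr r) / 2 - norm ((1/2) *\<^sub>R (a + b)) powr r)"
    by (simp only: norm_powr_scaleR[OF c]) (simp add: algebra_simps)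
qed (use r e in auto)

lemma dual_pow_pair_scale:
  fixes a b :: "'b::real_inner"
  assumes "c > 0" shows "dual_pow r (c *\<^sub>R a) \<bullet> (c *\<^sub>R b) = c powr r * (dual_pow r a \<bullet> b)"
proof -
  have "c powr (r - 1) * c = c powr r" using assms powr_mult_base[of c "r-1"] by (simp add: mult.commute)
  then show ?thesis using assms by (simp add: dual_pow_scale mult.commute)
qed

lemma continuous_dual_pow_compose:
  assumes "r > 1" "continuous_on S f" shows "continuous_on S (\<lambda>x. dual_pow r (f x :: 'b::real_inner))"
  using continuous_on_compose2[OF continuous_dual_pow[OF assms(1)] assms(2)] by auto

text \<open>The monotonicity defect of the flux vanishes only for \<open>v = 0\<close>, hence it
  dominates \<open>norm v powr r\<close> up to a small error. This turns a vanishing defect into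
  convergence of gradients.\<close>

lemma dual_pow_coercive:
  fixes r :: real assumes r: "r > 1" and e: "\<epsilon> > 0"
  shows "\<exists>C\<ge>0. \<forall>v u::'b::euclidean_space. norm v powr r \<le> \<epsilon> * (norm v powr r + norm u powr r)
     + C * ((dual_pow r (v + u) - dual_pow r u) \<bullet> v)"
proof (rule pair_interpolation[where r = r])
  show "continuous_on UNIV (\<lambda>z::'b\<times>'b. norm (fst z) powr r)"
    using r by (intro continuous_norm_powr continuous_intros) auto
  show "continuous_on UNIV (\<lambda>z::'b\<times>'b. (dual_pow r (fst z + snd z) - dual_pow r (snd z)) \<bullet> fst z)"
    using r by (intro continuous_intros continuous_dual_pow_compose) auto
  fix v u :: 'b
  show "(dual_pow r (v + u) - dual_pow r u) \<bullet> v \<ge> 0"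
    using dual_pow_strict_mono(1)[OF r, of "v + u" u] by simp
  show "norm v powr r \<le> 0" if "(dual_pow r (v + u) - dual_pow r u) \<bullet> v = 0"
    using dual_pow_strict_mono(2)[OF r, of "v + u" u] that by simp
  fix c :: real assume c: "c > 0"
  show "norm (c *\<^sub>R v) powr r = c powr r * norm v powr r" by (rule norm_powr_scaleR[OF c])
  show "(dual_pow r (c *\<^sub>R v + c *\<^sub>R u) - dual_pow r (c *\<^sub>R u)) \<bullet> c *\<^sub>R v =
       c powr r * ((dual_pow r (v + u) - dual_pow r u) \<bullet> v)"
    using dual_pow_pair_scale[OF c, of r "v + u" v] dual_pow_pair_scale[OF c, of r u v]
    by (simp only: inner_diff_left scaleR_add_right) (simp add: algebra_simps)
qed (use r e in auto)

text \<open>The remainder vanishes for \<open>u = 0\<close>, so the small factor can sit on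
  \<open>v\<close> and the large one on \<open>u\<close>; the small multiple of
  \<open>norm u powr r\<close> from the interpolation is absorbed into the large one. In the
  applications \<open>v\<close> runs through a bounded sequence and \<open>u\<close> is
  fixed.\<close>

lemma brezis_lieb_pointwise:
  fixes \<Phi> :: "'b::euclidean_space \<Rightarrow> 'b \<Rightarrow> real"
  assumes c: "continuous_on UNIV (\<lambda>z. \<Phi> (fst z) (snd z))"
    and h\<Phi>: "\<And>c a b. c > 0 \<Longrightarrow> \<Phi> (c *\<^sub>R a) (c *\<^sub>R b) = c powr r * \<Phi> a b"
    and zero: "\<And>a. \<Phi> a 0 = 0"
    and r: "r > 0" and e: "\<epsilon> > 0"
  shows "\<exists>C\<ge>0. \<forall>v u. \<bar>\<Phi> v u\<bar> \<le> \<epsilon> * norm v powr r + C * norm u powr r"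
proof -
  have "\<exists>C\<ge>0. \<forall>v u. \<bar>\<Phi> v u\<bar> \<le> \<epsilon> * (norm v powr r + norm u powr r) + C * norm u powr r"
  proof (rule pair_interpolation[where r = r])
    show "continuous_on UNIV (\<lambda>z::'b\<times>'b. norm (snd z) powr r)"
      using r by (intro continuous_norm_powr continuous_intros) auto
    show "continuous_on UNIV (\<lambda>z. \<bar>\<Phi> (fst z) (snd z)\<bar>)" by (intro continuous_intros c)
  qed (use r e zero h\<Phi> in \<open>auto simp: powr_mult abs_mult\<close>)
  then obtain C where C: "C \<ge> 0" "\<And>v u. \<bar>\<Phi> v u\<bar> \<le> \<epsilon> * (norm v powr r + norm u powr r) + C * norm u powr r" by blast
  show ?thesis
  proof (intro exI[of _ "C + \<epsilon>"] conjI allI)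
    fix v u show "\<bar>\<Phi> v u\<bar> \<le> \<epsilon> * norm v powr r + (C + \<epsilon>) * norm u powr r"
      using C(2)[of v u] by (simp add: algebra_simps)
  qed (use C e in auto)
qed

section \<open>Convergence in the mean\<close>

text \<open>Dominated convergence in the manner of Brezis and Lieb: the part of
  \<open>\<Phi> j\<close> exceeding \<open>\<epsilon> * A j\<close> is dominated by a multiple of
  the fixed function \<open>B\<close> and tends to 0 almost everywhere, while the rest contributes
  at most \<open>\<epsilon> * K\<close>. The integrals of \<open>A j\<close> need only be bounded,
  not convergent.\<close>

lemma integral_vanishing:
  fixes \<Phi> A :: "nat \<Rightarrow> 'a \<Rightarrow> real" and B :: "'a \<Rightarrow> real"
  assumes A: "\<And>j. integrable M (A j)" "\<And>j. (\<integral>x. A j x \<partial>M) \<le> K" "\<And>j. AE x in M. 0 \<le> A j x"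
    and B: "integrable M B"
    and lim: "AE x in M. (\<lambda>j. \<Phi> j x) \<longlonglongrightarrow> 0"
    and bound: "\<And>\<epsilon>. \<epsilon> > 0 \<Longrightarrow> \<exists>C\<ge>0. \<forall>j. AE x in M. \<bar>\<Phi> j x\<bar> \<le> \<epsilon> * A j x + C * B x"
  shows "(\<lambda>j. \<integral>x. \<Phi> j x \<partial>M) \<longlonglongrightarrow> 0"
proof -
  \<comment> \<open>A non-measurable \<open>\<Phi> j\<close> has Bochner integral 0, so it may be replaced by 0.\<close>
  define \<Psi> where "\<Psi> j = (if \<Phi> j \<in> borel_measurable M then \<Phi> j else (\<lambda>_. 0))" for j
  have int_eq: "(\<integral>x. \<Phi> j x \<partial>M) = (\<integral>x. \<Psi> j x \<partial>M)" for j
    by (cases "integrable M (\<Phi> j)") (auto simp: \<Psi>_def not_integrable_integral_eq)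
  have meas [measurable]: "\<Psi> j \<in> borel_measurable M" for j by (simp add: \<Psi>_def)
  have le: "\<bar>\<Psi> j x\<bar> \<le> \<bar>\<Phi> j x\<bar>" for j x by (simp add: \<Psi>_def)
  have A_nn: "0 \<le> (\<integral>x. A j x \<partial>M)" for j using A(3) by (rule integral_nonneg_AE)
  then have K: "K \<ge> 0" using A(2) by (meson order_trans)
  have "\<exists>N. \<forall>j\<ge>N. \<bar>\<integral>x. \<Psi> j x \<partial>M\<bar> < e" if e: "e > 0" for e
  proof -
    define \<epsilon> where "\<epsilon> = e / (2 * (K + 1))"
    have \<epsilon>: "\<epsilon> > 0" using e K by (simp add: \<epsilon>_def)
    have \<epsilon>K: "\<epsilon> * K < e / 2 + 0" using e K by (simp add: \<epsilon>_def field_simps)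
    obtain C where C: "C \<ge> 0" "\<And>j. AE x in M. \<bar>\<Phi> j x\<bar> \<le> \<epsilon> * A j x + C * B x"
      using bound[OF \<epsilon>] by blast
    define G where "G j x = max 0 (\<bar>\<Psi> j x\<bar> - \<epsilon> * A j x)" for j x
    have [measurable]: "A j \<in> borel_measurable M" for j using A(1) by auto
    have [measurable]: "G j \<in> borel_measurable M" for j unfolding G_def by measurable
    have Gb: "AE x in M. norm (G j x) \<le> C * \<bar>B x\<bar>" for j
      using C(2)[of j]
    proof eventually_elim
      case (elim x)
      moreover have "C * B x \<le> C * \<bar>B x\<bar>" "0 \<le> C * \<bar>B x\<bar>" using C(1) by (auto intro: mult_left_mono)
      ultimately show ?case using le[of j x] by (auto simp: G_def)
    qed
    have Glim: "AE x in M. (\<lambda>j. G j x) \<longlonglongrightarrow> 0"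
    proof -
      have "AE x in M. \<forall>j. 0 \<le> A j x" using A(3) by (simp add: AE_all_countable)
      with lim show ?thesis
      proof eventually_elim
        case (elim x)
        have 1: "\<forall>j. 0 \<le> G j x" by (simp add: G_def)
        have 2: "\<forall>j. G j x \<le> \<bar>\<Phi> j x\<bar>"
        proof
          fix j
          have "0 \<le> \<epsilon> * A j x" using elim(2) \<epsilon> by simp
          with le[of j x] show "G j x \<le> \<bar>\<Phi> j x\<bar>" by (simp add: G_def)
        qed
        show ?case
          by (rule tendsto_sandwich[OF always_eventually[OF 1] always_eventually[OF 2]])
            (use tendsto_rabs_zero[OF elim(1)] in auto)
      qed
    qed
    have "(\<lambda>j. \<integral>x. G j x \<partial>M) \<longlonglongrightarrow> (\<integral>x. 0 \<partial>M)"
      by (rule integral_dominated_convergence[where w = "\<lambda>x. C * \<bar>B x\<bar>"]) (use B Gb Glim in auto)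
    then have "\<forall>\<^sub>F j in sequentially. (\<integral>x. G j x \<partial>M) < e / 2"
      using e by (intro order_tendstoD(2)) auto
    then obtain N where N: "\<And>j. j \<ge> N \<Longrightarrow> (\<integral>x. G j x \<partial>M) < e / 2"
      by (auto simp: eventually_sequentially)
    have "\<bar>\<integral>x. \<Psi> j x \<partial>M\<bar> < e" if "j \<ge> N" for j
    proof -
      have Gint: "integrable M (G j)"
        by (rule Bochner_Integration.integrable_bound[where f = "\<lambda>x. C * \<bar>B x\<bar>"]) (use B Gb[of j] C(1) in auto)
      have "\<bar>\<integral>x. \<Psi> j x \<partial>M\<bar> \<le> (\<integral>x. \<bar>\<Psi> j x\<bar> \<partial>M)"
        by (rule integral_abs_bound)
      also have "\<dots> \<le> (\<integral>x. G j x + \<epsilon> * A j x \<partial>M)"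
      proof (rule integral_mono_AE')
        show "integrable M (\<lambda>x. G j x + \<epsilon> * A j x)" using Gint A(1) by auto
        show "AE x in M. \<bar>\<Psi> j x\<bar> \<le> G j x + \<epsilon> * A j x" by (auto simp: G_def max_def)
        show "AE x in M. 0 \<le> G j x + \<epsilon> * A j x" by (auto simp: G_def max_def)
      qed
      also have "\<dots> = (\<integral>x. G j x \<partial>M) + \<epsilon> * (\<integral>x. A j x \<partial>M)" using Gint A(1) by simp
      also have "\<dots> < e / 2 + e / 2"
        using N[OF that] \<epsilon>K A(2)[of j] \<epsilon> mult_left_mono[OF A(2)[of j], of \<epsilon>] by linarith
      finally show ?thesis by simp
    qed
    then show ?thesis by blast
  qed
  then show ?thesis unfolding int_eq by (simp add: LIMSEQ_iff)
qed

section \<open>Spaces of integrable powers: convergence, completeness, minimising sequences\<close>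

definition lp :: "'a measure \<Rightarrow> real \<Rightarrow> ('a \<Rightarrow> 'b::euclidean_space) \<Rightarrow> bool" where
  "lp M r f \<longleftrightarrow> f \<in> borel_measurable M \<and> integrable M (\<lambda>x. norm (f x) powr r)"

text \<open>Convergence is stated for the \<open>r\<close>-th power of the distance, so that the
  quasi-triangle inequality with factor \<open>2 powr r\<close> suffices. A non-integrable
  difference would have integral 0, hence the predicate is meaningful only together with
  \<open>lp\<close> for the functions involved.\<close>

definition lp_tendsto :: "'a measure \<Rightarrow> real \<Rightarrow> (nat \<Rightarrow> 'a \<Rightarrow> 'b::euclidean_space) \<Rightarrow> ('a \<Rightarrow> 'b) \<Rightarrow> bool" where
  "lp_tendsto M r f g \<longleftrightarrow> (\<lambda>n. \<integral>x. norm (f n x - g x) powr r \<partial>M) \<longlonglongrightarrow> 0"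

lemma lp_measurable [measurable_dest]: "lp M r f \<Longrightarrow> f \<in> borel_measurable M"
  by (simp add: lp_def)

lemma lp_integrable: "lp M r f \<Longrightarrow> integrable M (\<lambda>x. norm (f x) powr r)"
  by (simp add: lp_def)

lemma norm_add_powr_le:
  fixes a b :: "'b::real_normed_vector"
  assumes "r \<ge> 0" shows "norm (a + b) powr r \<le> 2 powr r * (norm a powr r + norm b powr r)"
proof -
  have "norm (a + b) powr r \<le> (2 * max (norm a) (norm b)) powr r"
    using assms norm_triangle_ineq[of a b] by (intro powr_mono2) auto
  also have "\<dots> = 2 powr r * max (norm a) (norm b) powr r" by (simp add: powr_mult)
  also have "\<dots> \<le> 2 powr r * (norm a powr r + norm b powr r)"
    by (intro mult_left_mono) (auto simp: max_def)
  finally show ?thesis .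
qed

lemma lpI_bound:
  assumes "f \<in> borel_measurable M" "integrable M g" "AE x in M. norm (f x) powr r \<le> g x"
  shows "lp M r f"
  unfolding lp_def
proof
  show "integrable M (\<lambda>x. norm (f x) powr r)"
    using assms by (intro Bochner_Integration.integrable_bound[OF assms(2)]) (auto elim: eventually_mono)
qed fact

lemma lp_add: "lp M r f \<Longrightarrow> lp M r g \<Longrightarrow> r \<ge> 0 \<Longrightarrow> lp M r (\<lambda>x. f x + g x)"
  by (rule lpI_bound[where g = "\<lambda>x. 2 powr r * (norm (f x) powr r + norm (g x) powr r)"])
    (auto simp: lp_def norm_add_powr_le)

lemma lp_mult_bounded:
  assumes f: "lp M r f" and [measurable]: "c \<in> borel_measurable M" and c: "AE x in M. \<bar>c x\<bar> \<le> K" and r: "r \<ge> 0"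
  shows "lp M r (\<lambda>x. c x *\<^sub>R f x)"
proof (rule lpI_bound[where g = "\<lambda>x. K powr r * norm (f x) powr r"])
  show "AE x in M. norm (c x *\<^sub>R f x) powr r \<le> K powr r * norm (f x) powr r"
    using c by eventually_elim (auto simp: powr_mult r intro!: mult_right_mono powr_mono2)
  show "integrable M (\<lambda>x. K powr r * norm (f x) powr r)" using f by (auto simp: lp_def)
  show "(\<lambda>x. c x *\<^sub>R f x) \<in> borel_measurable M" using f by (auto simp: lp_def)
qed

lemma lp_scaleR: "lp M r f \<Longrightarrow> lp M r (\<lambda>x. c *\<^sub>R f x)"
  by (auto simp: lp_def powr_mult)

lemma lp_diff: "lp M r f \<Longrightarrow> lp M r g \<Longrightarrow> r \<ge> 0 \<Longrightarrow> lp M r (\<lambda>x. f x - g x)"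
  using lp_add[of M r f "\<lambda>x. - 1 *\<^sub>R g x"] lp_scaleR[of M r g "-1"] by simp

lemma lp_cong_AE:
  "lp M r f \<Longrightarrow> AE x in M. f x = g x \<Longrightarrow> g \<in> borel_measurable M \<Longrightarrow> lp M r g"
  by (rule lpI_bound[where g = "\<lambda>x. norm (f x) powr r"]) (auto simp: lp_def elim: eventually_mono)

lemma lp_dom:
  assumes "lp M r f" "g \<in> borel_measurable M" "AE x in M. norm (g x) \<le> norm (f x)" "r \<ge> 0"
  shows "lp M r g"
  by (rule lpI_bound[where g = "\<lambda>x. norm (f x) powr r"])
    (use assms in \<open>auto simp: lp_def powr_mono2 elim: eventually_mono\<close>)

lemma lp_tendsto_squeeze:
  assumes "(\<lambda>n. \<integral>x. g n x \<partial>M) \<longlonglongrightarrow> 0" "\<And>n. integrable M (g n)"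
    "\<And>n. AE x in M. norm (f n x - l x) powr r \<le> g n x"
  shows "lp_tendsto M r f l"
  unfolding lp_tendsto_def
proof (rule tendsto_sandwich[OF _ _ tendsto_const assms(1)])
  show "\<forall>\<^sub>F n in sequentially. 0 \<le> (\<integral>x. norm (f n x - l x) powr r \<partial>M)" by auto
  show "\<forall>\<^sub>F n in sequentially. (\<integral>x. norm (f n x - l x) powr r \<partial>M) \<le> (\<integral>x. g n x \<partial>M)"
  proof (intro always_eventually allI)
    fix n
    have "AE x in M. 0 \<le> g n x"
      using assms(3)[of n] by eventually_elim (meson order_trans powr_ge_zero)
    with assms(2,3) show "(\<integral>x. norm (f n x - l x) powr r \<partial>M) \<le> (\<integral>x. g n x \<partial>M)"
      by (rule integral_mono_AE')
  qed
qed

lemma lp_tendsto_add: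
  assumes "lp_tendsto M r f f'" "lp_tendsto M r g g'" "\<And>n. lp M r (f n)" "\<And>n. lp M r (g n)"
    "lp M r f'" "lp M r g'" "r \<ge> 0"
  shows "lp_tendsto M r (\<lambda>n x. f n x + g n x) (\<lambda>x. f' x + g' x)"
proof (rule lp_tendsto_squeeze)
  let ?g = "\<lambda>n x. 2 powr r * (norm (f n x - f' x) powr r + norm (g n x - g' x) powr r)"
  have i: "integrable M (\<lambda>x. norm (f n x - f' x) powr r)" "integrable M (\<lambda>x. norm (g n x - g' x) powr r)" for n
    using assms by (auto intro!: lp_integrable lp_diff)
  then show "integrable M (?g n)" for n by auto
  have "(\<lambda>n. 2 powr r * ((\<integral>x. norm (f n x - f' x) powr r \<partial>M) + (\<integral>x. norm (g n x - g' x) powr r \<partial>M))) \<longlonglongrightarrow> 2 powr r * (0 + 0)"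
    using assms(1,2) unfolding lp_tendsto_def by (intro tendsto_intros)
  then show "(\<lambda>n. \<integral>x. ?g n x \<partial>M) \<longlonglongrightarrow> 0" using i by simp
  show "AE x in M. norm (f n x + g n x - (f' x + g' x)) powr r \<le> ?g n x" for n
    using norm_add_powr_le[OF assms(7), of "f n _ - f' _" "g n _ - g' _"] by (auto simp: algebra_simps)
qed

lemma lp_tendsto_scaleR:
  assumes "lp_tendsto M r f f'"
  shows "lp_tendsto M r (\<lambda>n x. c *\<^sub>R f n x) (\<lambda>x. c *\<^sub>R f' x)"
  using tendsto_mult_left[OF assms[unfolded lp_tendsto_def], of "\<bar>c\<bar> powr r"]
  by (simp add: lp_tendsto_def powr_mult flip: scaleR_diff_right)

lemma lp_tendsto_subseq: "lp_tendsto M r f g \<Longrightarrow> strict_mono s \<Longrightarrow> lp_tendsto M r (\<lambda>n. f (s n)) g"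
  unfolding lp_tendsto_def using LIMSEQ_subseq_LIMSEQ by (force simp: o_def)

lemma lp_tendsto_AE_subseq:
  fixes f :: "nat \<Rightarrow> 'a \<Rightarrow> 'b::euclidean_space"
  assumes "lp_tendsto M r f g" "\<And>n. lp M r (f n)" "lp M r g" and r: "r > 0"
  obtains s where "strict_mono (s::nat\<Rightarrow>nat)" "AE x in M. (\<lambda>n. f (s n) x) \<longlonglongrightarrow> g x"
proof -
  have i: "integrable M (\<lambda>x. norm (f n x - g x) powr r)" for n
    using assms by (auto intro!: lp_integrable lp_diff)
  have "(\<lambda>n. \<integral>x. norm (norm (f n x - g x) powr r) \<partial>M) \<longlonglongrightarrow> 0"
    using assms(1) by (simp add: lp_tendsto_def)
  from tendsto_L1_AE_subseq[OF i this] obtain s where s: "strict_mono s"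
    "AE x in M. (\<lambda>n. norm (f (s n) x - g x) powr r) \<longlonglongrightarrow> 0" by blast
  have "AE x in M. (\<lambda>n. f (s n) x) \<longlonglongrightarrow> g x" using s(2)
  proof eventually_elim
    case (elim x)
    have "(\<lambda>n. (norm (f (s n) x - g x) powr r) powr (1/r)) \<longlonglongrightarrow> 0 powr (1/r)"
      using r by (intro tendsto_powr2 elim tendsto_const) auto
    then have "(\<lambda>n. norm (f (s n) x - g x)) \<longlonglongrightarrow> 0" using r by (simp add: powr_powr)
    then show ?case by (simp add: tendsto_norm_zero_iff LIM_zero_iff)
  qed
  with s(1) show ?thesis by (rule that)
qed

text \<open>Fatou's lemma has to be applied to extended nonnegative integrals, because integrability
  of the limit is part of the conclusion. It is the only means by which bounds pass to almost
  everywhere limits.\<close>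

lemma lp_fatou:
  fixes f :: "nat \<Rightarrow> 'a \<Rightarrow> 'b::euclidean_space"
  assumes f: "\<And>n. lp M r (f n)" and K: "\<And>n. (\<integral>x. norm (f n x) powr r \<partial>M) \<le> K"
    and lim: "AE x in M. (\<lambda>n. f n x) \<longlonglongrightarrow> g x" and g: "g \<in> borel_measurable M" and r: "r > 0"
  shows "lp M r g" "(\<integral>x. norm (g x) powr r \<partial>M) \<le> K"
proof -
  have [measurable]: "f n \<in> borel_measurable M" for n using f by (auto simp: lp_def)
  note g [measurable]
  have K0: "K \<ge> 0" using K[of 0] by (rule order_trans[rotated]) simp
  have "(\<integral>\<^sup>+x. ennreal (norm (g x) powr r) \<partial>M) = (\<integral>\<^sup>+x. liminf (\<lambda>n. ennreal (norm (f n x) powr r)) \<partial>M)"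
  proof (rule nn_integral_cong_AE, use lim in eventually_elim)
    fix x assume x: "(\<lambda>n. f n x) \<longlonglongrightarrow> g x"
    have "(\<lambda>n. norm (f n x) powr r) \<longlonglongrightarrow> norm (g x) powr r"
      using r x by (intro tendsto_powr2 tendsto_norm tendsto_const) auto
    then have "(\<lambda>n. ennreal (norm (f n x) powr r)) \<longlonglongrightarrow> ennreal (norm (g x) powr r)"
      by (rule tendsto_ennrealI)
    then show "ennreal (norm (g x) powr r) = liminf (\<lambda>n. ennreal (norm (f n x) powr r))"
      by (intro lim_imp_Liminf[symmetric]) auto
  qed
  also have "\<dots> \<le> liminf (\<lambda>n. \<integral>\<^sup>+x. ennreal (norm (f n x) powr r) \<partial>M)"
    by (rule nn_integral_liminf) auto
  also have "\<dots> \<le> liminf (\<lambda>n::nat. ennreal K)"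
  proof (intro Liminf_mono always_eventually allI)
    fix n
    show "(\<integral>\<^sup>+x. ennreal (norm (f n x) powr r) \<partial>M) \<le> ennreal K"
      using K[of n] f[of n] by (subst nn_integral_eq_integral) (auto simp: lp_def intro: ennreal_leI)
  qed
  also have "\<dots> = ennreal K" by (simp add: Liminf_const)
  finally have *: "(\<integral>\<^sup>+x. ennreal (norm (g x) powr r) \<partial>M) \<le> ennreal K" .
  have int: "integrable M (\<lambda>x. norm (g x) powr r)"
    using le_less_trans[OF *] by (intro integrableI_nonneg) auto
  then show "lp M r g" by (simp add: lp_def)
  show "(\<integral>x. norm (g x) powr r \<partial>M) \<le> K"
    using * nn_integral_eq_integral[OF int] K0 by (simp add: ennreal_le_iff)
qed

definition lp_Cauchy :: "'a measure \<Rightarrow> real \<Rightarrow> (nat \<Rightarrow> 'a \<Rightarrow> 'b::euclidean_space) \<Rightarrow> bool" where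
  "lp_Cauchy M r f \<longleftrightarrow> (\<forall>e>0. \<exists>N. \<forall>m\<ge>N. \<forall>n\<ge>N. (\<integral>x. norm (f m x - f n x) powr r \<partial>M) < e)"

text \<open>Of the two factors in the bound one makes the integrals of the weighted increments
  \<open>D k\<close> summable, so that \<open>D k x\<close> tends to 0 for almost every
  \<open>x\<close>; the other is the weight itself, and \<open>D k x < 1\<close> says that the
  increment is at most \<open>(1/2)^k\<close>.\<close>

lemma AE_fast_Cauchy:
  fixes f :: "nat \<Rightarrow> 'a \<Rightarrow> 'b::euclidean_space"
  assumes f: "\<And>n. lp M r (f n)" and r: "r > 0"
    and fast: "\<And>k. (\<integral>x. norm (f (Suc k) x - f k x) powr r \<partial>M) \<le> (1/2)^k * (1/2) powr (k * r)"
  shows "AE x in M. convergent (\<lambda>n. f n x)"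
proof -
  define D where "D k x = 2 powr (k * r) * norm (f (Suc k) x - f k x) powr r" for k x
  have Dint: "integrable M (D k)" for k
    unfolding D_def using f r by (intro integrable_mult_right lp_integrable lp_diff) auto
  have Dle: "(\<integral>x. D k x \<partial>M) \<le> (1/2)^k" for k
  proof -
    have "(\<integral>x. D k x \<partial>M) = 2 powr (k * r) * (\<integral>x. norm (f (Suc k) x - f k x) powr r \<partial>M)"
      unfolding D_def by simp
    also have "\<dots> \<le> 2 powr (k * r) * ((1/2)^k * (1/2) powr (k * r))" by (intro mult_left_mono fast) auto
    also have "\<dots> = (1/2)^k" by (simp add: powr_divide)
    finally show ?thesis by simp
  qed
  have [measurable]: "D k \<in> borel_measurable M" for k using Dint by auto
  have "(\<integral>\<^sup>+x. (\<Sum>k. ennreal (D k x)) \<partial>M) = (\<Sum>k. \<integral>\<^sup>+x. ennreal (D k x) \<partial>M)"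
    by (rule nn_integral_suminf) auto
  also have "\<dots> \<le> (\<Sum>k. ennreal ((1/2)^k))"
  proof (rule suminf_le)
    fix k
    show "(\<integral>\<^sup>+x. ennreal (D k x) \<partial>M) \<le> ennreal ((1/2)^k)"
      using ennreal_leI[OF Dle[of k]] by (subst nn_integral_eq_integral[OF Dint]) (simp add: D_def, assumption)
  qed auto
  also have "\<dots> < \<infinity>"
    by (subst suminf_ennreal2) (auto simp: summable_geometric)
  finally have "AE x in M. (\<Sum>k. ennreal (D k x)) \<noteq> \<infinity>"
    by (intro nn_integral_PInf_AE) auto
  then show ?thesis
  proof eventually_elim
    case (elim x)
    have sD: "summable (\<lambda>k. D k x)" using elim by (intro summable_suminf_not_top) (auto simp: D_def)
    have "(\<lambda>k. D k x) \<longlonglongrightarrow> 0" by (rule summable_LIMSEQ_zero[OF sD])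
    then have "\<forall>\<^sub>F k in sequentially. D k x < 1" by (rule order_tendstoD) auto
    then have ev: "\<forall>\<^sub>F k in sequentially. norm (f (Suc k) x - f k x) \<le> (1/2)^k"
    proof eventually_elim
      case (elim k)
      have "(2 ^ k * norm (f (Suc k) x - f k x)) powr r = D k x"
        by (simp add: D_def powr_mult powr_powr flip: powr_realpow)
      then have "(2 ^ k * norm (f (Suc k) x - f k x)) powr r < 1 powr r" using elim by simp
      then have "2 ^ k * norm (f (Suc k) x - f k x) < 1" using r by (metis linorder_not_less order_less_imp_le powr_mono2 zero_le_one)
      then show ?case by (simp add: field_simps)
    qed
    have "summable (\<lambda>k. f (Suc k) x - f k x)"
      by (rule summable_comparison_test_ev[OF ev]) (auto simp: summable_geometric)
    then have "convergent (\<lambda>n. \<Sum>k<n. f (Suc k) x - f k x)" by (simp add: summable_iff_convergent)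
    then have "convergent (\<lambda>n. f n x - f 0 x)" by (simp add: sum_lessThan_telescope[of "\<lambda>n. f n x"])
    from convergent_add[OF this convergent_const[of "f 0 x"]] show ?case by simp
  qed
qed

text \<open>The theorem of Riesz and Fischer: a rapidly converging subsequence has an almost
  everywhere limit, and Fatou's lemma along it bounds the distance of every late \<open>f m\<close>
  to that limit.\<close>

lemma lp_complete:
  fixes f :: "nat \<Rightarrow> 'a \<Rightarrow> 'b::euclidean_space"
  assumes f: "\<And>n. lp M r (f n)" and C: "lp_Cauchy M r f" and r: "r > 0"
  obtains g s where "lp M r g" "lp_tendsto M r f g" "strict_mono (s::nat\<Rightarrow>nat)"
    "AE x in M. (\<lambda>n. f (s n) x) \<longlonglongrightarrow> g x"
proof -
  have "\<exists>N. \<forall>m\<ge>N. \<forall>n\<ge>N. (\<integral>x. norm (f m x - f n x) powr r \<partial>M) < (1/2)^k * (1/2) powr (k * r)" for k :: nat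
    using C unfolding lp_Cauchy_def by simp
  then obtain N where N: "\<And>k m n. m \<ge> N k \<Longrightarrow> n \<ge> N k \<Longrightarrow> (\<integral>x. norm (f m x - f n x) powr r \<partial>M) < (1/2)^k * (1/2) powr (k * r)"
    by metis
  \<comment> \<open>The recursion makes the indices strictly increasing and at the same time at
    least \<open>N k\<close>.\<close>
  define s where "s = rec_nat (N 0) (\<lambda>k m. max (N (Suc k)) (Suc m))"
  have s0: "s 0 = N 0" "s (Suc k) = max (N (Suc k)) (Suc (s k))" for k by (auto simp: s_def)
  have s: "strict_mono s" by (simp add: strict_mono_Suc_iff s0 less_max_iff_disj)
  have sN: "s k \<ge> N k" for k by (cases k) (auto simp: s0)
  have "AE x in M. convergent (\<lambda>n. f (s n) x)"
  proof (rule AE_fast_Cauchy[OF f r])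
    fix k
    have "s (Suc k) \<ge> N k" using sN[of k] strict_mono_less_eq[OF s, of k "Suc k"] by linarith
    then show "(\<integral>x. norm (f (s (Suc k)) x - f (s k) x) powr r \<partial>M) \<le> (1/2)^k * (1/2) powr (k * r)"
      using N[OF _ sN[of k]] by (intro less_imp_le) auto
  qed
  have [measurable]: "f n \<in> borel_measurable M" for n using f by (auto simp: lp_def)
  define g where "g x = lim (\<lambda>n. f (s n) x)" for x
  have g [measurable]: "g \<in> borel_measurable M" unfolding g_def by measurable
  have lim: "AE x in M. (\<lambda>n. f (s n) x) \<longlonglongrightarrow> g x"
    using \<open>AE x in M. convergent _\<close> by eventually_elim (simp add: g_def convergent_LIMSEQ_iff)
  have diff: "lp M r (\<lambda>x. f n x - f m x)" for n m using f r by (intro lp_diff) auto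
  \<comment> \<open>Here \<open>m\<close> stays fixed and only the second index runs along the
    subsequence; the shift by \<open>n0\<close> puts all of it into the range of the Cauchy
    estimate.\<close>
  have key: "lp M r (\<lambda>x. f m x - g x) \<and> (\<integral>x. norm (f m x - g x) powr r \<partial>M) \<le> e"
    if "e > 0" "\<And>n. n \<ge> n0 \<Longrightarrow> (\<integral>x. norm (f m x - f n x) powr r \<partial>M) < e" for m e n0
  proof -
    have le: "(\<integral>x. norm (f m x - f (s (n + n0)) x) powr r \<partial>M) \<le> e" for n
      using that(2)[of "s (n + n0)"] seq_suble[OF s, of "n + n0"] by linarith
    have lim': "AE x in M. (\<lambda>n. f m x - f (s (n + n0)) x) \<longlonglongrightarrow> f m x - g x"
      using lim by eventually_elim (intro tendsto_intros LIMSEQ_ignore_initial_segment)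
    show ?thesis using lp_fatou[OF diff le lim' _ r] by auto
  qed
  have tend: "lp_tendsto M r f g" unfolding lp_tendsto_def LIMSEQ_iff
  proof (intro allI impI)
    fix e :: real assume e: "e > 0"
    then obtain n0 where n0: "\<And>m n. m \<ge> n0 \<Longrightarrow> n \<ge> n0 \<Longrightarrow> (\<integral>x. norm (f m x - f n x) powr r \<partial>M) < e / 2"
      using C unfolding lp_Cauchy_def by (metis half_gt_zero)
    show "\<exists>no. \<forall>m\<ge>no. norm ((\<integral>x. norm (f m x - g x) powr r \<partial>M) - 0) < e"
      using key[of "e/2" n0, OF _ n0] e by (intro exI[of _ n0]) fastforce
  qed
  obtain n0 where "\<And>m n. m \<ge> n0 \<Longrightarrow> n \<ge> n0 \<Longrightarrow> (\<integral>x. norm (f m x - f n x) powr r \<partial>M) < 1"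
    using C unfolding lp_Cauchy_def by (metis zero_less_one)
  then have "lp M r (\<lambda>x. f n0 x - g x)" using key[of 1 n0 n0] by auto
  from lp_diff[OF f[of n0] this] r have "lp M r (\<lambda>x. f n0 x - (f n0 x - g x))" by simp
  then have "lp M r g" by simp
  with tend s lim show ?thesis using that by blast
qed

text \<open>As in the projection theorem, near-minimisers over convex sets are Cauchy. The infima
  \<open>d n\<close> over the shrinking sets increase to a limit \<open>l\<close>. Two
  near-minimisers with indices beyond \<open>N\<close> have energies at most
  \<open>l + 1 / (N + 1)\<close>, their midpoint lies in \<open>K N\<close> and has energy at least
  \<open>d N\<close>, so the midpoint defect tends to 0 and uniform convexity bounds the
  distance.\<close>

lemma minimizing_Cauchy:
  fixes K :: "nat \<Rightarrow> ('a \<Rightarrow> 'b::euclidean_space) set"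
  assumes r: "r > 1" and ne: "\<And>n. K n \<noteq> {}" and dec: "\<And>m n. m \<le> n \<Longrightarrow> K n \<subseteq> K m"
    and mid: "\<And>n f g. f \<in> K n \<Longrightarrow> g \<in> K n \<Longrightarrow> (\<lambda>x. (1/2) *\<^sub>R (f x + g x)) \<in> K n"
    and K: "\<And>n f. f \<in> K n \<Longrightarrow> lp M r f" "\<And>n f. f \<in> K n \<Longrightarrow> (\<integral>x. norm (f x) powr r \<partial>M) \<le> B"
  obtains k where "\<And>n. k n \<in> K n" "lp_Cauchy M r k"
proof -
  define J where "J f = (\<integral>x. norm (f x) powr r \<partial>M)" for f :: "'a \<Rightarrow> 'b"
  define d where "d n = Inf (J ` K n)" for n
  have bdd: "bdd_below (J ` K n)" for n by (auto intro!: bdd_belowI[of _ 0] simp: J_def)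
  have dle: "d n \<le> J f" if "f \<in> K n" for n f unfolding d_def using that by (intro cInf_lower bdd) auto
  have "d m \<le> d n" if "m \<le> n" for m n
    unfolding d_def using ne bdd dec[OF that] by (intro cInf_superset_mono) auto
  then have inc: "incseq d" by (auto simp: incseq_def)
  have "d n \<le> B" for n using ne[of n] dle[of _ n] K(2) unfolding J_def by (metis ex_in_conv order_trans)
  then obtain l where l: "d \<longlonglongrightarrow> l" "\<And>n. d n \<le> l" using incseq_convergent[OF inc, of B] by blast
  have "\<exists>f\<in>K n. J f < d n + 1 / (n + 1)" for n :: nat
    using cInf_lessD[of "J ` K n" "d n + 1 / (n + 1)"] ne[of n] unfolding d_def by auto
  then have "\<forall>n::nat. \<exists>f. f \<in> K n \<and> J f < d n + 1 / (n + 1)" by blast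
  from choice[OF this] obtain k where k': "\<forall>n::nat. k n \<in> K n \<and> J (k n) < d n + 1 / (n + 1)" by (elim exE)
  have k: "k n \<in> K n" "J (k n) < d n + 1 / (n + 1)" for n :: nat using k' by auto
  have lpk: "lp M r (k n)" for n using K k by blast
  have JB: "J (k n) \<le> B" for n using K(2)[OF k(1)] by (simp add: J_def)
  have B0: "B \<ge> 0" using JB[of 0] by (rule order_trans[rotated]) (simp add: J_def)
  have "lp_Cauchy M r k" unfolding lp_Cauchy_def
  proof (intro allI impI)
    fix e :: real assume e: "e > 0"
    define \<epsilon> where "\<epsilon> = e / (4 * (B + 1))"
    have \<epsilon>: "\<epsilon> > 0" "2 * \<epsilon> * B < e / 2 + 0" using e B0 by (auto simp: \<epsilon>_def field_simps)
    obtain C where C: "C \<ge> 0" "\<And>a b::'b. norm (a - b) powr r \<le> \<epsilon> * (norm a powr r + norm b powr r)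
     + C * ((norm a powr r + norm b powr r) / 2 - norm ((1/2) *\<^sub>R (a + b)) powr r)"
      using uniform_convexity_powr[OF r \<epsilon>(1)] by metis
    have main: "(\<integral>x. norm (k m x - k n x) powr r \<partial>M) \<le> 2 * \<epsilon> * B + C * ((l - d N) + 1 / (real N + 1))"
      if "m \<ge> N" "n \<ge> N" for m n N :: nat
    proof -
      let ?h = "\<lambda>x. (1/2) *\<^sub>R (k m x + k n x)"
      have hK: "?h \<in> K N" using mid[of "k m" N "k n"] k(1) dec that by blast
      note i = lp_integrable[OF lpk[of m]] lp_integrable[OF lpk[of n]] lp_integrable[OF K(1)[OF hK]]
      have "(\<integral>x. norm (k m x - k n x) powr r \<partial>M) \<le> (\<integral>x. \<epsilon> * (norm (k m x) powr r + norm (k n x) powr r)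
         + C * ((norm (k m x) powr r + norm (k n x) powr r) / 2 - norm (?h x) powr r) \<partial>M)"
        using i C(2) r by (intro integral_mono lp_integrable lp_diff lpk) auto
      also have "\<dots> = \<epsilon> * (J (k m) + J (k n)) + C * ((J (k m) + J (k n)) / 2 - J ?h)"
        using i by (simp add: J_def del: norm_scaleR)
      also have "\<dots> \<le> \<epsilon> * (B + B) + C * ((l - d N) + 1 / (real N + 1))"
      proof (intro add_mono mult_left_mono JB C(1))
        have "1 / (real m + 1) \<le> 1 / (real N + 1)" "1 / (real n + 1) \<le> 1 / (real N + 1)"
          using that by (auto simp: field_simps)
        then have "J (k m) \<le> l + 1 / (real N + 1)" "J (k n) \<le> l + 1 / (real N + 1)"
          using less_imp_le[OF k(2)[of m]] less_imp_le[OF k(2)[of n]] l(2)[of m] l(2)[of n]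
          unfolding of_nat_add of_nat_1 by (meson add_mono order_trans)+
        moreover have "(a + b) / 2 - c' \<le> (l - d') + c" if "a \<le> l + c" "b \<le> l + c" "d' \<le> c'" for a b c c' d' :: real
          using that by argo
        ultimately show "(J (k m) + J (k n)) / 2 - J ?h \<le> (l - d N) + 1 / (real N + 1)"
          using dle[OF hK] unfolding of_nat_add of_nat_1 by blast
      qed (use \<epsilon> in auto)
      finally show ?thesis by simp
    qed
    have "(\<lambda>N. 2 * \<epsilon> * B + C * ((l - d N) + 1 / (real N + 1))) \<longlonglongrightarrow> 2 * \<epsilon> * B + C * ((l - l) + 0)"
      using LIMSEQ_inverse_real_of_nat by (intro tendsto_intros l) (auto simp: inverse_eq_divide add.commute)
    then have "\<forall>\<^sub>F N in sequentially. 2 * \<epsilon> * B + C * ((l - d N) + 1 / (real N + 1)) < e"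
      using \<epsilon> e by (intro order_tendstoD(2)[of _ "2 * \<epsilon> * B"]) auto
    then obtain N where "2 * \<epsilon> * B + C * ((l - d N) + 1 / (real N + 1)) < e"
      by (auto simp: eventually_sequentially)
    then show "\<exists>N. \<forall>m\<ge>N. \<forall>n\<ge>N. (\<integral>x. norm (k m x - k n x) powr r \<partial>M) < e"
      using main[of N] by (meson le_less_trans)
  qed
  with k(1) show ?thesis by (rule that)
qed

section \<open>Smooth test functions\<close>

text \<open>Any explicit derivative may be used for checking smoothness, since it must agree with
  the Frechet derivative selected in the definition of \<open>C_k\<close>.\<close>

lemma C_k_SucI:
  assumes "\<And>x. (f has_derivative D x) (at x)" "\<And>b. b \<in> Basis \<Longrightarrow> C_k k (\<lambda>x. D x b)"
  shows "C_k (Suc k) f"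
proof -
  have "frechet_derivative f (at x) = D x" for x
    using frechet_derivative_at[OF assms(1)] by simp
  then show ?thesis using assms by (auto simp: differentiable_def)
qed

lemma C_k_Suc_has_derivative:
  "C_k (Suc k) f \<Longrightarrow> (f has_derivative frechet_derivative f (at x)) (at x)"
  by (simp add: frechet_derivative_works)

lemma C_k_Suc_partial:
  "C_k (Suc k) f \<Longrightarrow> b \<in> Basis \<Longrightarrow> C_k k (\<lambda>x. frechet_derivative f (at x) b)"
  by simp

declare C_k.simps(2) [simp del]

lemma C_k_continuous: "C_k k f \<Longrightarrow> continuous_on UNIV f"
  by (cases k) (auto simp: C_k.simps(2) continuous_at_imp_continuous_on differentiable_imp_continuous_within)

lemma C_k_SucD: "C_k (Suc k) f \<Longrightarrow> C_k k f"
proof (induction k arbitrary: f)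
  case (Suc k)
  show ?case
    by (rule C_k_SucI[OF C_k_Suc_has_derivative[OF Suc.prems]]) (rule Suc.IH[OF C_k_Suc_partial[OF Suc.prems]])
qed (simp add: C_k_continuous)

lemma C_k_const: "C_k k (\<lambda>_. c)"
  by (induction k arbitrary: c) (auto intro!: C_k_SucI[where D = "\<lambda>_ _. 0"])

lemma C_k_add: "C_k k f \<Longrightarrow> C_k k g \<Longrightarrow> C_k k (\<lambda>x. f x + g x)"
proof (induction k arbitrary: f g)
  case (Suc k)
  show ?case
    by (rule C_k_SucI[OF has_derivative_add[OF Suc.prems[THEN C_k_Suc_has_derivative]]])
      (rule Suc.IH[OF Suc.prems[THEN C_k_Suc_partial]])
qed (auto intro!: continuous_intros)

lemma C_k_mult: "C_k k f \<Longrightarrow> C_k k g \<Longrightarrow> C_k k (\<lambda>x. f x * g x)"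
proof (induction k arbitrary: f g)
  case (Suc k)
  show ?case
  proof (rule C_k_SucI[OF has_derivative_mult[OF Suc.prems[THEN C_k_Suc_has_derivative]]])
    fix b :: 'a assume b: "b \<in> Basis"
    show "C_k k (\<lambda>x. f x * frechet_derivative g (at x) b + frechet_derivative f (at x) b * g x)"
      by (intro C_k_add Suc.IH C_k_SucD[OF Suc.prems(1)] C_k_SucD[OF Suc.prems(2)]
          C_k_Suc_partial[OF Suc.prems(1) b] C_k_Suc_partial[OF Suc.prems(2) b])
  qed
qed (auto intro!: continuous_intros)

lemma C_k_cmult: "C_k k f \<Longrightarrow> C_k k (\<lambda>x. c * f x)"
  by (intro C_k_mult C_k_const)

lemma C_k_uminus: "C_k k f \<Longrightarrow> C_k k (\<lambda>x. - f x)"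
  using C_k_cmult[of k f "-1"] by simp

lemma C_k_diff: "C_k k f \<Longrightarrow> C_k k g \<Longrightarrow> C_k k (\<lambda>x. f x - g x)"
  using C_k_add[of k f "\<lambda>x. - g x"] C_k_uminus[of k g] by simp

lemma C_k_inner: "C_k k (\<lambda>x. x \<bullet> b)"
proof (cases k)
  case (Suc k)
  have "((\<lambda>x. x \<bullet> b) has_derivative (\<lambda>h. h \<bullet> b)) (at x)" for x
    by (auto intro!: derivative_eq_intros)
  from C_k_SucI[OF this] show ?thesis using Suc C_k_const by auto
qed (auto intro!: continuous_intros)

lemma C_k_ident: "C_k k (\<lambda>x::real. x)"
  using C_k_inner[of k "1::real"] by simp

lemma C_k_prod: "finite I \<Longrightarrow> (\<And>i. i \<in> I \<Longrightarrow> C_k k (f i)) \<Longrightarrow> C_k k (\<lambda>x. \<Prod>i\<in>I. f i x)"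
  by (induction I rule: finite_induct) (auto intro: C_k_const C_k_mult)

lemma frechet_derivative_real:
  fixes g :: "real \<Rightarrow> real"
  assumes "(g has_derivative frechet_derivative g (at t)) (at t)"
  shows "frechet_derivative g (at t) h = frechet_derivative g (at t) 1 * h"
  using linear_cmul[OF has_derivative_linear[OF assms], of h 1] by simp

text \<open>In the chain rule the derivative of the outer function is again composed with
  \<open>f\<close>, so the induction has to leave both functions arbitrary.\<close>

lemma C_k_compose:
  fixes g :: "real \<Rightarrow> real"
  shows "C_k k g \<Longrightarrow> C_k k f \<Longrightarrow> C_k k (\<lambda>x. g (f x))"
proof (induction k arbitrary: f g)
  case (Suc k)
  note dg = C_k_Suc_has_derivative[OF Suc.prems(1)] and df = C_k_Suc_has_derivative[OF Suc.prems(2)]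
  show ?case
  proof (rule C_k_SucI[OF has_derivative_compose[OF df dg]])
    fix b :: 'a assume b: "b \<in> Basis"
    have "C_k k (\<lambda>x. frechet_derivative g (at (f x)) 1 * frechet_derivative f (at x) b)"
      by (intro C_k_mult Suc.IH[of "\<lambda>t. frechet_derivative g (at t) 1"] C_k_Suc_partial[OF Suc.prems(1)]
        C_k_SucD[OF Suc.prems(2)] C_k_Suc_partial[OF Suc.prems(2) b]) auto
    then show "C_k k (\<lambda>x. frechet_derivative g (at (f x)) (frechet_derivative f (at x) b))"
      by (subst frechet_derivative_real[OF dg])
  qed
qed (auto intro: continuous_on_compose2)

lemma C_k_inverse:
  "C_k k f \<Longrightarrow> (\<And>x. f x \<noteq> 0) \<Longrightarrow> C_k k (\<lambda>x. inverse (f x))"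
proof (induction k arbitrary: f)
  case (Suc k)
  have d: "((\<lambda>x. inverse (f x)) has_derivative
     (\<lambda>h. - (inverse (f x) * frechet_derivative f (at x) h * inverse (f x)))) (at x)" for x
    by (rule Deriv.has_derivative_inverse[OF Suc.prems(2) C_k_Suc_has_derivative[OF Suc.prems(1)]])
  show ?case
    by (rule C_k_SucI[OF d])
      (intro C_k_uminus C_k_mult Suc.IH C_k_SucD[OF Suc.prems(1)] Suc.prems(2) C_k_Suc_partial[OF Suc.prems(1)])
qed (auto intro!: continuous_intros)

lemma C_k_real_SucI:
  fixes g :: "real \<Rightarrow> real"
  assumes "\<And>t. (g has_real_derivative g' t) (at t)" "C_k k g'"
  shows "C_k (Suc k) g"
  by (rule C_k_SucI[where D = "\<lambda>t h. g' t * h"]) (use assms in \<open>auto simp: has_field_derivative_def\<close>)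

lemma C_k_arctan: "C_k k arctan"
\<comment> \<open>Proving one order of smoothness more than required avoids a separate treatment of
  order 0.\<close>
proof (rule C_k_SucD, rule C_k_real_SucI)
  show "(arctan has_real_derivative inverse (1 + t * t)) (at t)" for t
    using DERIV_arctan[of t] by (simp add: power2_eq_square)
  show "C_k k (\<lambda>t. inverse (1 + t * t))"
    by (intro C_k_inverse C_k_add C_k_const C_k_mult C_k_ident) (metis add_eq_0_iff neg_0_le_iff_le not_one_le_zero zero_le_square)
qed

section \<open>Smooth bump functions\<close>

definition flat :: "nat \<Rightarrow> real \<Rightarrow> real" where
  "flat m t = (if t > 0 then inverse t ^ m * exp (- inverse t) else 0)"

lemma flat_tendsto_0: "(flat m \<longlongrightarrow> 0) (at 0)"
proof -
  have "((\<lambda>t::real. inverse t ^ m / exp (inverse t)) \<longlongrightarrow> 0) (at_right 0)"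
    by (rule filterlim_compose[OF tendsto_power_div_exp_0 filterlim_inverse_at_top_right])
  then have "(flat m \<longlongrightarrow> 0) (at_right 0)"
    by (rule Lim_transform_eventually)
      (use eventually_at_right_less[of "0::real"] in \<open>eventually_elim, auto simp: flat_def exp_minus divide_inverse\<close>)
  moreover have "(flat m \<longlongrightarrow> 0) (at_left 0)"
    by (rule Lim_transform_eventually[OF tendsto_const]) (auto simp: flat_def eventually_at_filter)
  ultimately show ?thesis by (simp add: filterlim_split_at)
qed

text \<open>The powers of \<open>inverse t\<close> in front of the exponential make the family
  closed under differentiation up to linear combinations; smoothness of all members then follows by
  one induction over the order with \<open>m\<close> arbitrary.\<close>

lemma flat_deriv: "(flat m has_real_derivative (flat (m + 2) t - m * flat (m + 1) t)) (at t)"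
proof (cases t "0::real" rule: linorder_cases)
  case less
  have "((\<lambda>_. 0) has_real_derivative 0) (at t)" by simp
  then have "(flat m has_real_derivative 0) (at t)"
    by (rule has_field_derivative_transform_within[where d = "-t"]) (use less in \<open>auto simp: flat_def dist_real_def\<close>)
  then show ?thesis using less by (simp add: flat_def)
next
  case equal
  \<comment> \<open>At the origin the difference quotient of \<open>flat m\<close> is
    \<open>flat (Suc m)\<close>, so the derivative 0 is the known limit of the next member.\<close>
  have "((\<lambda>t. (flat m t - flat m 0) / (t - 0)) \<longlongrightarrow> 0) (at 0)"
    by (rule Lim_transform_eventually[OF flat_tendsto_0[of "Suc m"]])
      (auto simp: flat_def divide_inverse eventually_at_filter)
  moreover have "flat (m + 2) 0 - m * flat (m + 1) 0 = 0" by (simp add: flat_def)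
  ultimately show ?thesis unfolding equal has_field_derivative_iff by (simp only:)
next
  case greater
  have "((\<lambda>t. inverse t ^ m * exp (- inverse t)) has_real_derivative (flat (m + 2) t - m * flat (m + 1) t)) (at t)"
  proof -
    have i: "(inverse has_real_derivative - (inverse t * inverse t)) (at t)"
      using DERIV_inverse[of t] greater by (simp add: power2_eq_square)
    have "((\<lambda>t. inverse t ^ m * exp (- inverse t)) has_real_derivative
       real m * (- (inverse t * inverse t) * inverse t ^ (m - Suc 0)) * exp (- inverse t)
       + exp (- inverse t) * - (- (inverse t * inverse t)) * inverse t ^ m) (at t)"
      by (intro DERIV_mult DERIV_power i DERIV_fun_exp DERIV_minus)
    moreover have "real m * (- (inverse t * inverse t) * inverse t ^ (m - Suc 0)) * exp (- inverse t)
       + exp (- inverse t) * - (- (inverse t * inverse t)) * inverse t ^ m = flat (m + 2) t - m * flat (m + 1) t"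
      using greater by (cases m) (simp_all add: flat_def algebra_simps)
    ultimately show ?thesis by (simp only:)
  qed
  then show ?thesis
    by (rule has_field_derivative_transform_within[where d = t]) (use greater in \<open>auto simp: flat_def dist_real_def\<close>)
qed

lemma C_k_flat: "C_k k (flat m)"
proof (induction k arbitrary: m)
  case 0
  show ?case using flat_deriv[of m] by (auto intro!: continuous_at_imp_continuous_on DERIV_isCont)
next
  case (Suc k)
  show ?case by (rule C_k_real_SucI[OF flat_deriv]) (intro C_k_diff C_k_cmult Suc.IH)
qed

text \<open>Smooth approximations of the indicator of the open box with corners \<open>a\<close> and
  \<open>c\<close>. The parameter \<open>n\<close> leaves the support alone; it multiplies the
  distances to the faces, so that inside the box each factor \<open>exp (- 1 / (n * s))\<close>
  tends to 1.\<close>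

definition bump :: "'a::euclidean_space \<Rightarrow> 'a \<Rightarrow> nat \<Rightarrow> 'a \<Rightarrow> real" where
  "bump a c n x = (\<Prod>b\<in>Basis. flat 0 (n * ((x - a) \<bullet> b)) * flat 0 (n * ((c - x) \<bullet> b)))"

lemma flat_0_bounds: "0 \<le> flat 0 t" "flat 0 t \<le> 1"
  by (auto simp: flat_def)

lemma bump_bounds: "0 \<le> bump a c n x" "bump a c n x \<le> 1"
  unfolding bump_def
  by (auto intro!: prod_nonneg prod_le_1 mult_nonneg_nonneg mult_le_one flat_0_bounds)

lemma bump_support: "bump a c n x \<noteq> 0 \<Longrightarrow> x \<in> box a c"
  unfolding bump_def mem_box by (auto simp: flat_def inner_diff_left zero_less_mult_iff split: if_splits)

lemma bump_tendsto: "(\<lambda>n. bump a c n x) \<longlonglongrightarrow> indicator (box a c) x"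
proof (cases "x \<in> box a c")
  case True
  have one: "(\<lambda>n. flat 0 (real n * s)) \<longlonglongrightarrow> 1" if "s > 0" for s
  proof -
    have "(\<lambda>n. exp (- (inverse (real n) * inverse s))) \<longlonglongrightarrow> exp (- (0 * inverse s))"
      by (intro tendsto_intros lim_inverse_n)
    then have "(\<lambda>n. exp (- (inverse (real n) * inverse s))) \<longlonglongrightarrow> 1" by simp
    then show ?thesis
      by (rule Lim_transform_eventually)
        (use eventually_gt_at_top[of 0] in \<open>eventually_elim, use that in \<open>auto simp: flat_def mult.commute\<close>\<close>)
  qed
  have "(\<lambda>n. bump a c n x) \<longlonglongrightarrow> (\<Prod>b\<in>(Basis::'a set). 1 * 1)"
    unfolding bump_def using True
    by (intro tendsto_prod tendsto_mult one) (auto simp: mem_box inner_diff_left)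
  then show ?thesis using True by simp
next
  case False
  then have "bump a c n x = 0" for n using bump_support[of a c n x] by blast
  with False show ?thesis by simp
qed

lemma C_k_bump: "C_k k (bump a c n)"
  unfolding bump_def inner_diff_left
  by (intro C_k_prod C_k_mult C_k_compose[OF C_k_flat] C_k_cmult C_k_diff C_k_inner C_k_const) auto

lemma test_functionsI:
  assumes "\<And>k. C_k k \<phi>" "compact K" "K \<subseteq> \<Omega>" "\<And>x. \<phi> x \<noteq> 0 \<Longrightarrow> x \<in> K"
  shows "\<phi> \<in> test_functions \<Omega>"
proof -
  have "closure {x. \<phi> x \<noteq> 0} \<subseteq> K"
    using assms by (intro closure_minimal) (auto simp: compact_imp_closed)
  moreover have "compact (closure {x. \<phi> x \<noteq> 0})"
    unfolding compact_closure using assms(4) by (intro bounded_subset[OF compact_imp_bounded[OF assms(2)]]) auto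
  ultimately show ?thesis using assms by (auto simp: test_functions_def)
qed

lemma test_functionsD:
  assumes "\<phi> \<in> test_functions \<Omega>"
  obtains K where "\<And>k. C_k k \<phi>" "compact K" "K \<subseteq> \<Omega>" "\<And>x. x \<notin> K \<Longrightarrow> \<phi> x = 0"
proof (rule that[of "closure {x. \<phi> x \<noteq> 0}"])
  show "\<phi> x = 0" if "x \<notin> closure {x. \<phi> x \<noteq> 0}" for x
    using that closure_subset[of "{x. \<phi> x \<noteq> 0}"] by blast
qed (use assms in \<open>simp_all add: test_functions_def\<close>)

lemma bump_test_function: "cbox a c \<subseteq> \<Omega> \<Longrightarrow> bump a c n \<in> test_functions \<Omega>"
  by (rule test_functionsI[OF C_k_bump compact_cbox]) (use bump_support box_subset_cbox in blast)+

lemma test_functions_scaleR: "\<phi> \<in> test_functions \<Omega> \<Longrightarrow> (\<lambda>x. c * \<phi> x) \<in> test_functions \<Omega>"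
  by (erule test_functionsD, rule test_functionsI[OF C_k_cmult]) (assumption | fastforce)+

lemma test_functions_add:
  assumes "\<phi> \<in> test_functions \<Omega>" "\<eta> \<in> test_functions \<Omega>"
  shows "(\<lambda>x. \<phi> x + \<eta> x) \<in> test_functions \<Omega>"
proof -
  obtain K where K: "\<And>k. C_k k \<phi>" "compact K" "K \<subseteq> \<Omega>" "\<And>x. x \<notin> K \<Longrightarrow> \<phi> x = 0"
    using test_functionsD[OF assms(1)] by metis
  obtain L where L: "\<And>k. C_k k \<eta>" "compact L" "L \<subseteq> \<Omega>" "\<And>x. x \<notin> L \<Longrightarrow> \<eta> x = 0"
    using test_functionsD[OF assms(2)] by metis
  show ?thesis
    by (rule test_functionsI[OF C_k_add[OF K(1) L(1)] compact_Un[OF K(2) L(2)]])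
      (use K(3,4) L(3,4) in \<open>blast, metis UnI1 UnI2 add_0\<close>)
qed

lemma test_functions_arctan: "\<phi> \<in> test_functions \<Omega> \<Longrightarrow> (\<lambda>x. arctan (\<phi> x)) \<in> test_functions \<Omega>"
  by (erule test_functionsD, rule test_functionsI[OF C_k_compose[OF C_k_arctan]]) (assumption | metis arctan_zero_zero)+

section \<open>Classical gradients and continuously differentiable functions of compact
  support\<close>

definition grad :: "('a::euclidean_space \<Rightarrow> real) \<Rightarrow> 'a \<Rightarrow> 'a" where
  "grad \<phi> x = (\<Sum>b\<in>Basis. frechet_derivative \<phi> (at x) b *\<^sub>R b)"

lemma grad_unique:
  assumes "(\<phi> has_derivative (\<lambda>h. g \<bullet> h)) (at x)" shows "grad \<phi> x = g"
  unfolding grad_def frechet_derivative_at[OF assms, symmetric] by (rule euclidean_representation)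

lemma frechet_derivative_eq_grad:
  assumes "\<phi> differentiable (at x)" shows "frechet_derivative \<phi> (at x) h = grad \<phi> x \<bullet> h"
proof -
  have lin: "linear (frechet_derivative \<phi> (at x))" by (rule linear_frechet_derivative[OF assms])
  have "frechet_derivative \<phi> (at x) h = frechet_derivative \<phi> (at x) (\<Sum>b\<in>Basis. (h \<bullet> b) *\<^sub>R b)"
    by (simp add: euclidean_representation)
  also have "\<dots> = (\<Sum>b\<in>Basis. (h \<bullet> b) * frechet_derivative \<phi> (at x) b)"
    by (simp add: linear_sum[OF lin] linear_cmul[OF lin])
  also have "\<dots> = grad \<phi> x \<bullet> h"
    unfolding grad_def inner_sum_left by (intro sum.cong) (auto simp: inner_commute)
  finally show ?thesis .
qed

text \<open>Only one continuous derivative is asked for, because the class has to contain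
  \<open>\<bar>w\<bar> powr r\<close> along with \<open>w\<close>. The gradient and a compact set
  containing the support are explicit parameters, so neither has to be recomputed for derived
  functions.\<close>

definition C1c :: "'a::euclidean_space set \<Rightarrow> ('a \<Rightarrow> real) \<Rightarrow> ('a \<Rightarrow> 'a) \<Rightarrow> bool" where
  "C1c K \<phi> g \<longleftrightarrow> compact K \<and> (\<forall>x. (\<phi> has_derivative (\<lambda>h. g x \<bullet> h)) (at x)) \<and> continuous_on UNIV g \<and>
     (\<forall>x. x \<notin> K \<longrightarrow> \<phi> x = 0) \<and> (\<forall>x. x \<notin> K \<longrightarrow> g x = 0)"

lemma test_functions_C1c:
  assumes "\<phi> \<in> test_functions \<Omega>"
  obtains K where "K \<subseteq> \<Omega>" "C1c K \<phi> (grad \<phi>)"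
proof -
  obtain K where K: "\<And>k. C_k k \<phi>" "compact K" "K \<subseteq> \<Omega>" "\<And>x. x \<notin> K \<Longrightarrow> \<phi> x = 0"
    using test_functionsD[OF assms] by metis
  have diff: "\<phi> differentiable (at x)" for x using K(1)[of "Suc 0"] by (simp add: C_k.simps)
  have der: "(\<phi> has_derivative (\<lambda>h. grad \<phi> x \<bullet> h)) (at x)" for x
    using diff[of x] unfolding frechet_derivative_works frechet_derivative_eq_grad[OF diff, abs_def] .
  have cont: "continuous_on UNIV (grad \<phi>)"
    unfolding grad_def using C_k_continuous[OF C_k_Suc_partial[OF K(1)[of "Suc 0"]]]
    by (intro continuous_intros) auto
  have zero: "grad \<phi> x = 0" if "x \<notin> K" for x
  proof (rule grad_unique, simp)
    have "((\<lambda>_. 0) has_derivative (\<lambda>h. 0)) (at x)" by simp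
    then show "(\<phi> has_derivative (\<lambda>h. 0)) (at x)"
      by (rule has_derivative_transform_within_open[where s = "- K"])
        (use K that in \<open>auto simp: compact_imp_closed open_Compl\<close>)
  qed
  show ?thesis by (rule that[OF K(3)]) (use K der cont zero in \<open>auto simp: C1c_def\<close>)
qed

section \<open>Translates of compactly supported functions\<close>

lemma continuous_compact_support_integrable:
  fixes f :: "'a::euclidean_space \<Rightarrow> 'b::euclidean_space"
  assumes "continuous_on UNIV f" "compact K" "\<And>x. x \<notin> K \<Longrightarrow> f x = 0"
  shows "integrable lborel f"
proof -
  have "integrable lborel (\<lambda>x. indicator K x *\<^sub>R f x)"
    using assms by (intro borel_integrable_compact) (auto intro: continuous_on_subset)
  moreover have "(\<lambda>x. indicator K x *\<^sub>R f x) = f" using assms(3) by (auto simp: indicator_def fun_eq_iff)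
  ultimately show ?thesis by simp
qed

lemma continuous_compact_support_bounded:
  fixes f :: "'a::euclidean_space \<Rightarrow> 'b::euclidean_space"
  assumes "continuous_on UNIV f" "compact K" "\<And>x. x \<notin> K \<Longrightarrow> f x = 0"
  obtains B where "B > 0" "\<And>x. norm (f x) \<le> B"
proof -
  have "bounded (f ` K)" using assms by (intro compact_imp_bounded compact_continuous_image) (auto intro: continuous_on_subset)
  then obtain B where B: "B > 0" "\<And>x. x \<in> K \<Longrightarrow> norm (f x) \<le> B" unfolding bounded_pos by auto
  then have "norm (f x) \<le> B" for x using assms(3)[of x] by (cases "x \<in> K") auto
  with B(1) show ?thesis by (rule that)
qed

lemma
  fixes f :: "'a::euclidean_space \<Rightarrow> 'b::euclidean_space"
  assumes f: "integrable lborel f"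
  shows integrable_translate: "integrable lborel (\<lambda>x. f (x + z))"
    and integral_translate: "(\<integral>x. f (x + z) \<partial>lborel) = (\<integral>x. f x \<partial>lborel)"
proof -
  have [measurable]: "f \<in> borel_measurable borel" using f by auto
  have "integrable (distr lborel borel ((+) z)) f" using f by (simp add: lborel_distr_plus)
  then show "integrable lborel (\<lambda>x. f (x + z))" by (simp add: integrable_distr_eq add.commute)
  have "(\<integral>x. f x \<partial>(distr lborel borel ((+) z))) = (\<integral>x. f (z + x) \<partial>lborel)"
    by (rule integral_distr) auto
  then show "(\<integral>x. f (x + z) \<partial>lborel) = (\<integral>x. f x \<partial>lborel)" by (simp add: lborel_distr_plus add.commute)
qed

context
  fixes K :: "'a::euclidean_space set" and w :: "'a \<Rightarrow> real" and g :: "'a \<Rightarrow> 'a"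
  assumes C1c: "C1c K w g"
begin

lemma C1c_facts:
  shows "compact K" "\<And>x. (w has_derivative (\<lambda>h. g x \<bullet> h)) (at x)" "continuous_on UNIV g"
    "\<And>x. x \<notin> K \<Longrightarrow> w x = 0" "\<And>x. x \<notin> K \<Longrightarrow> g x = 0" "continuous_on UNIV w"
  using C1c unfolding C1c_def
  by (auto intro!: continuous_at_imp_continuous_on has_derivative_continuous)

lemma C1c_integrable: "integrable lborel w" "integrable lborel g"
  using continuous_compact_support_integrable C1c_facts by blast+

lemma C1c_lipschitz:
  obtains L where "L > 0" "\<And>x. norm (g x) \<le> L" "\<And>x y. \<bar>w x - w y\<bar> \<le> L * norm (x - y)"
proof -
  obtain L where L: "L > 0" "\<And>x. norm (g x) \<le> L"
    using continuous_compact_support_bounded[OF C1c_facts(3,1,5)] by blast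
  have "norm (w x - w y) \<le> L * norm (x - y)" for x y
  proof (rule differentiable_bound[of UNIV w "\<lambda>x h. g x \<bullet> h" L x y])
    show "onorm (\<lambda>h. g x \<bullet> h) \<le> L" for x
      by (rule onorm_bound) (use L in \<open>auto intro!: order_trans[OF Cauchy_Schwarz_ineq2] mult_right_mono\<close>)
  qed (use C1c_facts(2) in auto)
  with L show ?thesis using that by auto
qed

text \<open>Dominated convergence: the quotients tend to the directional derivative, and the
  Lipschitz bound together with a common compact support provides the majorant.\<close>

lemma C1c_difference_quotient:
  shows "(\<lambda>n. \<integral>x. real (Suc n) * (w (x + (1 / Suc n) *\<^sub>R z) - w x) \<partial>lborel) \<longlonglongrightarrow> (\<integral>x. g x \<bullet> z \<partial>lborel)"
    and "(\<lambda>n. \<integral>x. \<bar>real (Suc n) * (w (x + (1 / Suc n) *\<^sub>R z) - w x)\<bar> \<partial>lborel) \<longlonglongrightarrow> (\<integral>x. \<bar>g x \<bullet> z\<bar> \<partial>lborel)"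
proof -
  obtain L where L: "L > 0" "\<And>x y. \<bar>w x - w y\<bar> \<le> L * norm (x - y)" using C1c_lipschitz by metis
  \<comment> \<open>All points that some shift of length at most \<open>norm z\<close> moves into
    \<open>K\<close>; outside this compact set every quotient vanishes.\<close>
  define K' where "K' = (\<lambda>(x, y). x - y) ` (K \<times> cball 0 (norm z))"
  have K': "compact K'" unfolding K'_def
    using C1c_facts(1) by (intro compact_continuous_image compact_Times) (auto intro!: continuous_intros simp: case_prod_beta)
  have [measurable]: "w \<in> borel_measurable borel" "g \<in> borel_measurable borel"
    using C1c_facts by (auto intro: borel_measurable_continuous_onI)
  define q where "q n x = real (Suc n) * (w (x + (1 / Suc n) *\<^sub>R z) - w x)" for n x
  have lim: "(\<lambda>n. q n x) \<longlonglongrightarrow> g x \<bullet> z" for x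
  proof -
    have "((\<lambda>t. w (x + t *\<^sub>R z)) has_derivative (\<lambda>t. g x \<bullet> (t *\<^sub>R z))) (at 0)"
      by (rule has_derivative_compose[of "\<lambda>t. x + t *\<^sub>R z" "\<lambda>t. t *\<^sub>R z" 0 UNIV w "\<lambda>h. g x \<bullet> h"])
        (auto intro!: derivative_eq_intros C1c_facts(2))
    then have "((\<lambda>t. w (x + t *\<^sub>R z)) has_real_derivative g x \<bullet> z) (at 0)"
      unfolding has_field_derivative_def by (rule has_derivative_eq_rhs) (simp add: fun_eq_iff)
    then have *: "((\<lambda>t. (w (x + t *\<^sub>R z) - w x) / t) \<longlongrightarrow> g x \<bullet> z) (at 0)"
      by (simp add: has_field_derivative_iff)
    have "filterlim (\<lambda>n. 1 / real (Suc n)) (at 0) sequentially"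
      using LIMSEQ_Suc[OF lim_1_over_n[where 'a=real]] by (auto simp: filterlim_at)
    from filterlim_compose[OF * this] show ?thesis by (simp add: q_def mult.commute)
  qed
  have bd: "\<bar>q n x\<bar> \<le> L * norm z * indicator K' x" for n x
  proof (cases "x \<in> K'")
    case True
    have "\<bar>q n x\<bar> \<le> real (Suc n) * (L * norm ((1 / Suc n) *\<^sub>R z))"
      using L(2)[of "x + (1 / Suc n) *\<^sub>R z" x] unfolding q_def abs_mult by (intro mult_mono) auto
    also have "\<dots> = L * norm z" by (simp add: field_simps)
    finally show ?thesis using True by simp
  next
    case False
    have "x \<notin> K" using False image_eqI[of x "\<lambda>(x, y). x - y" "(x, 0)" "K \<times> cball 0 (norm z)"] by (auto simp: K'_def)
    moreover have "x + (1 / Suc n) *\<^sub>R z \<notin> K"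
    proof
      assume "x + (1 / Suc n) *\<^sub>R z \<in> K"
      moreover have "norm ((1 / Suc n) *\<^sub>R z) \<le> norm z" by (simp add: divide_le_eq mult_le_cancel_left1)
      ultimately have "x \<in> K'" unfolding K'_def
        by (intro image_eqI[of x "\<lambda>(x, y). x - y" "(x + (1 / Suc n) *\<^sub>R z, (1 / Suc n) *\<^sub>R z)"]) auto
      with False show False ..
    qed
    ultimately show ?thesis using C1c_facts(4) False by (simp add: q_def)
  qed
  have dom: "integrable lborel (\<lambda>x. L * norm z * indicator K' x)"
    using K' by (auto intro!: integrable_real_indicator emeasure_bounded_finite simp: compact_imp_closed compact_imp_bounded)
  have "(\<lambda>n. \<integral>x. q n x \<partial>lborel) \<longlonglongrightarrow> (\<integral>x. g x \<bullet> z \<partial>lborel)"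
    by (rule integral_dominated_convergence[where w = "\<lambda>x. L * norm z * indicator K' x"])
      (use dom lim bd in \<open>auto simp: q_def[abs_def]\<close>)
  then show "(\<lambda>n. \<integral>x. real (Suc n) * (w (x + (1 / Suc n) *\<^sub>R z) - w x) \<partial>lborel) \<longlonglongrightarrow> (\<integral>x. g x \<bullet> z \<partial>lborel)"
    by (simp add: q_def)
  have "(\<lambda>n. \<integral>x. \<bar>q n x\<bar> \<partial>lborel) \<longlonglongrightarrow> (\<integral>x. \<bar>g x \<bullet> z\<bar> \<partial>lborel)"
    by (rule integral_dominated_convergence[where w = "\<lambda>x. L * norm z * indicator K' x"])
      (use dom lim bd in \<open>auto simp: q_def[abs_def] intro!: tendsto_intros\<close>)
  then show "(\<lambda>n. \<integral>x. \<bar>real (Suc n) * (w (x + (1 / Suc n) *\<^sub>R z) - w x)\<bar> \<partial>lborel) \<longlonglongrightarrow> (\<integral>x. \<bar>g x \<bullet> z\<bar> \<partial>lborel)"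
    by (simp add: q_def)
qed

text \<open>Translation invariance of the Lebesgue measure makes the integral of every difference
  quotient vanish. Applied to products, this is the source of integration by parts.\<close>

lemma C1c_integral_grad_zero: "(\<integral>x. g x \<bullet> z \<partial>lborel) = 0"
proof -
  have zero: "(\<integral>x. real (Suc n) * (w (x + (1 / Suc n) *\<^sub>R z) - w x) \<partial>lborel) = 0" for n
    using integral_translate[OF C1c_integrable(1)] integrable_translate[OF C1c_integrable(1)] C1c_integrable(1)
    by (simp add: Bochner_Integration.integral_diff)
  show ?thesis by (rule LIMSEQ_unique[OF C1c_difference_quotient(1)[of z, unfolded zero] tendsto_const])
qed

text \<open>The \<open>L^1\<close> distance \<open>G\<close> between \<open>w\<close> and its
  translates is subadditive in the shift, hence \<open>G z\<close> is at most \<open>n\<close> times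
  \<open>G\<close> at \<open>z / n\<close>. The limit of these bounds is the integral of
  \<open>\<bar>g x \<bullet> z\<bar>\<close>, without any integration along segments.\<close>

lemma C1c_translate_le:
  "(\<integral>x. \<bar>w (x + z) - w x\<bar> \<partial>lborel) \<le> norm z * (\<integral>x. norm (g x) \<partial>lborel)"
proof -
  define G where "G y = (\<integral>x. \<bar>w (x + y) - w x\<bar> \<partial>lborel)" for y
  have int: "integrable lborel (\<lambda>x. \<bar>w (x + y) - w x\<bar>)" for y
    using integrable_translate[OF C1c_integrable(1)] C1c_integrable(1) by auto
  have sub: "G (y + y') \<le> G y + G y'" for y y'
  proof -
    have int': "integrable lborel (\<lambda>x. \<bar>w (x + y + y') - w (x + y)\<bar>)"
      using integrable_translate[OF int[of y'], of y] by simp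
    have "G (y + y') \<le> (\<integral>x. \<bar>w (x + y) - w x\<bar> + \<bar>w (x + y + y') - w (x + y)\<bar> \<partial>lborel)"
      unfolding G_def using int int' by (intro integral_mono Bochner_Integration.integrable_add) (auto simp: add.assoc)
    also have "\<dots> = G y + G y'"
      using int int' integral_translate[OF int[of y'], of y] by (simp add: G_def)
    finally show ?thesis .
  qed
  have G0: "G 0 = 0" by (simp add: G_def)
  have mult: "G (real n *\<^sub>R y) \<le> real n * G y" for n y
  proof (induction n)
    case (Suc n)
    have "G (real (Suc n) *\<^sub>R y) \<le> G (real n *\<^sub>R y) + G y"
      using sub[of "real n *\<^sub>R y" y] by (simp add: algebra_simps)
    with Suc show ?case by (simp add: algebra_simps)
  qed (simp add: G0)
  have "G z \<le> (\<integral>x. \<bar>real (Suc n) * (w (x + (1 / Suc n) *\<^sub>R z) - w x)\<bar> \<partial>lborel)" for n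
    using mult[of "Suc n" "(1 / Suc n) *\<^sub>R z"] by (simp add: G_def abs_mult)
  then have "G z \<le> (\<integral>x. \<bar>g x \<bullet> z\<bar> \<partial>lborel)"
    using LIMSEQ_le_const[OF C1c_difference_quotient(2)[of z], of "G z"] by blast
  also have "\<dots> \<le> (\<integral>x. norm z * norm (g x) \<partial>lborel)"
    using C1c_integrable(2) by (intro integral_mono) (auto intro: order_trans[OF Cauchy_Schwarz_ineq2])
  finally show ?thesis by (simp add: G_def)
qed

end

section \<open>The Gagliardo-Nirenberg-Sobolev inequality\<close>

text \<open>Jensen's inequality for \<open>exp\<close> at the points
  \<open>ln (y i)\<close>.\<close>

lemma weighted_AM_GM:
  fixes w y :: "'i \<Rightarrow> real"
  assumes S: "finite S" and w: "\<And>i. i \<in> S \<Longrightarrow> w i \<ge> 0" "(\<Sum>i\<in>S. w i) = 1" and y: "\<And>i. i \<in> S \<Longrightarrow> y i > 0"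
  shows "(\<Prod>i\<in>S. y i powr w i) \<le> (\<Sum>i\<in>S. w i * y i)"
proof -
  have "S \<noteq> {}" using w(2) by auto
  have "(\<Prod>i\<in>S. y i powr w i) = (\<Prod>i\<in>S. exp (w i *\<^sub>R ln (y i)))"
    using y by (intro prod.cong) (auto simp: powr_def less_le)
  also have "\<dots> = exp (\<Sum>i\<in>S. w i *\<^sub>R ln (y i))" using S by (simp add: exp_sum)
  also have "\<dots> \<le> (\<Sum>i\<in>S. w i * exp (ln (y i)))"
    by (rule convex_on_sum[OF S \<open>S \<noteq> {}\<close> exp_convex w(2) w(1)]) auto
  also have "\<dots> = (\<Sum>i\<in>S. w i * y i)" using y by (intro sum.cong) auto
  finally show ?thesis .
qed

text \<open>Dividing each \<open>g i\<close> by its integral reduces the claim to the weighted mean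
  inequality at every point, whose right-hand side integrates to the sum of the weights. Strict
  positivity keeps the logarithms finite and the value \<open>0 powr 0 = 0\<close> out of the
  products.\<close>

lemma Holder_prod:
  fixes g :: "'i \<Rightarrow> 'a \<Rightarrow> real"
  assumes S: "finite S" and w: "\<And>i. i \<in> S \<Longrightarrow> w i \<ge> 0" "(\<Sum>i\<in>S. w i) = 1"
    and int: "\<And>i. i \<in> S \<Longrightarrow> integrable M (g i)" and pos: "\<And>i x. i \<in> S \<Longrightarrow> x \<in> space M \<Longrightarrow> g i x > 0"
    and G: "\<And>i. i \<in> S \<Longrightarrow> (\<integral>x. g i x \<partial>M) > 0"
  shows "(\<integral>x. (\<Prod>i\<in>S. g i x powr w i) \<partial>M) \<le> (\<Prod>i\<in>S. (\<integral>x. g i x \<partial>M) powr w i)"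
proof -
  define G where "G i = (\<integral>x. g i x \<partial>M)" for i
  define P where "P = (\<Prod>i\<in>S. G i powr w i)"
  have Gp: "G i > 0" if "i \<in> S" for i using assms(6)[OF that] by (simp add: G_def)
  have Gn: "G i \<noteq> 0" if "i \<in> S" for i using Gp[OF that] by simp
  have P0: "P \<ge> 0" unfolding P_def by (intro prod_nonneg) auto
  have "(\<integral>x. (\<Prod>i\<in>S. g i x powr w i) \<partial>M) \<le> (\<integral>x. P * (\<Sum>i\<in>S. w i * (g i x / G i)) \<partial>M)"
  proof (rule integral_mono')
    show "integrable M (\<lambda>x. P * (\<Sum>i\<in>S. w i * (g i x / G i)))" using int by auto
    fix x assume x: "x \<in> space M"
    have "(\<Prod>i\<in>S. g i x powr w i) = (\<Prod>i\<in>S. G i powr w i * (g i x / G i) powr w i)"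
      using pos[OF _ x] Gp Gn by (intro prod.cong) (auto simp: powr_divide less_imp_le)
    also have "\<dots> = P * (\<Prod>i\<in>S. (g i x / G i) powr w i)" by (simp add: P_def prod.distrib)
    also have "\<dots> \<le> P * (\<Sum>i\<in>S. w i * (g i x / G i))"
      using pos[OF _ x] Gp by (intro mult_left_mono weighted_AM_GM S w P0) auto
    finally show "(\<Prod>i\<in>S. g i x powr w i) \<le> P * (\<Sum>i\<in>S. w i * (g i x / G i))" .
    show "0 \<le> P * (\<Sum>i\<in>S. w i * (g i x / G i))"
      using pos[OF _ x] Gp w(1) by (intro mult_nonneg_nonneg P0 sum_nonneg) (auto simp: less_imp_le)
  qed
  also have "\<dots> = P * (\<Sum>i\<in>S. w i * ((\<integral>x. g i x \<partial>M) / G i))"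
    using int by simp
  also have "(\<Sum>i\<in>S. w i * ((\<integral>x. g i x \<partial>M) / G i)) = (\<Sum>i\<in>S. w i)"
    by (intro sum.cong) (auto simp: G_def[symmetric] Gn)
  finally show ?thesis by (simp add: w(2) P_def G_def)
qed

section \<open>Gagliardo's estimate on a product of finite measures on the line\<close>

context
  fixes \<mu> :: "real measure"
  assumes fin: "finite_measure \<mu>" and sets_\<mu> [measurable_cong]: "sets \<mu> = sets borel" and pos: "measure \<mu> UNIV > 0"
begin

lemma space_mu: "space \<mu> = UNIV"
  using sets_eq_imp_space_eq[OF sets_\<mu>] by simp

lemma product_sigma_finite_mu: "product_sigma_finite (\<lambda>_. \<mu>)"
  using fin by (simp add: product_sigma_finite_def finite_measure_def)

lemma finite_measure_PiM_mu: "finite I \<Longrightarrow> finite_measure (PiM I (\<lambda>_. \<mu>))"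
proof -
  assume I: "finite I"
  interpret product_sigma_finite "\<lambda>_. \<mu>" by (rule product_sigma_finite_mu)
  have "emeasure (PiM I (\<lambda>_. \<mu>)) (PiE I (\<lambda>_. space \<mu>)) = (\<Prod>i\<in>I. emeasure \<mu> (space \<mu>))"
    by (rule emeasure_PiM[OF I]) auto
  also have "\<dots> \<noteq> \<infinity>"
    using finite_measure.emeasure_finite[OF fin, of "space \<mu>"] by (simp add: power_eq_top_ennreal)
  finally show ?thesis by (intro finite_measureI) (simp add: space_PiM)
qed

lemma fun_upd_space: "x \<in> space (PiM I (\<lambda>_. \<mu>)) \<Longrightarrow> x(i := t) \<in> space (PiM (insert i I) (\<lambda>_. \<mu>))"
  by (auto simp: space_PiM space_mu PiE_def extensional_def)

text \<open>
  Gagliardo's estimate in the form of van Doorn and Macbeth: integrating out one coordinate with the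
  Hoelder inequality turns the claim for \<open>f\<close> into the same claim for the marginal of \<open>f\<close>.
  The lower bound \<open>\<delta>\<close> is there because \<open>0 powr 0 = 0\<close>, while in the application the exponent of \<open>f\<close> is 0.
\<close>

lemma grid_lines:
  fixes f :: "('i \<Rightarrow> real) \<Rightarrow> real"
  assumes "finite I" and p: "p \<ge> 0" "real (card I) * p \<le> 1 + p"
    and "f \<in> borel_measurable (PiM I (\<lambda>_. \<mu>))"
    and "\<And>x. x \<in> space (PiM I (\<lambda>_. \<mu>)) \<Longrightarrow> \<delta> \<le> f x \<and> f x \<le> B" "\<delta> > 0"
  shows "(\<integral>x. f x powr (1 - (real (card I) - 1) * p) * (\<Prod>i\<in>I. (\<integral>t. f (x(i := t)) \<partial>\<mu>) powr p) \<partial>PiM I (\<lambda>_. \<mu>))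
    \<le> (\<integral>x. f x \<partial>PiM I (\<lambda>_. \<mu>)) powr (1 + p)"
  using assms(1) p(2) assms(4-)
proof (induction I arbitrary: f \<delta> B rule: finite_induct)
  case empty
  then show ?case
    by (simp add: PiM_empty lebesgue_integral_count_space_finite)
next
  case (insert i I)
  interpret product_sigma_finite "\<lambda>_::'i. \<mu>" by (rule product_sigma_finite_mu)
  interpret mu: finite_measure \<mu> by (rule fin)
  have sf: "sigma_finite_measure \<mu>" using fin by (simp add: finite_measure_def)
  let ?N = "PiM I (\<lambda>_. \<mu>)" and ?J = "insert i I"
  let ?N' = "PiM ?J (\<lambda>_. \<mu>)"
  define m where "m = measure \<mu> UNIV"
  have m: "m > 0" using pos by (simp add: m_def)
  note f [measurable] = insert.prems(2)
  note fb = insert.prems(3)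
  have fin': "finite ?J" using insert.hyps by simp
  interpret N': finite_measure ?N' by (rule finite_measure_PiM_mu[OF fin'])
  interpret N: finite_measure ?N by (rule finite_measure_PiM_mu[OF insert.hyps(1)])
  \<comment> \<open>The exponent of \<open>f\<close> in the step, which is also its Hoelder weight:
    together with \<open>card I\<close> weights \<open>p\<close> it adds up to 1. The bound assumed
    on \<open>p\<close> is exactly its nonnegativity.\<close>
  define a where "a = 1 - (real (card ?J) - 1) * p"
  have a: "a \<ge> 0" "a = 1 - real (card I) * p"
    using insert.hyps insert.prems(1) by (auto simp: a_def algebra_simps)
  have "space ?N' \<noteq> {}" by (simp add: space_mu)
  then have B: "B \<ge> \<delta>" "B > 0" "\<delta> \<ge> 0" using fb insert.prems(4) by fastforce+
  have absB: "norm y \<le> B" if "\<delta> \<le> y \<and> y \<le> B" for y using that B by (simp add: abs_le_iff)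
  have upd: "x(j := t) \<in> space ?N'" if "x \<in> space ?N'" "j \<in> ?J" for x j t
    using fun_upd_space[OF that(1), of j t] that(2) by (simp add: insert_absorb)
  have upd': "x(j := t) \<in> space ?N" if "x \<in> space ?N" "j \<in> I" for x j t
    using fun_upd_space[OF that(1), of j t] that(2) by (simp add: insert_absorb)
  have updi: "x(i := t) \<in> space ?N'" if "x \<in> space ?N" for x t
    using fun_upd_space[OF that] .
  have ms1: "(\<lambda>(z, t). f (z(j := t))) \<in> borel_measurable (?N' \<Otimes>\<^sub>M \<mu>)" if "j \<in> ?J" for j
  proof -
    have "(\<lambda>(z, t). z(j := t)) \<in> measurable (?N' \<Otimes>\<^sub>M \<mu>) ?N'"
      using measurable_add_dim[of j ?J "\<lambda>_. \<mu>"] unfolding insert_absorb[OF that] .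
    from measurable_compose[OF this f] show ?thesis by (simp add: case_prod_beta' fun_upd_def)
  qed
  have ms2 [measurable]: "(\<lambda>(x, y). f (x(i := y))) \<in> borel_measurable (?N \<Otimes>\<^sub>M \<mu>)"
    using measurable_compose[OF measurable_add_dim[of i I "\<lambda>_. \<mu>"] f] by (simp add: case_prod_beta' fun_upd_def)
  define h where "h j z = (\<integral>t. f (z(j := t)) \<partial>\<mu>)" for j z
  define g where "g x = (\<integral>y. f (x(i := y)) \<partial>\<mu>)" for x
  have hm: "h j \<in> borel_measurable ?N'" if "j \<in> ?J" for j
    unfolding h_def using sigma_finite_measure.borel_measurable_lebesgue_integral[OF sf ms1[OF that]] .
  have gm: "g \<in> borel_measurable ?N"
    unfolding g_def using sigma_finite_measure.borel_measurable_lebesgue_integral[OF sf ms2] .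
  have avg: "integrable \<mu> F \<and> \<delta> * m \<le> (\<integral>t. F t \<partial>\<mu>) \<and> (\<integral>t. F t \<partial>\<mu>) \<le> B * m"
    if "F \<in> borel_measurable \<mu>" "\<And>t. \<delta> \<le> F t \<and> F t \<le> B" for F
  proof -
    have F: "integrable \<mu> F"
      by (rule mu.integrable_const_bound[where B = B]) (use that absB in blast)+
    have "(\<integral>t. \<delta> \<partial>\<mu>) \<le> (\<integral>t. F t \<partial>\<mu>)" "(\<integral>t. F t \<partial>\<mu>) \<le> (\<integral>t. B \<partial>\<mu>)"
      using that F by (intro integral_mono; simp)+
    with F show ?thesis by (simp add: m_def space_mu mult.commute)
  qed
  have hb: "\<delta> * m \<le> h j z \<and> h j z \<le> B * m" if "j \<in> ?J" "z \<in> space ?N'" for j z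
  proof -
    have "(\<lambda>t. f (z(j := t))) \<in> borel_measurable \<mu>"
      using measurable_compose[OF measurable_Pair1'[OF that(2)] ms1[OF that(1)]] by simp
    then show ?thesis unfolding h_def using avg fb upd[OF that(2,1)] by blast
  qed
  have fi: "(\<lambda>t. f (x(i := t))) \<in> borel_measurable \<mu>" if "x \<in> space ?N" for x
    using measurable_compose[OF measurable_Pair1'[OF that] ms2] by simp
  have gb: "\<delta> * m \<le> g x \<and> g x \<le> B * m" if "x \<in> space ?N" for x
    unfolding g_def using avg[OF fi[OF that]] fb updi[OF that] by blast
  have \<delta>m: "\<delta> * m > 0" using insert.prems(4) m by simp
  define F where "F z = f z powr a * (\<Prod>j\<in>?J. h j z powr p)" for z
  have Fint: "integrable ?N' F"
  proof (rule N'.integrable_const_bound[where B = "B powr a * (\<Prod>j\<in>?J. (B * m) powr p)"])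
    show "F \<in> borel_measurable ?N'" unfolding F_def using hm by measurable
    show "AE z in ?N'. norm (F z) \<le> B powr a * (\<Prod>j\<in>?J. (B * m) powr p)"
    proof (rule AE_I2)
      fix z assume z: "z \<in> space ?N'"
      have "F z \<ge> 0" unfolding F_def by (intro mult_nonneg_nonneg prod_nonneg) auto
      moreover have "F z \<le> B powr a * (\<Prod>j\<in>?J. (B * m) powr p)"
        unfolding F_def
      proof (intro mult_mono prod_mono conjI)
        show "f z powr a \<le> B powr a" using fb[OF z] insert.prems(4) a by (intro powr_mono2) auto
        show "h j z powr p \<le> (B * m) powr p" if "j \<in> ?J" for j
          using hb[OF that z] \<delta>m p by (intro powr_mono2) auto
      qed (auto intro: prod_nonneg)
      ultimately show "norm (F z) \<le> B powr a * (\<Prod>j\<in>?J. (B * m) powr p)" by simp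
    qed
  qed
  \<comment> \<open>With the other coordinates fixed, the line integral in direction
    \<open>i\<close> does not depend on \<open>y\<close> and leaves the integral as
    \<open>g x powr p\<close>. The remaining factors are \<open>f\<close> with weight
    \<open>a\<close> and one line integral with weight \<open>p\<close> for each element of
    \<open>I\<close>, ready for the Hoelder inequality in \<open>y\<close>.\<close>
  have inner: "(\<integral>y. F (x(i := y)) \<partial>\<mu>) \<le> g x powr (1 - (real (card I) - 1) * p) * (\<Prod>j\<in>I. (\<integral>t. g (x(j := t)) \<partial>\<mu>) powr p)"
    and inner0: "0 \<le> g x powr (1 - (real (card I) - 1) * p) * (\<Prod>j\<in>I. (\<integral>t. g (x(j := t)) \<partial>\<mu>) powr p)"
    if x: "x \<in> space ?N" for x
  proof -
    define G where "G k y = (if k = i then f (x(i := y)) else h k (x(i := y)))" for k y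
    define w where "w k = (if k = i then a else p)" for k
    have hx: "(\<lambda>y. h k (x(i := y))) \<in> borel_measurable \<mu>" if "k \<in> ?J" for k
    proof -
      have "(\<lambda>y. x(i := y)) \<in> measurable \<mu> ?N'"
        using measurable_compose[OF measurable_Pair1'[OF x] measurable_add_dim[of i I "\<lambda>_. \<mu>"]] by simp
      from measurable_compose[OF this hm[OF that]] show ?thesis .
    qed
    \<comment> \<open>Fubini's theorem: integrating the line integral in direction \<open>j\<close>
      over the coordinate \<open>i\<close> gives the line integral of the marginal.\<close>
    have swap: "(\<integral>y. h j (x(i := y)) \<partial>\<mu>) = (\<integral>t. g (x(j := t)) \<partial>\<mu>)" if j: "j \<in> I" for j
    proof -
      interpret P: pair_sigma_finite \<mu> \<mu> ..
      have ne: "i \<noteq> j" using j insert.hyps by auto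
      have meas: "(\<lambda>(y, t). f (x(i := y, j := t))) \<in> borel_measurable (\<mu> \<Otimes>\<^sub>M \<mu>)"
      proof -
        have "(\<lambda>y. x(i := y)) \<in> measurable \<mu> ?N'"
          using measurable_compose[OF measurable_Pair1'[OF x] measurable_add_dim[of i I "\<lambda>_. \<mu>"]] by simp
        then have "(\<lambda>(y, t). (x(i := y), t)) \<in> measurable (\<mu> \<Otimes>\<^sub>M \<mu>) (?N' \<Otimes>\<^sub>M \<mu>)" by measurable
        from measurable_compose[OF this ms1[of j]] j show ?thesis by (simp add: case_prod_beta' fun_upd_def cong: if_cong)
      qed
      interpret PP: finite_measure "\<mu> \<Otimes>\<^sub>M \<mu>" by (rule finite_measure_pair_measure) (rule fin)+
      have "integrable (\<mu> \<Otimes>\<^sub>M \<mu>) (\<lambda>(y, t). f (x(i := y, j := t)))"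
      proof (rule PP.integrable_const_bound[where B = B])
        show "AE z in \<mu> \<Otimes>\<^sub>M \<mu>. norm (case z of (y, t) \<Rightarrow> f (x(i := y, j := t))) \<le> B"
        proof (rule AE_I2)
          fix z show "norm (case z of (y, t) \<Rightarrow> f (x(i := y, j := t))) \<le> B"
          proof (cases z)
            case (Pair y t)
            have "x(i := y, j := t) \<in> space ?N'" by (rule upd[OF updi[OF x] insertI2[OF j]])
            from absB[OF fb[OF this]] show ?thesis unfolding Pair split .
          qed
        qed
      qed (rule meas)
      from P.Fubini_integral[OF this]
      have "(\<integral>t. (\<integral>y. f (x(i := y, j := t)) \<partial>\<mu>) \<partial>\<mu>) = (\<integral>y. (\<integral>t. f (x(i := y, j := t)) \<partial>\<mu>) \<partial>\<mu>)" .
      then show ?thesis by (simp add: h_def g_def fun_upd_twist[OF ne])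
    qed
    have fx: "\<delta> \<le> f (x(i := y)) \<and> f (x(i := y)) \<le> B" for y by (rule fb[OF updi[OF x]])
    have hx': "\<delta> * m \<le> h k (x(i := y)) \<and> h k (x(i := y)) \<le> B * m" if "k \<in> ?J" for k y
      by (rule hb[OF that updi[OF x]])
    have Gmb: "G k \<in> borel_measurable \<mu>" if "k \<in> ?J" for k
      using fi[OF x] hx[OF that] by (auto simp: G_def[abs_def])
    have Gint: "integrable \<mu> (G k)" if "k \<in> ?J" for k
    proof (rule mu.integrable_const_bound[where B = "B + B * m", OF AE_I2 Gmb[OF that]])
      fix y
      have "0 \<le> B * m" using B m by simp
      then show "norm (G k y) \<le> B + B * m"
        using fx[of y] hx'[OF that, of y] B \<delta>m by (cases "k = i") (simp_all add: G_def)
    qed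
    have Gpos: "G k y > 0" if "k \<in> ?J" for k y
      using fx[of y] hx'[OF that, of y] insert.prems(4) \<delta>m by (cases "k = i") (simp_all add: G_def)
    have Gi: "(\<integral>y. G i y \<partial>\<mu>) = g x" by (simp add: G_def g_def)
    have Gj: "(\<integral>y. G j y \<partial>\<mu>) = (\<integral>t. g (x(j := t)) \<partial>\<mu>)" if "j \<in> I" for j
    proof -
      have "j \<noteq> i" using that insert.hyps by blast
      then show ?thesis using swap[OF that] by (simp add: G_def)
    qed
    have Gposi: "(\<integral>y. G k y \<partial>\<mu>) > 0" if "k \<in> ?J" for k
    proof (cases "k = i")
      case True then show ?thesis using Gi gb[OF x] \<delta>m by auto
    next
      case False
      have "(\<integral>y. \<delta> * m \<partial>\<mu>) \<le> (\<integral>y. G k y \<partial>\<mu>)"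
      proof (intro integral_mono Gint that)
        show "\<delta> * m \<le> G k y" for y using hx'[OF that, of y] False by (simp add: G_def)
      qed simp
      moreover have "(\<integral>y. \<delta> * m \<partial>\<mu>) = m * (\<delta> * m)" by (simp add: space_mu m_def[symmetric])
      ultimately show ?thesis using mult_pos_pos[OF m \<delta>m] by linarith
    qed
    have "(\<integral>y. F (x(i := y)) \<partial>\<mu>) = (\<integral>y. g x powr p * (\<Prod>k\<in>?J. G k y powr w k) \<partial>\<mu>)"
    proof (rule Bochner_Integration.integral_cong[OF refl])
      fix y
      have "(\<Prod>k\<in>?J. G k y powr w k) = f (x(i := y)) powr a * (\<Prod>k\<in>I. h k (x(i := y)) powr p)"
        using insert.hyps by (auto simp: G_def w_def intro!: prod.cong)
      moreover have "h i (x(i := y)) = g x" by (simp add: h_def g_def)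
      ultimately show "F (x(i := y)) = g x powr p * (\<Prod>k\<in>?J. G k y powr w k)"
        using insert.hyps by (simp add: F_def)
    qed
    also have "\<dots> = g x powr p * (\<integral>y. (\<Prod>k\<in>?J. G k y powr w k) \<partial>\<mu>)" by simp
    also have "\<dots> \<le> g x powr p * (\<Prod>k\<in>?J. (\<integral>y. G k y \<partial>\<mu>) powr w k)"
    proof (intro mult_left_mono Holder_prod Gint Gpos Gposi fin')
      have "(\<Sum>k\<in>I. w k) = real (card I) * p"
        using insert.hyps(2) by (subst sum.cong[OF refl, of I w "\<lambda>_. p"]) (auto simp: w_def)
      then show "(\<Sum>k\<in>?J. w k) = 1" using insert.hyps a(2) by (simp add: w_def)
    qed (use a p in \<open>auto simp: w_def\<close>)
    also have "(\<Prod>k\<in>?J. (\<integral>y. G k y \<partial>\<mu>) powr w k) = g x powr a * (\<Prod>j\<in>I. (\<integral>t. g (x(j := t)) \<partial>\<mu>) powr p)"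
    proof -
      have "(\<Prod>k\<in>I. (\<integral>y. G k y \<partial>\<mu>) powr w k) = (\<Prod>j\<in>I. (\<integral>t. g (x(j := t)) \<partial>\<mu>) powr p)"
        using insert.hyps(2) by (intro prod.cong refl) (auto simp: w_def Gj)
      then show ?thesis using insert.hyps by (simp add: Gi w_def)
    qed
    also have "g x powr p * (g x powr a * (\<Prod>j\<in>I. (\<integral>t. g (x(j := t)) \<partial>\<mu>) powr p))
       = g x powr (p + a) * (\<Prod>j\<in>I. (\<integral>t. g (x(j := t)) \<partial>\<mu>) powr p)" by (simp add: powr_add)
    \<comment> \<open>The two powers of \<open>g x\<close> combine to the exponent that the
      induction hypothesis demands for the smaller index set.\<close>
    also have "p + a = 1 - (real (card I) - 1) * p" using a(2) by (simp add: algebra_simps)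
    finally show "(\<integral>y. F (x(i := y)) \<partial>\<mu>) \<le> g x powr (1 - (real (card I) - 1) * p) * (\<Prod>j\<in>I. (\<integral>t. g (x(j := t)) \<partial>\<mu>) powr p)" .
    show "0 \<le> g x powr (1 - (real (card I) - 1) * p) * (\<Prod>j\<in>I. (\<integral>t. g (x(j := t)) \<partial>\<mu>) powr p)"
      by (intro mult_nonneg_nonneg prod_nonneg) auto
  qed
  have cI: "real (card I) * p \<le> 1 + p" using insert.prems(1) insert.hyps p(1) by (simp add: algebra_simps)
  have Gint: "integrable ?N (\<lambda>x. g x powr (1 - (real (card I) - 1) * p) * (\<Prod>j\<in>I. (\<integral>t. g (x(j := t)) \<partial>\<mu>) powr p))"
  proof (rule N.integrable_const_bound[where B = "(B * m) powr (1 - (real (card I) - 1) * p) * (\<Prod>j\<in>I. (B * m * m) powr p)"])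
    have ms: "(\<lambda>x. (\<integral>t. g (x(j := t)) \<partial>\<mu>)) \<in> borel_measurable ?N" if "j \<in> I" for j
    proof (rule sigma_finite_measure.borel_measurable_lebesgue_integral[OF sf])
      have "(\<lambda>(z, t). z(j := t)) \<in> measurable (?N \<Otimes>\<^sub>M \<mu>) ?N"
        using measurable_add_dim[of j I "\<lambda>_. \<mu>"] that by (simp add: insert_absorb)
      from measurable_compose[OF this gm] show "(\<lambda>(x, t). g (x(j := t))) \<in> borel_measurable (?N \<Otimes>\<^sub>M \<mu>)"
        by (simp add: case_prod_beta' fun_upd_def)
    qed
    show "(\<lambda>x. g x powr (1 - (real (card I) - 1) * p) * (\<Prod>j\<in>I. (\<integral>t. g (x(j := t)) \<partial>\<mu>) powr p)) \<in> borel_measurable ?N"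
      using gm ms by measurable
    show "AE x in ?N. norm (g x powr (1 - (real (card I) - 1) * p) * (\<Prod>j\<in>I. (\<integral>t. g (x(j := t)) \<partial>\<mu>) powr p))
       \<le> (B * m) powr (1 - (real (card I) - 1) * p) * (\<Prod>j\<in>I. (B * m * m) powr p)"
    proof (rule AE_I2)
      fix x assume x: "x \<in> space ?N"
      have "g x powr (1 - (real (card I) - 1) * p) * (\<Prod>j\<in>I. (\<integral>t. g (x(j := t)) \<partial>\<mu>) powr p)
       \<le> (B * m) powr (1 - (real (card I) - 1) * p) * (\<Prod>j\<in>I. (B * m * m) powr p)"
      proof (intro mult_mono prod_mono conjI)
        show "g x powr (1 - (real (card I) - 1) * p) \<le> (B * m) powr (1 - (real (card I) - 1) * p)"
          using gb[OF x] \<delta>m cI by (intro powr_mono2) (auto simp: algebra_simps)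
        show "(\<integral>t. g (x(j := t)) \<partial>\<mu>) powr p \<le> (B * m * m) powr p" if j: "j \<in> I" for j
        proof (intro powr_mono2 p)
          have nn: "0 \<le> g (x(j := t)) \<and> g (x(j := t)) \<le> B * m" for t
          proof -
            have "\<delta> * m \<le> g (x(j := t)) \<and> g (x(j := t)) \<le> B * m" by (rule gb[OF upd'[OF x j]])
            then show ?thesis using \<delta>m by linarith
          qed
          show "0 \<le> (\<integral>t. g (x(j := t)) \<partial>\<mu>)" using nn by (intro Bochner_Integration.integral_nonneg) auto
          have "(\<integral>t. g (x(j := t)) \<partial>\<mu>) \<le> (\<integral>t. B * m \<partial>\<mu>)"
            using nn B m by (intro integral_mono') auto
          then show "(\<integral>t. g (x(j := t)) \<partial>\<mu>) \<le> B * m * m" by (simp add: space_mu m_def mult_ac)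
        qed
      qed (auto intro: prod_nonneg)
      then show "norm (g x powr (1 - (real (card I) - 1) * p) * (\<Prod>j\<in>I. (\<integral>t. g (x(j := t)) \<partial>\<mu>) powr p))
       \<le> (B * m) powr (1 - (real (card I) - 1) * p) * (\<Prod>j\<in>I. (B * m * m) powr p)"
        using inner0[OF x] by simp
    qed
  qed
  have "(\<integral>z. F z \<partial>?N') = (\<integral>x. (\<integral>y. F (x(i := y)) \<partial>\<mu>) \<partial>?N)"
    using product_integral_insert[OF insert.hyps Fint] .
  also have "\<dots> \<le> (\<integral>x. g x powr (1 - (real (card I) - 1) * p) * (\<Prod>j\<in>I. (\<integral>t. g (x(j := t)) \<partial>\<mu>) powr p) \<partial>?N)"
    using inner inner0 by (intro integral_mono' Gint)
  also have "\<dots> \<le> (\<integral>x. g x \<partial>?N) powr (1 + p)"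
    using insert.IH[OF cI gm gb \<delta>m] .
  also have "(\<integral>x. g x \<partial>?N) = (\<integral>z. f z \<partial>?N')"
  proof -
    have "integrable ?N' f"
      by (rule N'.integrable_const_bound[where B = B]) (use fb absB f in blast)+
    from product_integral_insert[OF insert.hyps this] show ?thesis by (simp add: g_def)
  qed
  finally show ?case by (simp only: F_def a_def h_def)
qed

end

text \<open>Lebesgue measure cut off to an interval by a density instead of a restricted space: the
  measure becomes finite, while its space stays the whole line, so that changing one coordinate
  never leaves the space of the product.\<close>

definition clip :: "real \<Rightarrow> real measure" where
  "clip R = density lborel (\<lambda>t. ennreal (indicator {-R..R} t))"

lemma clip_facts:
  assumes "R > 0"
  shows "finite_measure (clip R)" "sets (clip R) = sets borel" "measure (clip R) UNIV > 0"
proof -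
  have e: "emeasure (clip R) UNIV = ennreal (2 * R)"
    using assms by (simp add: clip_def emeasure_density ennreal_indicator)
  then show "finite_measure (clip R)" by (intro finite_measureI) (simp add: clip_def)
  show "sets (clip R) = sets borel" by (simp add: clip_def)
  show "measure (clip R) UNIV > 0" using e assms by (simp add: measure_def)
qed

text \<open>The product of the densities is the density of the product. Measurable boxes suffice for
  the comparison, since they determine the product measure.\<close>

lemma PiM_clip:
  assumes R: "R > 0" and I: "finite I"
  shows "PiM I (\<lambda>_. clip R) = density (PiM I (\<lambda>_. lborel)) (\<lambda>x. ennreal (\<Prod>i\<in>I. indicator {-R..R} (x i)))"
proof -
  interpret C: product_sigma_finite "\<lambda>_. clip R"
    by (rule product_sigma_finite_mu[OF clip_facts[OF R]])
  interpret L: product_sigma_finite "\<lambda>_. lborel :: real measure" ..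
  let ?P = "density (PiM I (\<lambda>_. lborel)) (\<lambda>x. ennreal (\<Prod>i\<in>I. indicator {-R..R} (x i)))"
  have "?P = PiM I (\<lambda>_. clip R)"
  proof (rule C.PiM_eqI[OF I])
    show "sets ?P = sets (PiM I (\<lambda>_. clip R))"
      by (simp add: clip_facts(2)[OF R] cong: sets_PiM_cong)
    fix A :: "'a \<Rightarrow> real set" assume "\<And>i. i \<in> I \<Longrightarrow> A i \<in> sets (clip R)"
    then have A: "A i \<in> sets borel" if "i \<in> I" for i using that clip_facts(2)[OF R] by auto
    have PA: "Pi\<^sub>E I A \<in> sets (PiM I (\<lambda>_. lborel))" using A by (intro sets_PiM_I_finite I) auto
    have "emeasure ?P (Pi\<^sub>E I A) = (\<integral>\<^sup>+x. ennreal (\<Prod>i\<in>I. indicator {-R..R} (x i)) * indicator (Pi\<^sub>E I A) x \<partial>PiM I (\<lambda>_. lborel))"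
      by (rule emeasure_density[OF _ PA]) measurable
    also have "\<dots> = (\<integral>\<^sup>+x. (\<Prod>i\<in>I. ennreal (indicator {-R..R} (x i)) * indicator (A i) (x i)) \<partial>PiM I (\<lambda>_. lborel))"
    proof (rule nn_integral_cong)
      fix x assume "x \<in> space (PiM I (\<lambda>_. lborel :: real measure))"
      then have "(indicator (Pi\<^sub>E I A) x :: ennreal) = (\<Prod>i\<in>I. indicator (A i) (x i))"
      proof (cases "\<forall>i\<in>I. x i \<in> A i")
        case True
        then have "(\<Prod>i\<in>I. indicator (A i) (x i) :: ennreal) = 1" by (intro prod.neutral) auto
        moreover have "x \<in> Pi\<^sub>E I A"
          using True \<open>x \<in> space _\<close> by (auto simp: space_PiM PiE_def)
        ultimately show ?thesis by simp
      next
        case False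
        then obtain i where "i \<in> I" "x i \<notin> A i" by blast
        then have "(\<Prod>i\<in>I. indicator (A i) (x i) :: ennreal) = 0" using I by (intro prod_zero bexI[of _ i]) auto
        moreover have "x \<notin> Pi\<^sub>E I A" using \<open>i \<in> I\<close> \<open>x i \<notin> A i\<close> by auto
        ultimately show ?thesis by simp
      qed
      then show "ennreal (\<Prod>i\<in>I. indicator {-R..R} (x i)) * indicator (Pi\<^sub>E I A) x
         = (\<Prod>i\<in>I. ennreal (indicator {-R..R} (x i)) * indicator (A i) (x i))"
        by (simp add: prod.distrib prod_ennreal)
    qed
    also have "\<dots> = (\<Prod>i\<in>I. \<integral>\<^sup>+t. ennreal (indicator {-R..R} t) * indicator (A i) t \<partial>lborel)"
      using A by (intro L.product_nn_integral_prod[OF I]) auto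
    also have "\<dots> = (\<Prod>i\<in>I. emeasure (clip R) (A i))"
      using A by (intro prod.cong) (auto simp: clip_def emeasure_density)
    finally show "emeasure ?P (Pi\<^sub>E I A) = (\<Prod>i\<in>I. emeasure (clip R) (A i))" .
  qed
  then show ?thesis by simp
qed

section \<open>From coordinates to the Euclidean space\<close>

definition of_coords :: "('a::euclidean_space \<Rightarrow> real) \<Rightarrow> 'a" where
  "of_coords x = (\<Sum>b\<in>Basis. x b *\<^sub>R b)"

lemma of_coords_inner: "b \<in> Basis \<Longrightarrow> of_coords x \<bullet> b = x b"
  by (simp add: of_coords_def)

lemma of_coords_measurable [measurable]: "of_coords \<in> measurable (PiM Basis (\<lambda>_. lborel)) borel"
  unfolding of_coords_def by measurable

lemma of_coords_upd:
  "b \<in> Basis \<Longrightarrow> of_coords (x(b := t)) = of_coords x + (t - x b) *\<^sub>R b"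
  by (rule euclidean_eqI) (auto simp: of_coords_inner inner_add_left inner_Basis)

text \<open>Lebesgue measure on the Euclidean space is the image under \<open>of_coords\<close> of
  the product of the line measures. The cut-off in each factor is invisible to a function that
  vanishes outside the cube.\<close>

lemma integral_of_coords:
  fixes F :: "'a::euclidean_space \<Rightarrow> real"
  assumes R: "R > 0" and [measurable]: "F \<in> borel_measurable borel"
    and supp: "\<And>y b. b \<in> Basis \<Longrightarrow> \<bar>y \<bullet> b\<bar> > R \<Longrightarrow> F y = 0"
  shows "(\<integral>x. F (of_coords x) \<partial>PiM Basis (\<lambda>_. clip R)) = (\<integral>y. F y \<partial>lborel)"
proof -
  have "(\<integral>x. F (of_coords x) \<partial>PiM Basis (\<lambda>_. clip R))
    = (\<integral>x. (\<Prod>i\<in>Basis. indicator {-R..R} (x i)) *\<^sub>R F (of_coords x) \<partial>PiM Basis (\<lambda>_. lborel))"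
    unfolding PiM_clip[OF R finite_Basis] by (rule integral_density) (auto intro!: prod_nonneg AE_I2)
  also have "\<dots> = (\<integral>x. F (of_coords x) \<partial>PiM Basis (\<lambda>_. lborel))"
  proof (rule Bochner_Integration.integral_cong[OF refl])
    fix x :: "'a \<Rightarrow> real"
    show "(\<Prod>i\<in>Basis. indicator {-R..R} (x i)) *\<^sub>R F (of_coords x) = F (of_coords x)"
    proof (cases "\<exists>b\<in>Basis. \<bar>x b\<bar> > R")
      case True
      then show ?thesis using supp[of _ "of_coords x"] by (auto simp: of_coords_inner)
    next
      case False
      then have "(\<Prod>i\<in>Basis. indicator {-R..R} (x i) :: real) = 1"
        by (intro prod.neutral) (auto simp: indicator_def not_less abs_le_iff)
      then show ?thesis by simp
    qed
  qed
  also have "\<dots> = (\<integral>y. F y \<partial>distr (PiM Basis (\<lambda>_. lborel)) borel of_coords)"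
    by (rule integral_distr[symmetric]) measurable
  also have "distr (PiM Basis (\<lambda>_. lborel)) borel (of_coords :: _ \<Rightarrow> 'a) = lborel"
    unfolding of_coords_def[abs_def] by (rule lborel_eq[symmetric])
  finally show ?thesis .
qed

text \<open>On the line in direction \<open>b\<close> the function vanishes at the coordinate
  \<open>- R\<close>, because \<open>K\<close> lies strictly inside the cube, so the fundamental
  theorem of calculus writes its value as an integral of a component of the gradient.\<close>

lemma C1c_le_line_integral:
  fixes w :: "'a::euclidean_space \<Rightarrow> real"
  assumes C: "C1c K w g" and R: "R > 0" and KR: "\<And>y b. y \<in> K \<Longrightarrow> b \<in> Basis \<Longrightarrow> \<bar>y \<bullet> b\<bar> < R"
    and b: "b \<in> Basis"
  shows "\<bar>w (of_coords x)\<bar> \<le> (\<integral>t. norm (g (of_coords (x(b := t)))) \<partial>clip R)"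
proof (cases "of_coords x \<in> K")
  case False
  then show ?thesis using C1c_facts(4)[OF C] by (simp add: Bochner_Integration.integral_nonneg)
next
  case True
  define s where "s = x b"
  have s: "- R < s" "s < R" using KR[OF True b] b by (auto simp: of_coords_inner s_def)
  define c where "c t = of_coords (x(b := t))" for t
  have c: "c t = (of_coords x - s *\<^sub>R b) + t *\<^sub>R b" for t
    using b by (simp add: c_def of_coords_upd s_def algebra_simps)
  have cs: "c s = of_coords x" by (simp add: c_def s_def)
  have cb: "c (-R) \<notin> K" using KR[OF _ b, of "c (-R)"] R b by (auto simp: c_def of_coords_inner)
  have contc: "continuous_on UNIV c" unfolding c[abs_def] by (intro continuous_intros)
  have contg: "continuous_on A (\<lambda>t. g (c t))" for A
    using continuous_on_compose2[OF C1c_facts(3)[OF C] contc] by (auto intro: continuous_on_subset)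
  have dc: "((\<lambda>t. w (c t)) has_vector_derivative (g (c t) \<bullet> b)) (at t within A)" for t A
  proof -
    have "(c has_derivative (\<lambda>h. h *\<^sub>R b)) (at t)" unfolding c[abs_def] by (auto intro!: derivative_eq_intros)
    from has_derivative_compose[OF this C1c_facts(2)[OF C]]
    have "((\<lambda>t. w (c t)) has_derivative (\<lambda>h. h * (g (c t) \<bullet> b))) (at t)" by simp
    then show ?thesis unfolding has_vector_derivative_def by (auto intro: has_derivative_at_withinI)
  qed
  have I: "integrable lborel (\<lambda>t. indicator {-r..s'} t *\<^sub>R norm (g (c t)))" for r s'
    by (rule borel_integrable_compact) (auto intro!: continuous_intros contg)
  have "w (of_coords x) = w (c s) - w (c (-R))" using C1c_facts(4)[OF C] cb cs by simp
  also have "\<dots> = (\<integral>t. indicator {-R..s} t *\<^sub>R (g (c t) \<bullet> b) \<partial>lborel)"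
    using s by (intro integral_FTC_Icc[symmetric] dc continuous_intros contg) auto
  finally have "\<bar>w (of_coords x)\<bar> \<le> (\<integral>t. \<bar>indicator {-R..s} t *\<^sub>R (g (c t) \<bullet> b)\<bar> \<partial>lborel)" by simp
  also have "\<dots> \<le> (\<integral>t. indicator {-R..R} t *\<^sub>R norm (g (c t)) \<partial>lborel)"
  proof (rule integral_mono'[OF I])
    fix t
    have "\<bar>g (c t) \<bullet> b\<bar> \<le> norm (g (c t))" using Basis_le_norm[OF b] .
    then show "\<bar>indicator {-R..s} t *\<^sub>R (g (c t) \<bullet> b)\<bar> \<le> indicator {-R..R} t *\<^sub>R norm (g (c t))"
      using s by (auto simp: indicator_def)
  qed auto
  also have "\<dots> = (\<integral>t. norm (g (c t)) \<partial>clip R)"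
    unfolding clip_def
    by (rule integral_density[symmetric])
      (auto intro!: borel_measurable_continuous_onI continuous_on_norm contg simp del: borel_measurable_norm)
  finally show ?thesis by (simp add: c_def)
qed

text \<open>The power \<open>s\<close> is distributed evenly over the coordinate directions, each
  factor is bounded by the integral of the gradient along the line in its direction, and
  \<open>grid_lines\<close> estimates the product. The cube containing the support makes the line
  measures finite, as required there.\<close>

lemma gagliardo_nirenberg:
  fixes w :: "'a::euclidean_space \<Rightarrow> real"
  assumes C: "C1c K w g" and n: "DIM('a) \<ge> 2"
  defines "s \<equiv> real DIM('a) / (real DIM('a) - 1)"
  shows "(\<integral>x. \<bar>w x\<bar> powr s \<partial>lborel) \<le> (\<integral>x. norm (g x) \<partial>lborel) powr s"
proof -
  have "bounded K" using C1c_facts(1)[OF C] by (rule compact_imp_bounded)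
  then obtain R0 where R0: "R0 > 0" "\<And>y. y \<in> K \<Longrightarrow> norm y \<le> R0" unfolding bounded_pos by auto
  define R where "R = R0 + 1"
  have R: "R > 0" using R0 by (simp add: R_def)
  have KR: "\<bar>y \<bullet> b\<bar> < R" if "y \<in> K" "b \<in> Basis" for y b
    using Basis_le_norm[OF that(2), of y] R0(2)[OF that(1)] by (simp add: R_def)
  note clip = clip_facts[OF R]
  let ?P = "PiM (Basis :: 'a set) (\<lambda>_. clip R)"
  interpret P: finite_measure ?P by (rule finite_measure_PiM_mu[OF clip finite_Basis])
  \<comment> \<open>The extreme admissible value in \<open>grid_lines\<close>: the exponent of
    \<open>f\<close> becomes 0, and the exponents of the line integrals add up to
    \<open>s = 1 + p\<close>.\<close>
  define p where "p = 1 / (real DIM('a) - 1)"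
  have p: "p \<ge> 0" "real DIM('a) * p \<le> 1 + p" "1 + p = s" "1 - (real DIM('a) - 1) * p = 0" "real DIM('a) * p = s"
    using n by (auto simp: p_def s_def field_simps)
  have s: "s > 0" using n by (simp add: s_def)
  have [measurable]: "w \<in> borel_measurable borel" "g \<in> borel_measurable borel"
    using C1c_facts[OF C] by (auto intro: borel_measurable_continuous_onI)
  have [measurable]: "of_coords \<in> measurable ?P borel"
  proof -
    have "sets ?P = sets (PiM Basis (\<lambda>_. lborel))" by (intro sets_PiM_cong) (auto simp: clip(2))
    from measurable_cong_sets[OF this refl] of_coords_measurable show ?thesis by blast
  qed
  obtain L where L: "L > 0" "\<And>x. norm (g x) \<le> L" using C1c_lipschitz[OF C] by metis
  have gint: "integrable ?P (\<lambda>x. norm (g (of_coords x)))"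
    by (rule P.integrable_const_bound[where B = L]) (use L in auto)
  have intg: "(\<integral>x. norm (g (of_coords x)) \<partial>?P) = (\<integral>x. norm (g x) \<partial>lborel)"
    by (rule integral_of_coords[OF R]) (use KR C1c_facts(5)[OF C] in \<open>fastforce\<close>)+
  have intw: "(\<integral>x. \<bar>w (of_coords x)\<bar> powr s \<partial>?P) = (\<integral>x. \<bar>w x\<bar> powr s \<partial>lborel)"
    by (rule integral_of_coords[OF R]) (use KR C1c_facts(4)[OF C] in \<open>fastforce\<close>)+
  \<comment> \<open>The norm of the gradient may vanish, so it is raised by \<open>\<delta>\<close>
    to meet the positive lower bound in \<open>grid_lines\<close>. On the cube this adds only finite
    mass, which disappears as \<open>\<delta>\<close> tends to 0.\<close>
  have le: "(\<integral>x. \<bar>w x\<bar> powr s \<partial>lborel) \<le> ((\<integral>x. norm (g x) \<partial>lborel) + \<delta> * measure ?P (space ?P)) powr s"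
    if \<delta>: "\<delta> > 0" for \<delta>
  proof -
    define f where "f x = norm (g (of_coords x)) + \<delta>" for x
    have fm [measurable]: "f \<in> borel_measurable ?P" unfolding f_def by measurable
    have fb: "\<delta> \<le> f x \<and> f x \<le> L + \<delta>" for x using L by (simp add: f_def)
    have fm1: "(\<lambda>t. f (x(b := t))) \<in> borel_measurable (clip R)" if "b \<in> Basis" for x b
    proof -
      have "continuous_on UNIV (\<lambda>t. norm (g (of_coords x + (t - x b) *\<^sub>R b)) + \<delta>)"
        by (intro continuous_intros continuous_on_compose2[OF C1c_facts(3)[OF C]]) auto
      then have "(\<lambda>t. norm (g (of_coords x + (t - x b) *\<^sub>R b)) + \<delta>) \<in> borel_measurable borel"
        by (rule borel_measurable_continuous_onI)
      then show ?thesis using clip(2) by (simp add: f_def of_coords_upd[OF that] measurable_cong_sets[OF clip(2) refl])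
    qed
    have wf: "\<bar>w (of_coords x)\<bar> \<le> (\<integral>t. f (x(b := t)) \<partial>clip R)" if b: "b \<in> Basis" for x b
    proof -
      interpret c: finite_measure "clip R" by (rule clip)
      have i: "integrable (clip R) (\<lambda>t. f (x(b := t)))"
        by (rule c.integrable_const_bound[where B = "L + \<delta>", OF _ fm1[OF b]]) (use fb \<delta> in \<open>auto intro!: AE_I2 simp: f_def\<close>)
      have "\<bar>w (of_coords x)\<bar> \<le> (\<integral>t. norm (g (of_coords (x(b := t)))) \<partial>clip R)"
        by (rule C1c_le_line_integral[OF C R KR b])
      also have "\<dots> \<le> (\<integral>t. f (x(b := t)) \<partial>clip R)"
        by (rule integral_mono'[OF i]) (use \<delta> in \<open>auto simp: f_def\<close>)
      finally show ?thesis .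
    qed
    have pt: "\<bar>w (of_coords x)\<bar> powr s \<le> f x powr (1 - (real DIM('a) - 1) * p) * (\<Prod>b\<in>Basis. (\<integral>t. f (x(b := t)) \<partial>clip R) powr p)" for x
    proof -
      have "\<bar>w (of_coords x)\<bar> powr s = (\<Prod>b\<in>(Basis::'a set). \<bar>w (of_coords x)\<bar> powr p)"
      proof (cases "w (of_coords x) = 0")
        case False
        then have "(\<Prod>b\<in>(Basis::'a set). \<bar>w (of_coords x)\<bar> powr p) = \<bar>w (of_coords x)\<bar> powr (p * real DIM('a))"
          by (simp add: powr_powr flip: powr_realpow)
        also have "p * real DIM('a) = s" using p(5) by (simp add: mult.commute)
        finally show ?thesis by simp
      qed (use s in simp)
      also have "\<dots> \<le> (\<Prod>b\<in>Basis. (\<integral>t. f (x(b := t)) \<partial>clip R) powr p)"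
        using wf by (intro prod_mono conjI powr_mono2 p) auto
      \<comment> \<open>A factor with exponent 0 is inserted; it equals 1 only because
        \<open>f x\<close> is positive.\<close>
      also have "\<dots> = f x powr (1 - (real DIM('a) - 1) * p) * (\<Prod>b\<in>Basis. (\<integral>t. f (x(b := t)) \<partial>clip R) powr p)"
        using fb[of x] \<delta> by (simp add: p(4))
      finally show ?thesis .
    qed
    have "(\<integral>x. \<bar>w x\<bar> powr s \<partial>lborel) \<le> (\<integral>x. f x powr (1 - (real DIM('a) - 1) * p) * (\<Prod>b\<in>Basis. (\<integral>t. f (x(b := t)) \<partial>clip R) powr p) \<partial>?P)"
      unfolding intw[symmetric]
    proof (rule integral_mono'[OF _ pt])
      show "integrable ?P (\<lambda>x. f x powr (1 - (real DIM('a) - 1) * p) * (\<Prod>b\<in>Basis. (\<integral>t. f (x(b := t)) \<partial>clip R) powr p))"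
      proof (rule P.integrable_const_bound[where B = "(\<Prod>b\<in>(Basis::'a set). ((L + \<delta>) * measure (clip R) UNIV) powr p)"])
        interpret c: finite_measure "clip R" by (rule clip)
        have spc: "space (clip R) = UNIV" by (simp add: clip_def)
        have ms: "(\<lambda>x. \<integral>t. f (x(b := t)) \<partial>clip R) \<in> borel_measurable ?P" if b: "b \<in> Basis" for b
        proof (rule c.borel_measurable_lebesgue_integral)
          have "(\<lambda>(z, t). z(b := t)) \<in> measurable (?P \<Otimes>\<^sub>M clip R) ?P"
            using measurable_add_dim[of b Basis "\<lambda>_. clip R"] unfolding insert_absorb[OF b] .
          from measurable_compose[OF this fm] show "(\<lambda>(x, t). f (x(b := t))) \<in> borel_measurable (?P \<Otimes>\<^sub>M clip R)"
            by (simp add: case_prod_beta' fun_upd_def)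
        qed
        then show "(\<lambda>x. f x powr (1 - (real DIM('a) - 1) * p) * (\<Prod>b\<in>Basis. (\<integral>t. f (x(b := t)) \<partial>clip R) powr p)) \<in> borel_measurable ?P"
          by measurable
        have "f x powr (1 - (real DIM('a) - 1) * p) * (\<Prod>b\<in>Basis. (\<integral>t. f (x(b := t)) \<partial>clip R) powr p)
           \<le> (\<Prod>b\<in>(Basis::'a set). ((L + \<delta>) * measure (clip R) UNIV) powr p)" for x
        proof -
          have "(\<integral>t. f (x(b := t)) \<partial>clip R) \<le> (L + \<delta>) * measure (clip R) UNIV" if "b \<in> Basis" for b
          proof -
            have "(\<integral>t. f (x(b := t)) \<partial>clip R) \<le> (\<integral>t. L + \<delta> \<partial>clip R)"
              using fb L \<delta> by (intro integral_mono') auto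
            then show ?thesis by (simp add: spc mult.commute)
          qed
          moreover have "0 \<le> (\<integral>t. f (x(b := t)) \<partial>clip R)" for b
            using fb \<delta> by (intro Bochner_Integration.integral_nonneg) (meson less_le_trans less_imp_le)
          ultimately have "(\<Prod>b\<in>Basis. (\<integral>t. f (x(b := t)) \<partial>clip R) powr p) \<le> (\<Prod>b\<in>(Basis::'a set). ((L + \<delta>) * measure (clip R) UNIV) powr p)"
            by (intro prod_mono conjI powr_mono2 p) auto
          then show ?thesis using fb[of x] \<delta> by (simp add: p(4))
        qed
        moreover have "0 \<le> f x powr (1 - (real DIM('a) - 1) * p) * (\<Prod>b\<in>Basis. (\<integral>t. f (x(b := t)) \<partial>clip R) powr p)" for x
          by (intro mult_nonneg_nonneg prod_nonneg) auto
        ultimately show "AE x in ?P. norm (f x powr (1 - (real DIM('a) - 1) * p) * (\<Prod>b\<in>Basis. (\<integral>t. f (x(b := t)) \<partial>clip R) powr p))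
           \<le> (\<Prod>b\<in>(Basis::'a set). ((L + \<delta>) * measure (clip R) UNIV) powr p)"
          by (intro AE_I2) (simp only: real_norm_def abs_of_nonneg)
      qed
    qed (intro mult_nonneg_nonneg prod_nonneg; simp)
    also have "\<dots> \<le> (\<integral>x. f x \<partial>?P) powr (1 + p)"
      using grid_lines[OF clip finite_Basis p(1,2) fm fb \<delta>] .
    also have "(\<integral>x. f x \<partial>?P) = (\<integral>x. norm (g x) \<partial>lborel) + \<delta> * measure ?P (space ?P)"
      unfolding f_def using gint by (simp add: intg mult.commute)
    finally show ?thesis by (simp add: p(3))
  qed
  have "((\<lambda>\<delta>. ((\<integral>x. norm (g x) \<partial>lborel) + \<delta> * measure ?P (space ?P)) powr s) \<longlongrightarrow>
     ((\<integral>x. norm (g x) \<partial>lborel) + 0 * measure ?P (space ?P)) powr s) (at_right 0)"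
    using s by (intro tendsto_powr2 tendsto_intros) (auto simp: eventually_at_filter intro!: add_nonneg_nonneg)
  then have "(\<integral>x. \<bar>w x\<bar> powr s \<partial>lborel) \<le> ((\<integral>x. norm (g x) \<partial>lborel) + 0 * measure ?P (space ?P)) powr s"
    by (rule tendsto_lowerbound) (auto simp: eventually_at_filter intro!: always_eventually le)
  then show ?thesis by simp
qed

section \<open>The Sobolev inequality for exponents above 1\<close>

lemma Holder_inequality:
  fixes f g :: "'a \<Rightarrow> real"
  assumes pq: "p > 1" "1 / p + 1 / q = 1" and nn: "\<And>x. 0 \<le> f x" "\<And>x. 0 \<le> g x"
    and [measurable]: "f \<in> borel_measurable M" "g \<in> borel_measurable M"
    and i: "integrable M (\<lambda>x. f x powr p)" "integrable M (\<lambda>x. g x powr q)"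
  shows "(\<integral>x. f x * g x \<partial>M) \<le> (\<integral>x. f x powr p \<partial>M) powr (1 / p) * (\<integral>x. g x powr q \<partial>M) powr (1 / q)"
proof -
  have "0 < 1 / p" "1 / p < 1" using pq(1) by simp_all
  then have "0 < 1 / q" "1 / q < 1" using pq(2) by linarith+
  then have q: "q > 1" by (simp add: divide_less_eq)
  define A B where "A = (\<integral>x. f x powr p \<partial>M)" and "B = (\<integral>x. g x powr q \<partial>M)"
  have AB: "A \<ge> 0" "B \<ge> 0" by (auto simp: A_def B_def)
  have zero: "(\<integral>x. f x * g x \<partial>M) = 0" if "A = 0 \<or> B = 0"
  proof -
    have "AE x in M. f x powr p = 0 \<or> g x powr q = 0"
      using that integral_nonneg_eq_0_iff_AE[OF i(1)] integral_nonneg_eq_0_iff_AE[OF i(2)]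
      by (auto simp: A_def B_def elim: eventually_mono)
    then have "AE x in M. f x * g x = 0" by eventually_elim auto
    then have "(\<integral>x. f x * g x \<partial>M) = (\<integral>x. 0 \<partial>M)" by (intro integral_cong_AE) auto
    then show ?thesis by simp
  qed
  show ?thesis
  proof (cases "A = 0 \<or> B = 0")
    case True
    then show ?thesis using zero by (auto simp: A_def[symmetric] B_def[symmetric])
  next
    case False
    then have pos: "A > 0" "B > 0" using AB by auto
    define a b where "a = A powr (1 / p)" and "b = B powr (1 / q)"
    have ab: "a > 0" "b > 0" "a powr p = A" "b powr q = B"
      using pos pq q by (auto simp: a_def b_def powr_powr)
    have "(\<integral>x. f x * g x \<partial>M) \<le> (\<integral>x. a * b * (f x powr p / A / p + g x powr q / B / q) \<partial>M)"
    proof (rule integral_mono')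
      show "integrable M (\<lambda>x. a * b * (f x powr p / A / p + g x powr q / B / q))" using i by auto
      fix x
      have "(f x / a) * (g x / b) \<le> (f x / a) powr p / p + (g x / b) powr q / q"
        using nn ab pq q by (intro Youngs_inequality) auto
      also have "\<dots> = f x powr p / A / p + g x powr q / B / q"
        using nn ab by (simp add: powr_divide)
      finally show "f x * g x \<le> a * b * (f x powr p / A / p + g x powr q / B / q)"
        using ab by (simp add: field_simps)
      show "0 \<le> a * b * (f x powr p / A / p + g x powr q / B / q)"
        using ab pos pq q by (intro mult_nonneg_nonneg add_nonneg_nonneg) auto
    qed
    also have "\<dots> = a * b * (1 / p + 1 / q)"
      using i pos by (simp add: A_def[symmetric] B_def[symmetric])
    finally show ?thesis by (simp add: pq(2) a_def b_def A_def B_def)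
  qed
qed

text \<open>At the origin the difference quotient is the duality map itself, so its continuity there
  supplies the derivative 0.\<close>

lemma DERIV_abs_powr:
  assumes "r > 1"
  shows "((\<lambda>t::real. \<bar>t\<bar> powr r) has_real_derivative r * dual_pow r t) (at t)"
proof (cases t "0::real" rule: linorder_cases)
  case less
  have "((\<lambda>t. (- t) powr r) has_real_derivative r * dual_pow r t) (at t)"
    using less by (auto intro!: derivative_eq_intros simp: dual_pow_def powr_diff power2_eq_square field_simps)
  then show ?thesis
    by (rule has_field_derivative_transform_within[where d = "-t"]) (use less in \<open>auto simp: dist_real_def\<close>)
next
  case equal
  have "((\<lambda>t::real. t * \<bar>t\<bar> powr (r - 2)) \<longlongrightarrow> 0) (at 0)"
  proof -
    have "((\<lambda>t::real. dual_pow r t) \<longlongrightarrow> dual_pow r 0) (at 0)"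
      using bspec[OF continuous_dual_pow[OF assms, unfolded continuous_on_def] UNIV_I, of "0::real"] by simp
    then show ?thesis by (simp add: dual_pow_def mult.commute)
  qed
  moreover have "\<forall>\<^sub>F t::real in at 0. t * \<bar>t\<bar> powr (r - 2) = (\<bar>t\<bar> powr r - \<bar>0\<bar> powr r) / (t - 0)"
    using assms by (auto simp: eventually_at_filter powr_diff field_simps power2_eq_square intro!: always_eventually)
  ultimately have "((\<lambda>t. (\<bar>t\<bar> powr r - \<bar>0\<bar> powr r) / (t - 0)) \<longlongrightarrow> 0) (at (0::real))"
    by (rule Lim_transform_eventually)
  then show ?thesis unfolding equal has_field_derivative_iff by (simp only: dual_pow_0 mult_zero_right)
next
  case greater
  have "((\<lambda>t. t powr r) has_real_derivative r * dual_pow r t) (at t)"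
    using greater by (auto intro!: derivative_eq_intros simp: dual_pow_def powr_diff power2_eq_square field_simps)
  then show ?thesis
    by (rule has_field_derivative_transform_within[where d = t]) (use greater in \<open>auto simp: dist_real_def\<close>)
qed

lemma C1c_abs_powr:
  assumes C: "C1c K w g" and r: "r > 1"
  shows "C1c K (\<lambda>x. \<bar>w x\<bar> powr r) (\<lambda>x. (r * dual_pow r (w x)) *\<^sub>R g x)"
  unfolding C1c_def
proof (intro conjI allI impI)
  show "((\<lambda>x. \<bar>w x\<bar> powr r) has_derivative (\<lambda>h. (r * dual_pow r (w x)) *\<^sub>R g x \<bullet> h)) (at x)" for x
    using has_derivative_compose[OF C1c_facts(2)[OF C] DERIV_abs_powr[OF r, unfolded has_field_derivative_def]]
    by simp
  show "continuous_on UNIV (\<lambda>x. (r * dual_pow r (w x)) *\<^sub>R g x)"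
    by (intro continuous_intros continuous_dual_pow_compose[OF r] C1c_facts[OF C])
qed (use C1c_facts[OF C] r in auto)

text \<open>The Gagliardo-Nirenberg inequality is applied to \<open>\<bar>w\<bar> powr r\<close>,
  whose gradient is a product of \<open>\<bar>w\<bar> powr (r - 1)\<close> and \<open>g\<close>; the
  Hoelder inequality separates the two.\<close>

lemma sobolev_inequality_C1c:
  assumes n: "DIM('a::euclidean_space) \<ge> 2" and p: "1 < p" "p < real DIM('a)"
  defines "ps \<equiv> crit_exp TYPE('a) p"
  obtains C where "C > 0"
    "\<And>K (w :: 'a \<Rightarrow> real) g. C1c K w g \<Longrightarrow> (\<integral>x. \<bar>w x\<bar> powr ps \<partial>lborel) \<le> C * (\<integral>x. norm (g x) powr p \<partial>lborel) powr (ps / p)"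
proof -
  define N where "N = real DIM('a)"
  define s where "s = N / (N - 1)"
  \<comment> \<open>The one power for which both sides involve the same integral of
    \<open>w\<close>: on the left \<open>r * s = ps\<close>, and after the Hoelder inequality
    \<open>(r - 1) * q = ps\<close> for the conjugate exponent \<open>q\<close>.\<close>
  define r where "r = p * (N - 1) / (N - p)"
  define q where "q = p / (p - 1)"
  have N: "N \<ge> 2" "p < N" using n p by (auto simp: N_def)
  have ps: "ps = N * p / (N - p)" by (simp add: ps_def crit_exp_def N_def)
  have ps0: "ps > 0" using N p by (simp add: ps)
  have s0: "s > 0" using N by (simp add: s_def)
  have r1: "r - 1 = N * (p - 1) / (N - p)" using N by (simp add: r_def field_simps)
  moreover have "N * (p - 1) / (N - p) > 0" using N p by simp
  ultimately have r: "r > 1" by linarith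
  have cancel: "x * a / b * (y / a) = x * y / b" if "a \<noteq> 0" for a b x y :: real using that by simp
  have rs: "r * s = ps" unfolding r_def s_def ps using N by (subst cancel) (auto simp: mult.commute)
  have rq: "(r - 1) * q = ps" unfolding r1 q_def ps using p by (subst cancel) auto
  have pq: "1 / p + 1 / q = 1" using p by (simp add: q_def field_simps)
  have ex: "1 / s - 1 / q = 1 / ps" using N p by (simp add: s_def q_def ps field_simps)
  have "(\<integral>x. \<bar>w x\<bar> powr ps \<partial>lborel) \<le> r powr ps * (\<integral>x. norm (g x) powr p \<partial>lborel) powr (ps / p)"
    if C: "C1c K w g" for K and w :: "'a \<Rightarrow> real" and g
  proof -
    define X Y where "X = (\<integral>x. \<bar>w x\<bar> powr ps \<partial>lborel)" and "Y = (\<integral>x. norm (g x) powr p \<partial>lborel)"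
    have X0: "X \<ge> 0" and Y0: "Y \<ge> 0" by (auto simp: X_def Y_def)
    note C' = C1c_abs_powr[OF C r]
    have [measurable]: "w \<in> borel_measurable borel" "g \<in> borel_measurable borel"
      using C1c_facts[OF C] by (auto intro: borel_measurable_continuous_onI)
    have i1: "integrable lborel (\<lambda>x. (\<bar>w x\<bar> powr (r - 1)) powr q)"
      unfolding powr_powr rq using C1c_facts[OF C] ps0
      by (intro continuous_compact_support_integrable[where K = K] continuous_on_powr' continuous_intros) auto
    have i2: "integrable lborel (\<lambda>x. norm (g x) powr p)"
      using C1c_facts[OF C] p
      by (intro continuous_compact_support_integrable[where K = K] continuous_norm_powr) auto
    have "X = (\<integral>x. \<bar>\<bar>w x\<bar> powr r\<bar> powr s \<partial>lborel)" by (simp add: X_def powr_powr rs)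
    also have "\<dots> \<le> (\<integral>x. norm ((r * dual_pow r (w x)) *\<^sub>R g x) \<partial>lborel) powr s"
      unfolding s_def N_def by (rule gagliardo_nirenberg[OF C' n])
    also have "(\<integral>x. norm ((r * dual_pow r (w x)) *\<^sub>R g x) \<partial>lborel) = r * (\<integral>x. norm (g x) * \<bar>w x\<bar> powr (r - 1) \<partial>lborel)"
      using r norm_dual_pow[of r "w _ :: real"] by (simp add: abs_mult mult_ac)
    also have "(r * (\<integral>x. norm (g x) * \<bar>w x\<bar> powr (r - 1) \<partial>lborel)) powr s \<le> (r * (Y powr (1 / p) * X powr (1 / q))) powr s"
    proof (intro powr_mono2 mult_left_mono)
      show "(\<integral>x. norm (g x) * \<bar>w x\<bar> powr (r - 1) \<partial>lborel) \<le> Y powr (1 / p) * X powr (1 / q)"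
        using Holder_inequality[OF p(1) pq _ _ _ _ i2 i1] by (simp add: X_def Y_def powr_powr rq)
    qed (use s0 r in \<open>auto intro!: mult_nonneg_nonneg Bochner_Integration.integral_nonneg\<close>)
    finally have X: "X \<le> (r * (Y powr (1 / p) * X powr (1 / q))) powr s" .
    \<comment> \<open>The integral \<open>X\<close> reappears on the right with a smaller power. If
      it is nonzero, dividing by \<open>X powr (1 / q)\<close> leaves the exponent
      \<open>1 / s - 1 / q = 1 / ps\<close>.\<close>
    show ?thesis
    proof (cases "X = 0")
      case False
      then have Xp: "X > 0" using X0 by simp
      have "X powr (1 / s) \<le> ((r * (Y powr (1 / p) * X powr (1 / q))) powr s) powr (1 / s)"
        using X X0 s0 by (intro powr_mono2) auto
      also have "\<dots> = r * (Y powr (1 / p) * X powr (1 / q))"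
        using s0 r by (simp add: powr_powr)
      finally have "X powr (1 / s) \<le> r * Y powr (1 / p) * X powr (1 / q)" by (simp add: mult.assoc)
      moreover have "X powr (1 / s) = X powr (1 / ps) * X powr (1 / q)"
      proof -
        have "1 / s = 1 / ps + 1 / q" using ex by (simp add: algebra_simps)
        then show ?thesis by (simp only: powr_add)
      qed
      ultimately have "X powr (1 / ps) \<le> r * Y powr (1 / p)" using Xp by simp
      then have "(X powr (1 / ps)) powr ps \<le> (r * Y powr (1 / p)) powr ps"
        using ps0 by (intro powr_mono2) auto
      then show ?thesis using ps0 r X0 by (simp add: powr_powr powr_mult X_def[symmetric] Y_def[symmetric])
    qed (simp add: X_def[symmetric])
  qed
  moreover have "r powr ps > 0" using r by simp
  ultimately show ?thesis using that by blast
qed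

section \<open>Weak gradients\<close>

lemma integral_lebesgue_on_eq_lborel:
  fixes f :: "'a::euclidean_space \<Rightarrow> 'b::euclidean_space"
  assumes \<Omega>: "\<Omega> \<in> sets lebesgue" and f: "integrable lborel f" and supp: "\<And>x. x \<notin> \<Omega> \<Longrightarrow> f x = 0"
  shows "integrable (lebesgue_on \<Omega>) f" "(\<integral>x. f x \<partial>lebesgue_on \<Omega>) = (\<integral>x. f x \<partial>lborel)"
proof -
  have eq: "(\<lambda>x. indicator \<Omega> x *\<^sub>R f x) = f" using supp by (auto simp: indicator_def fun_eq_iff)
  show "integrable (lebesgue_on \<Omega>) f" "(\<integral>x. f x \<partial>lebesgue_on \<Omega>) = (\<integral>x. f x \<partial>lborel)"
    using \<Omega> f by (simp_all add: integrable_restrict_space integral_restrict_space eq integrable_completion integral_completion)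
qed

lemma AE_lebesgue_on_iff:
  assumes "\<Omega> \<in> sets lebesgue"
  shows "(AE x in lebesgue_on \<Omega>. P x) \<longleftrightarrow> (AE x in lebesgue. x \<in> \<Omega> \<longrightarrow> P x)"
  using assms by (simp add: AE_restrict_space_iff)

text \<open>Completeness of the Lebesgue measure. It gives measurability of weak gradients that are
  known only up to null sets, such as those selected by choice in \<open>weak_grad\<close>.\<close>

lemma lebesgue_on_measurable_cong_AE:
  fixes f g :: "'a::euclidean_space \<Rightarrow> 'b::euclidean_space"
  assumes \<Omega>: "\<Omega> \<in> sets lebesgue" and f: "f \<in> borel_measurable (lebesgue_on \<Omega>)"
    and ae: "AE x in lebesgue_on \<Omega>. f x = g x"
  shows "g \<in> borel_measurable (lebesgue_on \<Omega>)"
proof (rule borel_measurable_if_D, rule borel_measurable_AE)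
  show "(\<lambda>x. if x \<in> \<Omega> then f x else 0) \<in> borel_measurable lebesgue" by (rule borel_measurable_if_I[OF f \<Omega>])
  show "AE x in lebesgue. (if x \<in> \<Omega> then f x else 0) = (if x \<in> \<Omega> then g x else 0)"
    using ae unfolding AE_lebesgue_on_iff[OF \<Omega>] by eventually_elim auto
qed

text \<open>The bump functions are admissible and converge boundedly to the indicator of the open
  box; the boundary of the box does not contribute.\<close>

lemma box_integral_zero:
  fixes F :: "'a::euclidean_space \<Rightarrow> real"
  assumes \<Omega>: "open \<Omega>" and loc: "locally_integrable_on \<Omega> F"
    and zero: "\<And>\<eta>. \<eta> \<in> test_functions \<Omega> \<Longrightarrow> (\<integral>x. F x * \<eta> x \<partial>lebesgue_on \<Omega>) = 0"
    and sub: "cbox a c \<subseteq> \<Omega>"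
  shows "integral (cbox a c) F = 0"
proof -
  have \<Omega>s: "\<Omega> \<in> sets lebesgue" using \<Omega> by simp
  have si: "set_integrable lebesgue (cbox a c) F" using loc sub by (simp add: locally_integrable_on_def)
  have sib: "set_integrable lebesgue (box a c) F"
    by (rule set_integrable_subset[OF si]) (auto simp: box_subset_cbox)
  have eq: "indicator \<Omega> x *\<^sub>R (F x * bump a c n x) = bump a c n x * (indicator (cbox a c) x *\<^sub>R F x)" for n x
    using bump_support[of a c n x] sub box_subset_cbox[of a c] by (auto simp: indicator_def) 
  have [measurable]: "bump a c n \<in> borel_measurable borel" for n
    by (intro borel_measurable_continuous_onI C_k_continuous C_k_bump)
  have si': "integrable lebesgue (\<lambda>x. indicator (cbox a c) x *\<^sub>R F x)" using si by (simp add: set_integrable_def)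
  have sib': "integrable lebesgue (\<lambda>x. indicator (box a c) x *\<^sub>R F x)" using sib by (simp add: set_integrable_def)
  have "(\<lambda>n. \<integral>x. bump a c n x * (indicator (cbox a c) x *\<^sub>R F x) \<partial>lebesgue) \<longlonglongrightarrow> (\<integral>x. indicator (box a c) x *\<^sub>R F x \<partial>lebesgue)"
  proof (rule integral_dominated_convergence[where w = "\<lambda>x. \<bar>indicator (cbox a c) x *\<^sub>R F x\<bar>"])
    show "(\<lambda>x. bump a c n x * (indicator (cbox a c) x *\<^sub>R F x)) \<in> borel_measurable lebesgue" for n
      by (rule borel_measurable_times[OF measurable_completion borel_measurable_integrable[OF si']]) measurable
    show "AE x in lebesgue. (\<lambda>n. bump a c n x * (indicator (cbox a c) x *\<^sub>R F x)) \<longlonglongrightarrow> indicator (box a c) x *\<^sub>R F x"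
    proof (rule AE_I2)
      fix x
      have "(\<lambda>n. bump a c n x * (indicator (cbox a c) x *\<^sub>R F x)) \<longlonglongrightarrow> indicator (box a c) x * (indicator (cbox a c) x *\<^sub>R F x)"
        by (intro tendsto_intros bump_tendsto)
      moreover have "indicator (box a c) x * (indicator (cbox a c) x *\<^sub>R F x) = indicator (box a c) x *\<^sub>R F x"
        using box_subset_cbox[of a c] by (auto simp: indicator_def)
      ultimately show "(\<lambda>n. bump a c n x * (indicator (cbox a c) x *\<^sub>R F x)) \<longlonglongrightarrow> indicator (box a c) x *\<^sub>R F x" by (simp only:)
    qed
    show "AE x in lebesgue. norm (bump a c n x * (indicator (cbox a c) x *\<^sub>R F x)) \<le> \<bar>indicator (cbox a c) x *\<^sub>R F x\<bar>" for n
      using bump_bounds[of a c n] by (auto simp: abs_mult intro!: mult_left_le_one_le)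
    show "integrable lebesgue (\<lambda>x. \<bar>indicator (cbox a c) x *\<^sub>R F x\<bar>)" using si' by (rule integrable_abs)
    show "(\<lambda>x. indicator (box a c) x *\<^sub>R F x) \<in> borel_measurable lebesgue" using sib' by auto
  qed
  moreover have "(\<integral>x. bump a c n x * (indicator (cbox a c) x *\<^sub>R F x) \<partial>lebesgue) = 0" for n
  proof -
    have "(\<integral>x. indicator \<Omega> x *\<^sub>R (F x * bump a c n x) \<partial>lebesgue) = 0"
      using zero[OF bump_test_function[OF sub, of n]] \<Omega>s by (simp add: integral_restrict_space)
    then show ?thesis unfolding eq .
  qed
  ultimately have "(\<integral>x. indicator (box a c) x *\<^sub>R F x \<partial>lebesgue) = 0" using LIMSEQ_unique[OF _ tendsto_const] by simp
  then have "integral (box a c) F = 0"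
    using set_lebesgue_integral_eq_integral(2)[OF sib] by (simp add: set_lebesgue_integral_def)
  then show ?thesis by (simp add: integral_open_interval)
qed

text \<open>Lebesgue differentiation: almost everywhere \<open>F x\<close> is the limit of averages
  over cubes with corner \<open>x\<close>, and the averages over cubes inside the domain vanish.
  Countably many closed boxes exhaust the domain.\<close>

lemma fundamental_lemma_variations:
  fixes F :: "'a::euclidean_space \<Rightarrow> real"
  assumes \<Omega>: "open \<Omega>" and loc: "locally_integrable_on \<Omega> F"
    and zero: "\<And>\<eta>. \<eta> \<in> test_functions \<Omega> \<Longrightarrow> (\<integral>x. F x * \<eta> x \<partial>lebesgue_on \<Omega>) = 0"
  shows "AE x in lebesgue_on \<Omega>. F x = 0"
proof -
  have box: "negligible {x \<in> cbox a c. F x \<noteq> 0}" if sub: "cbox a c \<subseteq> \<Omega>" for a c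
  proof -
    \<comment> \<open>The differentiation theorem wants integrability on every box of the space,
      which \<open>F\<close> is only known to have inside the domain.\<close>
    define f where "f x = indicator (cbox a c) x *\<^sub>R F x" for x
    have "integrable lebesgue f" using loc sub by (simp add: f_def[abs_def] locally_integrable_on_def set_integrable_def)
    then have "set_integrable lebesgue UNIV f" by (simp add: set_integrable_def)
    then have "f integrable_on cbox x y" for x y
      by (rule set_lebesgue_integral_eq_integral(1)[OF absolutely_integrable_on_subcbox[OF _ subset_UNIV]])
    then obtain N where N: "negligible N" "\<And>x e. \<lbrakk>x \<notin> N; 0 < e\<rbrakk> \<Longrightarrow>
       \<exists>d>0. \<forall>h. 0 < h \<and> h < d \<longrightarrow> norm (integral (cbox x (x + h *\<^sub>R One)) f /\<^sub>R h ^ DIM('a) - f x) < e"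
      using integrable_ccontinuous_explicit[of f] by metis
    have "F x = 0" if x: "x \<in> box a c" "x \<notin> N" for x
    proof (rule ccontr)
      assume "F x \<noteq> 0"
      have fx: "f x = F x" using x(1) box_subset_cbox[of a c] by (auto simp: f_def)
      obtain d where d: "d > 0" "\<And>h. 0 < h \<Longrightarrow> h < d \<Longrightarrow> norm (integral (cbox x (x + h *\<^sub>R One)) f /\<^sub>R h ^ DIM('a) - f x) < \<bar>F x\<bar>"
        using N(2)[OF x(2), of "\<bar>F x\<bar>"] \<open>F x \<noteq> 0\<close> by auto
      obtain e where e: "e > 0" "cball x e \<subseteq> box a c"
        using open_contains_cball[of "box a c"] x(1) by auto
      \<comment> \<open>In the sum norm the cube of side \<open>h\<close> reaches at most
        \<open>DIM('a) * h\<close> from its corner, so this choice keeps it in the ball of radius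
        \<open>e\<close>; and \<open>h < d\<close> is required by the differentiation
        theorem.\<close>
      define h where "h = min (d / 2) (e / real DIM('a))"
      have h: "h > 0" using d(1) e(1) by (simp add: h_def)
      have "h \<le> d / 2" "h \<le> e / real DIM('a)" unfolding h_def by (rule min.cobounded1, rule min.cobounded2)
      then have hd: "h < d" using d(1) by simp
      have sub': "cbox x (x + h *\<^sub>R One) \<subseteq> cbox a c"
      proof
        fix y assume y: "y \<in> cbox x (x + h *\<^sub>R One)"
        have "norm (y - x) \<le> (\<Sum>b\<in>Basis. \<bar>(y - x) \<bullet> b\<bar>)" by (rule norm_le_l1)
        also have "\<dots> \<le> (\<Sum>b\<in>(Basis::'a set). h)"
        proof (rule sum_mono)
          fix b :: 'a assume b: "b \<in> Basis"
          then have "x \<bullet> b \<le> y \<bullet> b" "y \<bullet> b \<le> x \<bullet> b + h" using y by (auto simp: mem_box inner_add_left)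
          then show "\<bar>(y - x) \<bullet> b\<bar> \<le> h" by (simp add: inner_diff_left)
        qed
        also have "\<dots> \<le> e" using \<open>h \<le> e / real DIM('a)\<close> by (simp add: field_simps)
        finally show "y \<in> cbox a c" using e(2) box_subset_cbox[of a c] by (auto simp: dist_norm norm_minus_commute)
      qed
      have "integral (cbox x (x + h *\<^sub>R One)) f = integral (cbox x (x + h *\<^sub>R One)) F"
        using sub' by (intro integral_cong) (auto simp: f_def)
      also have "\<dots> = 0" using sub' sub by (intro box_integral_zero[OF \<Omega> loc zero]) auto
      finally show False using d(2)[OF h hd] fx by simp
    qed
    then have "{x \<in> cbox a c. F x \<noteq> 0} \<subseteq> N \<union> (cbox a c - box a c)" by auto
    then show ?thesis using N(1) negligible_frontier_interval[of a c] negligible_subset negligible_Un by blast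
  qed
  obtain D where D: "countable D" "D \<subseteq> Pow \<Omega>" "\<And>X. X \<in> D \<Longrightarrow> \<exists>a b. X = cbox a b" "\<Union>D = \<Omega>"
    using open_countable_Union_open_cbox[OF \<Omega>] by metis
  have "negligible (\<Union>X\<in>D. {x \<in> X. F x \<noteq> 0})"
    using D box by (intro negligible_countable_Union countable_image) (auto, metis PowD Pow_iff subsetD)
  then have "(\<Union>X\<in>D. {x \<in> X. F x \<noteq> 0}) \<in> null_sets lebesgue" by (simp add: negligible_iff_null_sets)
  moreover have "{x \<in> \<Omega>. F x \<noteq> 0} \<subseteq> (\<Union>X\<in>D. {x \<in> X. F x \<noteq> 0})" using D(4) by auto
  ultimately have "AE x in lebesgue. x \<in> \<Omega> \<longrightarrow> F x = 0"
    by (intro AE_I'[of "(\<Union>X\<in>D. {x \<in> X. F x \<noteq> 0})"]) auto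
  then show ?thesis using \<Omega> by (simp add: AE_lebesgue_on_iff)
qed

lemma locally_integrable_on_inner:
  "locally_integrable_on \<Omega> G \<Longrightarrow> locally_integrable_on \<Omega> (\<lambda>x. G x \<bullet> b)"
  unfolding locally_integrable_on_def set_integrable_def
proof (intro allI impI)
  fix K assume *: "\<forall>K. compact K \<and> K \<subseteq> \<Omega> \<longrightarrow> integrable lebesgue (\<lambda>x. indicator K x *\<^sub>R G x)" and K: "compact K \<and> K \<subseteq> \<Omega>"
  have "integrable lebesgue (\<lambda>x. (indicator K x *\<^sub>R G x) \<bullet> b)"
    by (rule integrable_inner_left) (use * K in blast)
  then show "integrable lebesgue (\<lambda>x. indicator K x *\<^sub>R (G x \<bullet> b))" by simp
qed

lemma locally_integrable_mult:
  fixes F :: "'a::euclidean_space \<Rightarrow> real"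
  assumes \<Omega>: "\<Omega> \<in> sets lebesgue" and loc: "locally_integrable_on \<Omega> F"
    and K: "compact K" "K \<subseteq> \<Omega>" and \<eta>: "continuous_on UNIV \<eta>" "\<And>x. x \<notin> K \<Longrightarrow> \<eta> x = 0"
  shows "integrable (lebesgue_on \<Omega>) (\<lambda>x. F x * \<eta> x)"
proof -
  obtain B where B: "B > 0" "\<And>x. norm (\<eta> x) \<le> B"
    using continuous_compact_support_bounded[OF \<eta>(1) K(1) \<eta>(2)] by blast
  have iK: "integrable lebesgue (\<lambda>x. indicator K x *\<^sub>R F x)"
    using loc K by (simp add: locally_integrable_on_def set_integrable_def)
  have eq: "indicator \<Omega> x *\<^sub>R (F x * \<eta> x) = \<eta> x * (indicator K x *\<^sub>R F x)" for x
    using K(2) \<eta>(2)[of x] by (auto simp: indicator_def)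
  have [measurable]: "\<eta> \<in> borel_measurable lebesgue"
    using \<eta>(1) by (auto intro!: measurable_completion borel_measurable_continuous_onI)
  have "integrable lebesgue (\<lambda>x. \<eta> x * (indicator K x *\<^sub>R F x))"
    by (rule Bochner_Integration.integrable_bound[OF integrable_mult_right[OF integrable_abs[OF iK], of B]])
      (use iK B in \<open>auto simp: abs_mult intro!: mult_right_mono\<close>)
  then show ?thesis using \<Omega> by (simp add: integrable_restrict_space eq del: real_scaleR_def)
qed

text \<open>The fundamental lemma is applied to each component of the difference. Two functions that
  agree almost everywhere are allowed, because elements of the space are given by
  representatives.\<close>

lemma weak_gradient_unique:
  fixes G H :: "'a::euclidean_space \<Rightarrow> 'a"
  assumes \<Omega>: "open \<Omega>" and G: "has_weak_gradient \<Omega> u G" and H: "has_weak_gradient \<Omega> v H"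
    and uv: "AE x in lebesgue_on \<Omega>. u x = v x"
  shows "AE x in lebesgue_on \<Omega>. G x = H x"
proof -
  have \<Omega>s: "\<Omega> \<in> sets lebesgue" using \<Omega> by simp
  have "AE x in lebesgue_on \<Omega>. (G x - H x) \<bullet> b = 0" if b: "b \<in> Basis" for b
  proof (rule fundamental_lemma_variations[OF \<Omega>])
    have lG: "locally_integrable_on \<Omega> (\<lambda>x. G x \<bullet> b)" and lH: "locally_integrable_on \<Omega> (\<lambda>x. H x \<bullet> b)"
      using G H by (auto intro!: locally_integrable_on_inner simp: has_weak_gradient_def)
    then show "locally_integrable_on \<Omega> (\<lambda>x. (G x - H x) \<bullet> b)"
      by (auto simp: locally_integrable_on_def inner_diff_left intro!: set_integral_diff)
    fix \<eta> assume \<eta>: "\<eta> \<in> test_functions \<Omega>"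
    obtain K where K: "K \<subseteq> \<Omega>" "C1c K \<eta> (grad \<eta>)" using test_functions_C1c[OF \<eta>] by blast
    note f = C1c_facts[OF K(2)]
    note i = locally_integrable_mult[OF \<Omega>s lG f(1) K(1) f(6,4)] locally_integrable_mult[OF \<Omega>s lH f(1) K(1) f(6,4)]
    have lu: "locally_integrable_on \<Omega> u" "locally_integrable_on \<Omega> v"
      using G H by (auto simp: has_weak_gradient_def)
    have d: "frechet_derivative \<eta> (at x) b = grad \<eta> x \<bullet> b" for x
      using frechet_derivative_at[OF f(2)[of x]] by metis
    have c: "continuous_on UNIV (\<lambda>x. grad \<eta> x \<bullet> b)" by (intro continuous_intros f)
    have z: "grad \<eta> x \<bullet> b = 0" if "x \<notin> K" for x using f(5)[OF that] by simp
    have "(\<integral>x. u x * frechet_derivative \<eta> (at x) b \<partial>lebesgue_on \<Omega>) = (\<integral>x. v x * frechet_derivative \<eta> (at x) b \<partial>lebesgue_on \<Omega>)"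
      unfolding d
    proof (rule integral_cong_AE)
      show "AE x in lebesgue_on \<Omega>. u x * (grad \<eta> x \<bullet> b) = v x * (grad \<eta> x \<bullet> b)"
        using uv by eventually_elim simp
      show "(\<lambda>x. u x * (grad \<eta> x \<bullet> b)) \<in> borel_measurable (lebesgue_on \<Omega>)"
        using locally_integrable_mult[OF \<Omega>s lu(1) f(1) K(1) c z] by (rule borel_measurable_integrable)
      show "(\<lambda>x. v x * (grad \<eta> x \<bullet> b)) \<in> borel_measurable (lebesgue_on \<Omega>)"
        using locally_integrable_mult[OF \<Omega>s lu(2) f(1) K(1) c z] by (rule borel_measurable_integrable)
    qed
    then have "(\<integral>x. (G x \<bullet> b) * \<eta> x \<partial>lebesgue_on \<Omega>) = (\<integral>x. (H x \<bullet> b) * \<eta> x \<partial>lebesgue_on \<Omega>)"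
      using G H \<eta> b by (auto simp: has_weak_gradient_def)
    then show "(\<integral>x. (G x - H x) \<bullet> b * \<eta> x \<partial>lebesgue_on \<Omega>) = 0"
      using i by (simp add: inner_diff_left left_diff_distrib)
  qed
  then have "AE x in lebesgue_on \<Omega>. \<forall>b\<in>Basis. (G x - H x) \<bullet> b = 0"
    by (intro AE_finite_allI finite_Basis)
  then show ?thesis by eventually_elim (simp add: euclidean_eq_iff[of "G _"] inner_diff_left)
qed

text \<open>From \<open>t \<le> \<epsilon> + \<epsilon> powr (1 - r) * t powr r\<close>: values
  below \<open>\<epsilon>\<close> cost at most \<open>\<epsilon>\<close> times the finite total
  mass, larger ones are controlled by the \<open>r\<close>-th power.\<close>

lemma lp_tendsto_L1:
  assumes fin: "finite_measure M" and r: "r > 1" and f: "lp_tendsto M r f g" "\<And>n. lp M r (f n)" "lp M r g"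
  shows "(\<lambda>n. \<integral>x. norm (f n x - g x) \<partial>M) \<longlonglongrightarrow> 0"
proof -
  interpret finite_measure M by fact
  have i: "integrable M (\<lambda>x. norm (f n x - g x) powr r)" for n
    using f r by (intro lp_integrable lp_diff) auto
  have le: "(\<integral>x. norm (f n x - g x) \<partial>M) \<le> \<epsilon> * measure M (space M) + \<epsilon> powr (1 - r) * (\<integral>x. norm (f n x - g x) powr r \<partial>M)"
    if \<epsilon>: "\<epsilon> > 0" for \<epsilon> n
  proof -
    have "(\<integral>x. norm (f n x - g x) \<partial>M) \<le> (\<integral>x. \<epsilon> + \<epsilon> powr (1 - r) * norm (f n x - g x) powr r \<partial>M)"
    proof (rule integral_mono')
      fix x
      let ?t = "norm (f n x - g x)"
      show "?t \<le> \<epsilon> + \<epsilon> powr (1 - r) * ?t powr r"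
      proof (cases "?t \<le> \<epsilon>")
        case False
        then have "?t = ?t powr (1 - r) * ?t powr r" using \<epsilon> by (simp flip: powr_add)
        also have "\<dots> \<le> \<epsilon> powr (1 - r) * ?t powr r"
          using False r \<epsilon> by (intro mult_right_mono powr_mono2') auto
        finally show ?thesis using \<epsilon> by linarith
      qed (auto intro: add_increasing2)
      show "0 \<le> \<epsilon> + \<epsilon> powr (1 - r) * ?t powr r" using \<epsilon> by simp
    qed (use i in auto)
    also have "\<dots> = \<epsilon> * measure M (space M) + \<epsilon> powr (1 - r) * (\<integral>x. norm (f n x - g x) powr r \<partial>M)"
      using i by (simp add: mult.commute)
    finally show ?thesis .
  qed
  show ?thesis
  proof (rule LIMSEQ_I)
    fix e :: real assume e: "e > 0"
    define m where "m = measure M (space M)"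
    define \<epsilon> where "\<epsilon> = e / (2 * (m + 1))"
    have m: "m \<ge> 0" by (simp add: m_def)
    have \<epsilon>: "\<epsilon> > 0" using e m by (simp add: \<epsilon>_def)
    have "\<epsilon> * m < e" using e m by (auto simp: \<epsilon>_def field_simps intro!: add_nonneg_pos)
    have "(\<lambda>n. \<epsilon> * m + \<epsilon> powr (1 - r) * (\<integral>x. norm (f n x - g x) powr r \<partial>M)) \<longlonglongrightarrow> \<epsilon> * m + \<epsilon> powr (1 - r) * 0"
      using f(1) unfolding lp_tendsto_def by (intro tendsto_intros)
    then have "\<forall>\<^sub>F n in sequentially. \<epsilon> * m + \<epsilon> powr (1 - r) * (\<integral>x. norm (f n x - g x) powr r \<partial>M) < e"
      using \<open>\<epsilon> * m < e\<close> by (intro order_tendstoD(2)) auto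
    then obtain N where N: "\<And>n. n \<ge> N \<Longrightarrow> \<epsilon> * m + \<epsilon> powr (1 - r) * (\<integral>x. norm (f n x - g x) powr r \<partial>M) < e"
      by (auto simp: eventually_sequentially)
    have "norm ((\<integral>x. norm (f n x - g x) \<partial>M) - 0) < e" if "n \<ge> N" for n
      using N[OF that] le[OF \<epsilon>, of n] by (simp add: m_def)
    then show "\<exists>N. \<forall>n\<ge>N. norm ((\<integral>x. norm (f n x - g x) \<partial>M) - 0) < e" by blast
  qed
qed

lemma lp_integrable_L1:
  assumes fin: "finite_measure M" and r: "r \<ge> 1" and f: "lp M r f"
  shows "integrable M f"
proof -
  interpret finite_measure M by fact
  have b: "norm (f x) \<le> 1 + norm (f x) powr r" for x
  proof (cases "norm (f x) \<le> 1")
    case False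
    then have "norm (f x) powr 1 \<le> norm (f x) powr r" using r by (intro powr_mono) auto
    then show ?thesis using False by (simp add: abs_if split: if_splits)
  qed (auto intro: add_increasing2)
  have "integrable M (\<lambda>x. 1 + norm (f x) powr r)" using f by (simp add: lp_def)
  then show ?thesis using f b
    by (intro Bochner_Integration.integrable_bound[of M "\<lambda>x. 1 + norm (f x) powr r" f])
      (auto simp: lp_def intro!: AE_I2 order_trans[OF b])
qed

lemma integral_mult_bounded_tendsto:
  fixes f :: "nat \<Rightarrow> 'a \<Rightarrow> real"
  assumes fin: "finite_measure M" and r: "r > 1" and f: "lp_tendsto M r f g" "\<And>n. lp M r (f n)" "lp M r g"
    and c: "c \<in> borel_measurable M" "\<And>x. \<bar>c x\<bar> \<le> B"
  shows "(\<lambda>n. \<integral>x. f n x * c x \<partial>M) \<longlonglongrightarrow> (\<integral>x. g x * c x \<partial>M)"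
proof -
  note [measurable] = c(1)
  have i: "integrable M (f n)" "integrable M g" for n using lp_integrable_L1[OF fin _ f(2)] lp_integrable_L1[OF fin _ f(3)] r by auto
  have ic: "integrable M (\<lambda>x. h x * c x)" if "integrable M h" for h
    using that c by (intro Bochner_Integration.integrable_bound[OF integrable_mult_left[OF that, of B]])
      (auto simp: abs_mult intro!: AE_I2 mult_left_mono order_trans[OF c(2)])
  have le: "norm ((\<integral>x. f n x * c x \<partial>M) - (\<integral>x. g x * c x \<partial>M)) \<le> B * (\<integral>x. norm (f n x - g x) \<partial>M)" for n
  proof -
    have "(\<integral>x. f n x * c x \<partial>M) - (\<integral>x. g x * c x \<partial>M) = (\<integral>x. (f n x - g x) * c x \<partial>M)"
      using ic i by (simp add: left_diff_distrib)
    also have "\<bar>\<dots>\<bar> \<le> (\<integral>x. \<bar>(f n x - g x) * c x\<bar> \<partial>M)" by (rule integral_abs_bound)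
    also have "\<dots> \<le> (\<integral>x. B * norm (f n x - g x) \<partial>M)"
    proof (rule integral_mono')
      fix x show "\<bar>(f n x - g x) * c x\<bar> \<le> B * norm (f n x - g x)"
        using mult_left_mono[OF c(2)[of x], of "\<bar>f n x - g x\<bar>"] by (simp add: abs_mult mult.commute)
      show "0 \<le> B * norm (f n x - g x)" using c(2)[of x] by simp
    qed (use i in auto)
    finally show ?thesis by simp
  qed
  have "(\<lambda>n. B * (\<integral>x. norm (f n x - g x) \<partial>M)) \<longlonglongrightarrow> B * 0"
    by (intro tendsto_intros lp_tendsto_L1[OF fin r f])
  then have lim: "(\<lambda>n. B * (\<integral>x. norm (f n x - g x) \<partial>M)) \<longlonglongrightarrow> 0" by (simp only: mult_zero_right)
  have "(\<lambda>n. (\<integral>x. f n x * c x \<partial>M) - (\<integral>x. g x * c x \<partial>M)) \<longlonglongrightarrow> 0"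
    by (rule Lim_null_comparison[OF always_eventually[OF allI[OF le]] lim])
  then show ?thesis by (simp add: LIM_zero_iff)
qed

lemma lp_inner: "lp M r g \<Longrightarrow> b \<in> Basis \<Longrightarrow> r \<ge> 0 \<Longrightarrow> lp M r (\<lambda>x. g x \<bullet> b)"
  by (rule lp_dom[of M r g]) (auto simp: lp_def Basis_le_norm)

lemma lp_tendsto_inner:
  assumes "lp_tendsto M r f g" "\<And>n. lp M r (f n)" "lp M r g" "b \<in> Basis" "r \<ge> 0"
  shows "lp_tendsto M r (\<lambda>n x. f n x \<bullet> b) (\<lambda>x. g x \<bullet> b)"
proof (rule lp_tendsto_squeeze[OF assms(1)[unfolded lp_tendsto_def]])
  show "integrable M (\<lambda>x. norm (f n x - g x) powr r)" for n using assms by (intro lp_integrable lp_diff)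
  show "AE x in M. norm (f n x \<bullet> b - g x \<bullet> b) powr r \<le> norm (f n x - g x) powr r" for n
    using assms by (auto simp: inner_diff_left[symmetric] intro!: powr_mono2 Basis_le_norm)
qed

lemma C1c_mult:
  assumes "C1c K \<phi> g" "C1c L \<eta> k"
  shows "C1c K (\<lambda>x. \<phi> x * \<eta> x) (\<lambda>x. \<phi> x *\<^sub>R k x + \<eta> x *\<^sub>R g x)"
  unfolding C1c_def
proof (intro conjI allI impI)
  note f = C1c_facts[OF assms(1)] and h = C1c_facts[OF assms(2)]
  show "compact K" by (rule f)
  show "((\<lambda>x. \<phi> x * \<eta> x) has_derivative (\<lambda>h. (\<phi> x *\<^sub>R k x + \<eta> x *\<^sub>R g x) \<bullet> h)) (at x)" for x
    using has_derivative_mult[OF f(2)[of x] h(2)[of x]] by (simp add: inner_add_left mult.commute)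
  show "continuous_on UNIV (\<lambda>x. \<phi> x *\<^sub>R k x + \<eta> x *\<^sub>R g x)" by (intro continuous_intros f h)
qed (use C1c_facts[OF assms(1)] in auto)

section \<open>Limits of test functions on a bounded open set\<close>

locale sobolev_domain =
  fixes \<Omega> :: "'a::euclidean_space set" and p :: real
  assumes open_domain: "open \<Omega>" and bounded_domain: "bounded \<Omega>" and p1: "p > 1"
begin

abbreviation "L \<equiv> lebesgue_on \<Omega>"
abbreviation "T \<equiv> test_functions \<Omega>"

lemma domain_sets [simp]: "\<Omega> \<in> sets lebesgue"
  using open_domain by simp

lemma finite_L: "finite_measure L"
proof (rule finite_measureI)
  have "emeasure lebesgue \<Omega> = emeasure lborel \<Omega>" using open_domain by simp
  also have "\<dots> < \<infinity>" by (rule emeasure_bounded_finite[OF bounded_domain])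
  finally show "emeasure L (space L) \<noteq> \<infinity>" by (simp add: emeasure_restrict_space)
qed

sublocale finite_measure L by (rule finite_L)

lemma continuous_measurable: "continuous_on UNIV f \<Longrightarrow> f \<in> borel_measurable L"
  for f :: "'a \<Rightarrow> 'b::euclidean_space"
  by (intro measurable_restrict_space1 measurable_completion) (simp add: borel_measurable_continuous_onI)

lemma continuous_support:
  fixes f :: "'a \<Rightarrow> 'b::euclidean_space"
  assumes "continuous_on UNIV f" "compact K" "K \<subseteq> \<Omega>" "\<And>x. x \<notin> K \<Longrightarrow> f x = 0"
  shows "integrable L f" "(\<integral>x. f x \<partial>L) = (\<integral>x. f x \<partial>lborel)"
  using integral_lebesgue_on_eq_lborel[OF domain_sets continuous_compact_support_integrable[OF assms(1,2,4)]] assms(3,4)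
  by auto

lemma lp_continuous:
  fixes f :: "'a \<Rightarrow> 'b::euclidean_space"
  assumes "continuous_on UNIV f" "compact K" "K \<subseteq> \<Omega>" "\<And>x. x \<notin> K \<Longrightarrow> f x = 0" "r > 0"
  shows "lp L r f" "(\<integral>x. norm (f x) powr r \<partial>L) = (\<integral>x. norm (f x) powr r \<partial>lborel)"
proof -
  note c = continuous_support[OF continuous_norm_powr[OF assms(1,5)] assms(2,3)]
  show "lp L r f" unfolding lp_def using assms by (intro conjI c continuous_measurable) auto
  show "(\<integral>x. norm (f x) powr r \<partial>L) = (\<integral>x. norm (f x) powr r \<partial>lborel)" by (intro c) (use assms in auto)
qed

lemma test_lp:
  assumes "\<phi> \<in> T" "r > 0"
  shows "lp L r \<phi>" "lp L r (grad \<phi>)"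
    "(\<integral>x. norm (\<phi> x) powr r \<partial>L) = (\<integral>x. norm (\<phi> x) powr r \<partial>lborel)"
    "(\<integral>x. norm (grad \<phi> x) powr r \<partial>L) = (\<integral>x. norm (grad \<phi> x) powr r \<partial>lborel)"
proof -
  obtain K where K: "K \<subseteq> \<Omega>" "C1c K \<phi> (grad \<phi>)" using test_functions_C1c[OF assms(1)] by blast
  note f = C1c_facts[OF K(2)]
  show "lp L r \<phi>" "(\<integral>x. norm (\<phi> x) powr r \<partial>L) = (\<integral>x. norm (\<phi> x) powr r \<partial>lborel)"
    by (rule lp_continuous[OF f(6,1) K(1) f(4) assms(2)], assumption)+
  show "lp L r (grad \<phi>)" "(\<integral>x. norm (grad \<phi> x) powr r \<partial>L) = (\<integral>x. norm (grad \<phi> x) powr r \<partial>lborel)"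
    by (rule lp_continuous[OF f(3,1) K(1) f(5) assms(2)], assumption)+
qed

lemma test_partial:
  assumes "\<eta> \<in> T" "b \<in> Basis"
  shows "frechet_derivative \<eta> (at x) b = grad \<eta> x \<bullet> b"
    "(\<lambda>x. frechet_derivative \<eta> (at x) b) \<in> borel_measurable L" "\<eta> \<in> borel_measurable L"
    "\<exists>B. \<forall>x. \<bar>frechet_derivative \<eta> (at x) b\<bar> \<le> B" "\<exists>B. \<forall>x. \<bar>\<eta> x\<bar> \<le> B"
proof -
  obtain K where K: "K \<subseteq> \<Omega>" "C1c K \<eta> (grad \<eta>)" using test_functions_C1c[OF assms(1)] by blast
  note f = C1c_facts[OF K(2)]
  have d: "frechet_derivative \<eta> (at x) b = grad \<eta> x \<bullet> b" for x
    using frechet_derivative_at[OF f(2)[of x]] by metis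
  then show "frechet_derivative \<eta> (at x) b = grad \<eta> x \<bullet> b" .
  show "(\<lambda>x. frechet_derivative \<eta> (at x) b) \<in> borel_measurable L" "\<eta> \<in> borel_measurable L"
    unfolding d by (intro continuous_measurable continuous_intros f)+
  obtain B where "\<And>x. norm (grad \<eta> x) \<le> B" using continuous_compact_support_bounded[OF f(3,1,5)] by metis
  then show "\<exists>B. \<forall>x. \<bar>frechet_derivative \<eta> (at x) b\<bar> \<le> B"
    unfolding d using Basis_le_norm[OF assms(2)] order_trans by blast
  obtain B where "\<And>x. norm (\<eta> x) \<le> B" using continuous_compact_support_bounded[OF f(6,1,4)] by metis
  then show "\<exists>B. \<forall>x. \<bar>\<eta> x\<bar> \<le> B" by auto
qed

text \<open>The gradient of the product of the two test functions has integral 0 over the whole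
  space, and the compact supports make integrals over the space and over the domain agree.\<close>

lemma test_integration_by_parts:
  assumes "\<phi> \<in> T" "\<eta> \<in> T" "b \<in> Basis"
  shows "(\<integral>x. \<phi> x * frechet_derivative \<eta> (at x) b \<partial>L) = - (\<integral>x. (grad \<phi> x \<bullet> b) * \<eta> x \<partial>L)"
proof -
  obtain K where K: "K \<subseteq> \<Omega>" "C1c K \<phi> (grad \<phi>)" using test_functions_C1c[OF assms(1)] by blast
  obtain K' where K': "K' \<subseteq> \<Omega>" "C1c K' \<eta> (grad \<eta>)" using test_functions_C1c[OF assms(2)] by blast
  note f = C1c_facts[OF K(2)] and h = C1c_facts[OF K'(2)]
  have s1: "integrable L (\<lambda>x. \<phi> x * (grad \<eta> x \<bullet> b))" "(\<integral>x. \<phi> x * (grad \<eta> x \<bullet> b) \<partial>L) = (\<integral>x. \<phi> x * (grad \<eta> x \<bullet> b) \<partial>lborel)"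
    by (rule continuous_support[OF _ f(1) K(1)]; (intro continuous_intros f h | simp add: f))+
  have s2: "integrable L (\<lambda>x. (grad \<phi> x \<bullet> b) * \<eta> x)" "(\<integral>x. (grad \<phi> x \<bullet> b) * \<eta> x \<partial>L) = (\<integral>x. (grad \<phi> x \<bullet> b) * \<eta> x \<partial>lborel)"
    by (rule continuous_support[OF _ f(1) K(1)]; (intro continuous_intros f h | simp add: f))+
  have i1: "integrable lborel (\<lambda>x. \<phi> x * (grad \<eta> x \<bullet> b))"
    by (rule continuous_compact_support_integrable[OF _ f(1)]; (intro continuous_intros f h | simp add: f))
  have i2: "integrable lborel (\<lambda>x. (grad \<phi> x \<bullet> b) * \<eta> x)"
    by (rule continuous_compact_support_integrable[OF _ f(1)]; (intro continuous_intros f h | simp add: f))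
  have "0 = (\<integral>x. \<phi> x * (grad \<eta> x \<bullet> b) + (grad \<phi> x \<bullet> b) * \<eta> x \<partial>lborel)"
    using C1c_integral_grad_zero[OF C1c_mult[OF K(2) K'(2)], of b] by (simp add: inner_add_left mult.commute)
  then show ?thesis unfolding test_partial(1)[OF assms(2,3)] s1(2) s2(2) using i1 i2 by simp
qed

lemma lp_locally_integrable:
  fixes f :: "'a \<Rightarrow> 'b::euclidean_space"
  assumes "lp L p f" shows "locally_integrable_on \<Omega> f"
proof -
  have "integrable L f" using lp_integrable_L1[OF finite_L _ assms] p1 by simp
  then have "set_integrable lebesgue \<Omega> f" by (simp add: set_integrable_def integrable_restrict_space)
  then have "set_integrable lebesgue K f" if "compact K" "K \<subseteq> \<Omega>" for K
    by (rule set_integrable_subset) (use that fmeasurableD[OF lmeasurable_compact] in auto)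
  then show ?thesis by (simp add: locally_integrable_on_def)
qed

text \<open>The space as a set of pairs: a function together with an explicit gradient, both limits
  of the same test functions. This keeps the arbitrary choice in \<open>weak_grad\<close> out of the
  analysis; the passage to and from \<open>W01p\<close> is made separately.\<close>

definition sob :: "('a \<Rightarrow> real) \<Rightarrow> ('a \<Rightarrow> 'a) \<Rightarrow> bool" where
  "sob u g \<longleftrightarrow> lp L p u \<and> lp L p g \<and>
     (\<exists>\<phi>. (\<forall>n. \<phi> n \<in> T) \<and> lp_tendsto L p \<phi> u \<and> lp_tendsto L p (\<lambda>n. grad (\<phi> n)) g)"

lemma sob_lp: "sob u g \<Longrightarrow> lp L p u" "sob u g \<Longrightarrow> lp L p g"
  by (auto simp: sob_def)

lemma sob_approx:
  assumes "sob u g"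
  obtains \<phi> where "\<And>n. \<phi> n \<in> T" "lp_tendsto L p \<phi> u" "lp_tendsto L p (\<lambda>n. grad (\<phi> n)) g"
    "\<And>n. lp L p (\<phi> n)" "\<And>n. lp L p (grad (\<phi> n))"
proof -
  obtain \<phi> where \<phi>: "\<forall>n. \<phi> n \<in> T" "lp_tendsto L p \<phi> u" "lp_tendsto L p (\<lambda>n. grad (\<phi> n)) g"
    using assms unfolding sob_def by (elim conjE exE)
  have "p > 0" using p1 by simp
  then have "lp L p (\<phi> n)" "lp L p (grad (\<phi> n))" for n using \<phi>(1) test_lp[of "\<phi> n" p] by auto
  then show thesis using \<phi> by (intro that[of \<phi>]) auto
qed

text \<open>Integration by parts for the approximating test functions passes to the limit, since the
  other test function and its partial derivatives are bounded and convergence in \<open>L^p\<close>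
  on a finite measure space implies convergence in \<open>L^1\<close>.\<close>

lemma sob_weak_gradient:
  assumes "sob u g" shows "has_weak_gradient \<Omega> u g"
  unfolding has_weak_gradient_def
proof (intro conjI ballI)
  show "locally_integrable_on \<Omega> u" "locally_integrable_on \<Omega> g"
    using sob_lp[OF assms] by (auto intro: lp_locally_integrable)
  obtain \<phi> where \<phi>: "\<And>n. \<phi> n \<in> T" "lp_tendsto L p \<phi> u" "lp_tendsto L p (\<lambda>n. grad (\<phi> n)) g"
    "\<And>n. lp L p (\<phi> n)" "\<And>n. lp L p (grad (\<phi> n))" using sob_approx[OF assms] by metis
  fix \<eta> b assume \<eta>: "\<eta> \<in> T" and b: "b \<in> (Basis :: 'a set)"
  note tp = test_partial[OF \<eta> b]
  obtain B B' where B: "\<And>x. \<bar>frechet_derivative \<eta> (at x) b\<bar> \<le> B" "\<And>x. \<bar>\<eta> x\<bar> \<le> B'"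
    using tp(4,5) by blast
  have A: "(\<lambda>n. \<integral>x. \<phi> n x * frechet_derivative \<eta> (at x) b \<partial>L) \<longlonglongrightarrow> (\<integral>x. u x * frechet_derivative \<eta> (at x) b \<partial>L)"
    by (rule integral_mult_bounded_tendsto[OF finite_L p1 \<phi>(2,4) sob_lp(1)[OF assms] tp(2) B(1)])
  have B: "(\<lambda>n. \<integral>x. (grad (\<phi> n) x \<bullet> b) * \<eta> x \<partial>L) \<longlonglongrightarrow> (\<integral>x. (g x \<bullet> b) * \<eta> x \<partial>L)"
    by (rule integral_mult_bounded_tendsto[OF finite_L p1 _ _ _ tp(3) B(2)])
      (use p1 \<phi> sob_lp(2)[OF assms] b in \<open>auto intro!: lp_tendsto_inner lp_inner\<close>)
  show "(\<integral>x. u x * frechet_derivative \<eta> (at x) b \<partial>L) = - (\<integral>x. (g x \<bullet> b) * \<eta> x \<partial>L)"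
    by (rule LIMSEQ_unique[OF A[unfolded test_integration_by_parts[OF \<phi>(1) \<eta> b]] tendsto_minus[OF B]])
qed

lemma sob_unique:
  "sob u g \<Longrightarrow> sob v h \<Longrightarrow> AE x in L. u x = v x \<Longrightarrow> AE x in L. g x = h x"
  by (rule weak_gradient_unique[OF open_domain sob_weak_gradient sob_weak_gradient])

lemma sob_test: "\<phi> \<in> T \<Longrightarrow> sob \<phi> (grad \<phi>)"
  unfolding sob_def using p1 by (auto intro!: test_lp exI[of _ "\<lambda>_. \<phi>"] simp: lp_tendsto_def)

lemma test_grad_linear:
  assumes "\<phi> \<in> T" "\<eta> \<in> T"
  shows "grad (\<lambda>x. c * \<phi> x + d * \<eta> x) = (\<lambda>x. c *\<^sub>R grad \<phi> x + d *\<^sub>R grad \<eta> x)"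
proof
  fix x
  obtain K where K: "K \<subseteq> \<Omega>" "C1c K \<phi> (grad \<phi>)" using test_functions_C1c[OF assms(1)] by blast
  obtain K' where K': "K' \<subseteq> \<Omega>" "C1c K' \<eta> (grad \<eta>)" using test_functions_C1c[OF assms(2)] by blast
  note f = C1c_facts(2)[OF K(2)] and h = C1c_facts(2)[OF K'(2)]
  show "grad (\<lambda>x. c * \<phi> x + d * \<eta> x) x = c *\<^sub>R grad \<phi> x + d *\<^sub>R grad \<eta> x"
    by (rule grad_unique)
      (use has_derivative_add[OF has_derivative_mult_right[OF f, of c] has_derivative_mult_right[OF h, of d]]
        in \<open>simp add: inner_add_left\<close>)
qed

lemma sob_linear:
  assumes u: "sob u g" and v: "sob v h"
  shows "sob (\<lambda>x. c * u x + d * v x) (\<lambda>x. c *\<^sub>R g x + d *\<^sub>R h x)"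
proof -
  obtain \<phi> where \<phi>: "\<And>n. \<phi> n \<in> T" "lp_tendsto L p \<phi> u" "lp_tendsto L p (\<lambda>n. grad (\<phi> n)) g"
    "\<And>n. lp L p (\<phi> n)" "\<And>n. lp L p (grad (\<phi> n))" using sob_approx[OF u] by metis
  obtain \<eta> where \<eta>: "\<And>n. \<eta> n \<in> T" "lp_tendsto L p \<eta> v" "lp_tendsto L p (\<lambda>n. grad (\<eta> n)) h"
    "\<And>n. lp L p (\<eta> n)" "\<And>n. lp L p (grad (\<eta> n))" using sob_approx[OF v] by metis
  note lpu = sob_lp[OF u] and lpv = sob_lp[OF v]
  have p0: "p \<ge> 0" using p1 by simp
  have "lp_tendsto L p (\<lambda>n x. c *\<^sub>R \<phi> n x + d *\<^sub>R \<eta> n x) (\<lambda>x. c *\<^sub>R u x + d *\<^sub>R v x)"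
    by (intro lp_tendsto_add lp_tendsto_scaleR lp_scaleR \<phi> \<eta> lpu lpv p0)
  moreover have "lp_tendsto L p (\<lambda>n x. c *\<^sub>R grad (\<phi> n) x + d *\<^sub>R grad (\<eta> n) x) (\<lambda>x. c *\<^sub>R g x + d *\<^sub>R h x)"
    by (intro lp_tendsto_add lp_tendsto_scaleR lp_scaleR \<phi> \<eta> lpu lpv p0)
  moreover have "lp L p (\<lambda>x. c *\<^sub>R u x + d *\<^sub>R v x)" "lp L p (\<lambda>x. c *\<^sub>R g x + d *\<^sub>R h x)"
    by (intro lp_add lp_scaleR lpu lpv p0)+
  moreover have "(\<lambda>x. c * \<phi> n x + d * \<eta> n x) \<in> T" for n
    by (intro test_functions_add test_functions_scaleR \<phi> \<eta>)
  ultimately show ?thesis unfolding sob_def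
    by (intro conjI exI[of _ "\<lambda>n x. c * \<phi> n x + d * \<eta> n x"]) (auto simp: test_grad_linear[OF \<phi>(1) \<eta>(1)])
qed

lemma sob_diff: "sob u g \<Longrightarrow> sob v h \<Longrightarrow> sob (\<lambda>x. u x - v x) (\<lambda>x. g x - h x)"
  using sob_linear[of u g v h 1 "-1"] by simp

lemma sob_scale: "sob u g \<Longrightarrow> sob (\<lambda>x. c * u x) (\<lambda>x. c *\<^sub>R g x)"
  using sob_linear[of u g u g c 0] by simp

text \<open>Diagonal choice: for the \<open>n\<close>-th pair take a test function whose distances
  to it, in function and gradient, are below \<open>1 / (n + 1)\<close>. The chosen test functions
  approximate the limit pair.\<close>

lemma sob_closed:
  assumes s: "\<And>n. sob (u n) (g n)" and u: "lp L p v" "lp_tendsto L p u v" and g: "lp L p h" "lp_tendsto L p g h"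
  shows "sob v h"
proof -
  have "\<exists>\<phi>\<in>T. (\<integral>x. norm (\<phi> x - u n x) powr p \<partial>L) < 1 / Suc n \<and> (\<integral>x. norm (grad \<phi> x - g n x) powr p \<partial>L) < 1 / Suc n" for n
  proof -
    obtain \<phi> where \<phi>: "\<And>k. \<phi> k \<in> T" "lp_tendsto L p \<phi> (u n)" "lp_tendsto L p (\<lambda>n. grad (\<phi> n)) (g n)"
      using sob_approx[OF s[of n]] by metis
    have "\<forall>\<^sub>F k in sequentially. (\<integral>x. norm (\<phi> k x - u n x) powr p \<partial>L) < 1 / Suc n"
      "\<forall>\<^sub>F k in sequentially. (\<integral>x. norm (grad (\<phi> k) x - g n x) powr p \<partial>L) < 1 / Suc n"
      using \<phi>(2,3) unfolding lp_tendsto_def by (auto intro!: order_tendstoD(2)[where y = 0])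
    then have "\<forall>\<^sub>F k in sequentially. (\<integral>x. norm (\<phi> k x - u n x) powr p \<partial>L) < 1 / Suc n \<and> (\<integral>x. norm (grad (\<phi> k) x - g n x) powr p \<partial>L) < 1 / Suc n"
      by (rule eventually_conj)
    then show ?thesis using \<phi>(1) unfolding eventually_sequentially by blast
  qed
  then have "\<forall>n. \<exists>\<phi>. \<phi> \<in> T \<and> (\<integral>x. norm (\<phi> x - u n x) powr p \<partial>L) < 1 / Suc n \<and> (\<integral>x. norm (grad \<phi> x - g n x) powr p \<partial>L) < 1 / Suc n"
    by blast
  from choice[OF this] obtain \<phi> where "\<forall>n. \<phi> n \<in> T \<and> (\<integral>x. norm (\<phi> n x - u n x) powr p \<partial>L) < 1 / Suc n \<and>
    (\<integral>x. norm (grad (\<phi> n) x - g n x) powr p \<partial>L) < 1 / Suc n" by (elim exE)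
  then have \<phi>: "\<phi> n \<in> T" "(\<integral>x. norm (\<phi> n x - u n x) powr p \<partial>L) < 1 / Suc n"
    "(\<integral>x. norm (grad (\<phi> n) x - g n x) powr p \<partial>L) < 1 / Suc n" for n by simp_all
  have inv: "(\<lambda>n. 1 / real (Suc n)) \<longlonglongrightarrow> 0" using LIMSEQ_Suc[OF lim_1_over_n] by simp
  have p0: "p \<ge> 0" "p > 0" using p1 by auto
  have z1: "lp_tendsto L p (\<lambda>n x. \<phi> n x - u n x) (\<lambda>_. 0)"
    unfolding lp_tendsto_def diff_zero
    by (rule tendsto_sandwich[OF _ _ tendsto_const inv])
      (use less_imp_le[OF \<phi>(2)] in \<open>auto intro!: always_eventually\<close>)
  have z2: "lp_tendsto L p (\<lambda>n x. grad (\<phi> n) x - g n x) (\<lambda>_. 0)"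
    unfolding lp_tendsto_def diff_zero
    by (rule tendsto_sandwich[OF _ _ tendsto_const inv])
      (use less_imp_le[OF \<phi>(3)] in \<open>auto intro!: always_eventually\<close>)
  have lz: "lp L p (\<lambda>_. 0 :: real)" "lp L p (\<lambda>_. 0 :: 'a)" by (simp_all add: lp_def)
  note l\<phi> = test_lp[OF \<phi>(1) p0(2)] and ls = sob_lp[OF s]
  have "lp_tendsto L p (\<lambda>n x. (\<phi> n x - u n x) + u n x) (\<lambda>x. 0 + v x)"
    by (intro lp_tendsto_add z1 u l\<phi> ls lz p0 lp_diff)
  moreover have "lp_tendsto L p (\<lambda>n x. (grad (\<phi> n) x - g n x) + g n x) (\<lambda>x. 0 + h x)"
    by (intro lp_tendsto_add z2 g l\<phi> ls lz p0 lp_diff)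
  ultimately show ?thesis unfolding sob_def using u(1) g(1) \<phi>(1) by (intro conjI exI[of _ \<phi>]) auto
qed

section \<open>Comparison with the space \<open>W01p\<close>\<close>

lemma weak_grad_eq:
  assumes "has_weak_gradient \<Omega> u g"
  shows "AE x in L. weak_grad \<Omega> u x = g x"
proof (rule weak_gradient_unique[OF open_domain _ assms])
  show "has_weak_gradient \<Omega> u (weak_grad \<Omega> u)"
    unfolding weak_grad_def by (rule someI[of "has_weak_gradient \<Omega> u", OF assms])
qed simp

lemma lp_iff_Lp_space: "g \<in> Lp_space \<Omega> r \<longleftrightarrow> lp L r g"
  by (simp add: Lp_space_def lp_def)

lemma weak_grad_cong:
  assumes "has_weak_gradient \<Omega> u g" "lp L p g"
  shows "lp L p (weak_grad \<Omega> u)" "grad_energy \<Omega> p u = (\<integral>x. norm (g x) powr p \<partial>L)"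
proof -
  have ae: "AE x in L. weak_grad \<Omega> u x = g x" by (rule weak_grad_eq[OF assms(1)])
  then have ae': "AE x in L. g x = weak_grad \<Omega> u x" by eventually_elim simp
  have m: "weak_grad \<Omega> u \<in> borel_measurable L"
    by (rule lebesgue_on_measurable_cong_AE[OF domain_sets lp_measurable[OF assms(2)] ae'])
  show "lp L p (weak_grad \<Omega> u)" by (rule lp_cong_AE[OF assms(2) ae' m])
  show "grad_energy \<Omega> p u = (\<integral>x. norm (g x) powr p \<partial>L)"
    unfolding grad_energy_def using ae m assms(2)
    by (intro integral_cong_AE) (auto simp: lp_def elim: eventually_mono)
qed

lemma sob_W01p:
  assumes "sob u g"
  shows "u \<in> W01p \<Omega> p" "AE x in L. weak_grad \<Omega> u x = g x" "grad_energy \<Omega> p u = (\<integral>x. norm (g x) powr p \<partial>L)"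
proof -
  note w = sob_weak_gradient[OF assms]
  show "AE x in L. weak_grad \<Omega> u x = g x" by (rule weak_grad_eq[OF w])
  show "grad_energy \<Omega> p u = (\<integral>x. norm (g x) powr p \<partial>L)" by (rule weak_grad_cong[OF w sob_lp(2)[OF assms]])
  obtain \<phi> where \<phi>: "\<And>n. \<phi> n \<in> T" "lp_tendsto L p \<phi> u" "lp_tendsto L p (\<lambda>n. grad (\<phi> n)) g"
    using sob_approx[OF assms] by metis
  have "grad_energy \<Omega> p (\<lambda>x. \<phi> n x - u x) = (\<integral>x. norm (grad (\<phi> n) x - g x) powr p \<partial>L)" for n
    using sob_diff[OF sob_test[OF \<phi>(1)] assms, of n] by (intro weak_grad_cong sob_weak_gradient sob_lp(2))
  then have "W1p_norm \<Omega> p (\<lambda>x. \<phi> n x - u x) = ((\<integral>x. norm (\<phi> n x - u x) powr p \<partial>L) + (\<integral>x. norm (grad (\<phi> n) x - g x) powr p \<partial>L)) powr (1 / p)" for n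
    by (simp add: W1p_norm_def)
  moreover have "(\<lambda>n. ((\<integral>x. norm (\<phi> n x - u x) powr p \<partial>L) + (\<integral>x. norm (grad (\<phi> n) x - g x) powr p \<partial>L)) powr (1 / p)) \<longlonglongrightarrow> (0 + 0) powr (1 / p)"
    using \<phi>(2,3) p1 unfolding lp_tendsto_def
    by (intro tendsto_powr2 tendsto_add tendsto_const always_eventually) (auto intro!: add_nonneg_nonneg)
  ultimately have "(\<lambda>n. W1p_norm \<Omega> p (\<lambda>x. \<phi> n x - u x)) \<longlonglongrightarrow> 0" by simp
  moreover have "u \<in> Lp_space \<Omega> p" "g \<in> Lp_space \<Omega> p" using sob_lp[OF assms] by (simp_all add: lp_iff_Lp_space)
  ultimately show "u \<in> W01p \<Omega> p" unfolding W01p_def W1p_def using \<phi>(1) w by blast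
qed

text \<open>The definition of \<open>W01p\<close> measures the approximation through the selected
  weak gradient of \<open>\<phi> n - u\<close>. The difference of the gradients is a weak gradient
  of this function as well, so by uniqueness the norm is made of the two integrals that occur in
  \<open>sob\<close>, and both tend to 0.\<close>

lemma W01p_sob:
  assumes "u \<in> W01p \<Omega> p" shows "sob u (weak_grad \<Omega> u)"
proof -
  obtain g \<phi> where g': "u \<in> Lp_space \<Omega> p" "g \<in> Lp_space \<Omega> p" "has_weak_gradient \<Omega> u g"
    and \<phi>: "\<And>n::nat. \<phi> n \<in> T" "(\<lambda>n. W1p_norm \<Omega> p (\<lambda>x. \<phi> n x - u x)) \<longlonglongrightarrow> 0"
    using assms unfolding W01p_def W1p_def by blast
  then have g: "lp L p u" "lp L p g" "has_weak_gradient \<Omega> u g" by (simp_all add: lp_iff_Lp_space)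
  note wg = weak_grad_cong(1)[OF g(3,2)]
  have hw: "has_weak_gradient \<Omega> u (weak_grad \<Omega> u)" unfolding weak_grad_def by (rule someI[of "has_weak_gradient \<Omega> u", OF g(3)])
  have p0: "p > 0" "p \<ge> 0" using p1 by auto
  have hd: "has_weak_gradient \<Omega> (\<lambda>x. \<phi> n x - u x) (\<lambda>x. grad (\<phi> n) x - weak_grad \<Omega> u x)" for n
    unfolding has_weak_gradient_def
  proof (intro conjI ballI)
    note l = test_lp[OF \<phi>(1)[of n] p0(1)]
    show "locally_integrable_on \<Omega> (\<lambda>x. \<phi> n x - u x)" "locally_integrable_on \<Omega> (\<lambda>x. grad (\<phi> n) x - weak_grad \<Omega> u x)"
      by (intro lp_locally_integrable lp_diff l g wg p0)+
    fix \<eta> b assume \<eta>: "\<eta> \<in> T" and b: "b \<in> (Basis :: 'a set)"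
    note tp = test_partial[OF \<eta> b]
    obtain B B' where B: "\<And>x. \<bar>frechet_derivative \<eta> (at x) b\<bar> \<le> B" "\<And>x. \<bar>\<eta> x\<bar> \<le> B'"
      using tp(4,5) by blast
    have i: "integrable L (\<lambda>x. f x * c x)" if "lp L p f" "c \<in> borel_measurable L" "\<And>x. \<bar>c x\<bar> \<le> B" for f c :: "'a \<Rightarrow> real" and B
    proof -
      have fi: "integrable L f" using lp_integrable_L1[OF finite_L _ that(1)] p1 by simp
      then show ?thesis using that(2)
        by (intro Bochner_Integration.integrable_bound[OF integrable_mult_left[OF fi, of B]])
          (auto simp: abs_mult intro!: AE_I2 mult_left_mono order_trans[OF that(3)])
    qed
    have "(\<integral>x. (\<phi> n x - u x) * frechet_derivative \<eta> (at x) b \<partial>L) = (\<integral>x. \<phi> n x * frechet_derivative \<eta> (at x) b \<partial>L) - (\<integral>x. u x * frechet_derivative \<eta> (at x) b \<partial>L)"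
      using i[OF l(1) tp(2) B(1)] i[OF g(1) tp(2) B(1)] by (simp add: left_diff_distrib)
    also have "\<dots> = - (\<integral>x. (grad (\<phi> n) x \<bullet> b) * \<eta> x \<partial>L) + (\<integral>x. (weak_grad \<Omega> u x \<bullet> b) * \<eta> x \<partial>L)"
      using test_integration_by_parts[OF \<phi>(1) \<eta> b, of n] hw \<eta> b by (simp add: has_weak_gradient_def)
    also have "\<dots> = - (\<integral>x. ((grad (\<phi> n) x - weak_grad \<Omega> u x) \<bullet> b) * \<eta> x \<partial>L)"
      using i[OF lp_inner[OF l(2) b p0(2)] tp(3) B(2)] i[OF lp_inner[OF wg b p0(2)] tp(3) B(2)]
      by (simp add: left_diff_distrib inner_diff_left)
    finally show "(\<integral>x. (\<phi> n x - u x) * frechet_derivative \<eta> (at x) b \<partial>L) = - (\<integral>x. ((grad (\<phi> n) x - weak_grad \<Omega> u x) \<bullet> b) * \<eta> x \<partial>L)" .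
  qed
  define A B where "A n = (\<integral>x. norm (\<phi> n x - u x) powr p \<partial>L)" and "B n = (\<integral>x. norm (grad (\<phi> n) x - weak_grad \<Omega> u x) powr p \<partial>L)" for n
  have AB: "A n \<ge> 0" "B n \<ge> 0" for n by (auto simp: A_def B_def)
  have "grad_energy \<Omega> p (\<lambda>x. \<phi> n x - u x) = B n" for n
    unfolding B_def by (rule weak_grad_cong(2)[OF hd lp_diff[OF test_lp(2)[OF \<phi>(1) p0(1)] wg p0(2)]])
  then have "W1p_norm \<Omega> p (\<lambda>x. \<phi> n x - u x) = (A n + B n) powr (1 / p)" for n
    by (simp add: W1p_norm_def A_def)
  then have "(\<lambda>n. ((A n + B n) powr (1 / p)) powr p) \<longlonglongrightarrow> 0 powr p"
    using \<phi>(2) p1 by (intro tendsto_powr2 tendsto_const) auto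
  then have *: "(\<lambda>n. A n + B n) \<longlonglongrightarrow> 0" using p1 AB by (simp add: powr_powr add_nonneg_nonneg)
  have "A \<longlonglongrightarrow> 0" "B \<longlonglongrightarrow> 0"
    by (rule tendsto_sandwich[OF _ _ tendsto_const *]; use AB in auto)+
  then show ?thesis unfolding sob_def lp_tendsto_def A_def B_def using g(1) wg \<phi>(1) by blast
qed

end

section \<open>Compactness\<close>

text \<open>The threshold \<open>\<epsilon> powr (- 1 / (b - a))\<close> is where
  \<open>t powr a\<close> and \<open>\<epsilon> * t powr b\<close> cross. Below it the left side is
  bounded by its value there, above it by the first term on the right.\<close>

lemma powr_le_interpolate:
  fixes a b :: real
  assumes ab: "0 \<le> a" "a < b" and e: "\<epsilon> > 0"
  shows "\<exists>C\<ge>0. \<forall>t\<ge>0. t powr a \<le> \<epsilon> * t powr b + C"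
proof (intro exI[of _ "(\<epsilon> powr (- 1 / (b - a))) powr a"] conjI allI impI)
  let ?T = "\<epsilon> powr (- 1 / (b - a))"
  fix t :: real assume t: "t \<ge> 0"
  show "t powr a \<le> \<epsilon> * t powr b + ?T powr a"
  proof (cases "t \<le> ?T")
    case True
    then have "t powr a \<le> ?T powr a" using t ab by (intro powr_mono2) auto
    moreover have "0 \<le> \<epsilon> * t powr b" using e by simp
    ultimately show ?thesis by linarith
  next
    case False
    then have tp: "t > 0" using powr_ge_zero[of \<epsilon> "- 1 / (b - a)"] by linarith
    have "t powr (a - b) \<le> ?T powr (a - b)" using False e ab by (intro powr_mono2') auto
    also have "\<dots> = \<epsilon>"
    proof -
      have "- 1 / (b - a) * (a - b) = 1" using ab by (simp add: field_simps)
      then show ?thesis using e unfolding powr_powr by simp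
    qed
    finally have "t powr b * t powr (a - b) \<le> t powr b * \<epsilon>" by (intro mult_left_mono) auto
    then have "t powr a \<le> t powr b * \<epsilon>" by (simp add: powr_add[symmetric])
    then show ?thesis using add_increasing2[OF powr_ge_zero] by (simp add: mult.commute)
  qed
qed simp

text \<open>A form of Vitali's theorem: a bound with the larger exponent makes the smaller powers
  equi-integrable on a finite measure space, so almost everywhere convergence becomes convergence in
  the mean. Fatou's lemma supplies the bound for the limit.\<close>

lemma lp_tendsto_interpolate:
  fixes f :: "nat \<Rightarrow> 'a \<Rightarrow> 'b::euclidean_space"
  assumes fin: "finite_measure M" and r: "0 < a" "a < b"
    and f: "\<And>n. lp M b (f n)" "\<And>n. (\<integral>x. norm (f n x) powr b \<partial>M) \<le> K"
    and lim: "AE x in M. (\<lambda>n. f n x) \<longlonglongrightarrow> g x" and g: "g \<in> borel_measurable M"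
  shows "lp_tendsto M a f g"
proof -
  interpret finite_measure M by fact
  have gb: "lp M b g" "(\<integral>x. norm (g x) powr b \<partial>M) \<le> K" using lp_fatou[OF f lim g] r by auto
  have "lp M b (\<lambda>x. f n x - g x)" for n using r by (intro lp_diff f gb) auto
  note i = lp_integrable[OF this]
  have "(\<lambda>n. \<integral>x. norm (f n x - g x) powr a \<partial>M) \<longlonglongrightarrow> 0"
  proof (rule integral_vanishing[where A = "\<lambda>n x. norm (f n x - g x) powr b" and B = "\<lambda>_. 1"])
    show "(\<integral>x. norm (f n x - g x) powr b \<partial>M) \<le> 2 powr b * (K + K)" for n
    proof -
      have "(\<integral>x. norm (f n x - g x) powr b \<partial>M) \<le> (\<integral>x. 2 powr b * (norm (f n x) powr b + norm (g x) powr b) \<partial>M)"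
        using r norm_add_powr_le[of b "f n _" "- g _"] lp_integrable[OF f(1)] lp_integrable[OF gb(1)] i
        by (intro integral_mono) auto
      also have "\<dots> = 2 powr b * ((\<integral>x. norm (f n x) powr b \<partial>M) + (\<integral>x. norm (g x) powr b \<partial>M))"
        using lp_integrable[OF f(1)] lp_integrable[OF gb(1)] by simp
      also have "\<dots> \<le> 2 powr b * (K + K)" by (intro mult_left_mono add_mono f gb) auto
      finally show ?thesis .
    qed
    show "AE x in M. (\<lambda>n. norm (f n x - g x) powr a) \<longlonglongrightarrow> 0" using lim
    proof eventually_elim
      case (elim x)
      have "(\<lambda>n. norm (f n x - g x)) \<longlonglongrightarrow> 0" using elim by (simp add: tendsto_norm_zero_iff LIM_zero_iff)
      then have "(\<lambda>n. norm (f n x - g x) powr a) \<longlonglongrightarrow> 0 powr a" using r by (intro tendsto_powr2 tendsto_const) auto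
      then show ?case by simp
    qed
    show "\<exists>C\<ge>0. \<forall>n. AE x in M. \<bar>norm (f n x - g x) powr a\<bar> \<le> \<epsilon> * norm (f n x - g x) powr b + C * 1" if e: "\<epsilon> > 0" for \<epsilon>
    proof -
      obtain C where "C \<ge> 0" "\<forall>t\<ge>0. t powr a \<le> \<epsilon> * t powr b + C" using powr_le_interpolate[OF less_imp_le[OF r(1)] r(2) e] by blast
      then show ?thesis by (intro exI[of _ C]) auto
    qed
  qed (use i in auto)
  then show ?thesis by (simp add: lp_tendsto_def)
qed

lemma diagonal_convergent:
  fixes a :: "nat \<Rightarrow> nat \<Rightarrow> real"
  assumes "\<And>i. bounded (range (a i))"
  obtains s where "strict_mono (s :: nat \<Rightarrow> nat)" "\<And>i. convergent (\<lambda>j. a i (s j))"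
proof -
  interpret subseqs "\<lambda>i s. convergent (\<lambda>j. a i (s j))"
  proof
    fix n and s :: "nat \<Rightarrow> nat" assume s: "strict_mono s"
    have "bounded (range (\<lambda>j. a n (s j)))" using assms[of n] by (rule bounded_subset) auto
    then obtain l r where "strict_mono r" "((\<lambda>j. a n (s j)) \<circ> r) \<longlonglongrightarrow> l"
      using bounded_imp_convergent_subsequence by metis
    then show "\<exists>r'. strict_mono r' \<and> convergent (\<lambda>j. a n ((s \<circ> r') j))" by (auto simp: convergent_def o_def)
  qed
  have "convergent (\<lambda>j. a i (diagseq j))" for i
  proof -
    have "convergent (\<lambda>j. a i ((diagseq \<circ> (+) (Suc i)) j))"
    proof (rule diagseq_holds)
      fix r s :: "nat \<Rightarrow> nat" and n assume "strict_mono r" "convergent (\<lambda>j. a n (s j))"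
      then show "convergent (\<lambda>j. a n ((s \<circ> r) j))"
        using convergent_subseq_convergent[of "\<lambda>j. a n (s j)" r] by (simp add: o_def)
    qed
    then have "convergent (\<lambda>j. a i (diagseq (j + Suc i)))" by (simp add: o_def add.commute)
    then show ?thesis using convergent_ignore_initial_segment[of "\<lambda>j. a i (diagseq j)" "Suc i"] by simp
  qed
  with subseq_diagseq show ?thesis by (rule that)
qed

text \<open>A substitute for mollification. For the compactness argument it is enough that the
  averages have a bound and a Lipschitz constant depending only on the \<open>L^1\<close> norms of
  the function and its gradient, and that they are \<open>L^1\<close>-close to the function.\<close>

definition ball_avg :: "real \<Rightarrow> ('a::euclidean_space \<Rightarrow> real) \<Rightarrow> 'a \<Rightarrow> real" where
  "ball_avg \<epsilon> w x = (\<integral>y. indicator (cball 0 \<epsilon>) y * w (x + y) \<partial>lborel) / measure lborel (cball (0::'a) \<epsilon>)"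

context
  fixes K :: "'a::euclidean_space set" and w :: "'a \<Rightarrow> real" and g :: "'a \<Rightarrow> 'a" and \<epsilon> :: real
  assumes C1c: "C1c K w g" and e: "\<epsilon> > 0"
begin

private abbreviation "Q \<equiv> cball (0::'a) \<epsilon>"

lemma cball_measure_pos: "measure lborel Q > 0"
  using e content_cball_pos[of \<epsilon> "0::'a"] by simp

private lemma w_meas [measurable]: "w \<in> borel_measurable borel"
  using C1c_facts(6)[OF C1c] by (rule borel_measurable_continuous_onI)

private lemma int_shift: "integrable lborel (\<lambda>y. w (x + y))"
  using integrable_translate[OF C1c_integrable(1)[OF C1c], of x] by (simp add: add.commute)

private lemma int_shift_Q: "integrable lborel (\<lambda>y. indicator Q y * w (x + y))"
  by (rule Bochner_Integration.integrable_bound[OF int_shift[of x]]) (auto simp: indicator_def)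

lemma ball_avg_bound: "\<bar>ball_avg \<epsilon> w x\<bar> \<le> (\<integral>y. \<bar>w y\<bar> \<partial>lborel) / measure lborel Q"
proof -
  have "\<bar>\<integral>y. indicator Q y * w (x + y) \<partial>lborel\<bar> \<le> (\<integral>y. \<bar>indicator Q y * w (x + y)\<bar> \<partial>lborel)"
    by (rule integral_abs_bound)
  also have "\<dots> \<le> (\<integral>y. \<bar>w (x + y)\<bar> \<partial>lborel)"
    using int_shift by (intro integral_mono') (auto simp: indicator_def)
  also have "\<dots> = (\<integral>y. \<bar>w y\<bar> \<partial>lborel)"
    using integral_translate[of "\<lambda>y. \<bar>w y\<bar>" x] C1c_integrable(1)[OF C1c] by (simp add: add.commute)
  finally show ?thesis using cball_measure_pos unfolding ball_avg_def abs_divide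
    by (simp add: divide_right_mono)
qed

lemma ball_avg_lipschitz:
  "\<bar>ball_avg \<epsilon> w x - ball_avg \<epsilon> w x'\<bar> \<le> norm (x - x') * (\<integral>y. norm (g y) \<partial>lborel) / measure lborel Q"
proof -
  have i: "integrable lborel (\<lambda>y. \<bar>w (y + (x - x')) - w y\<bar>)"
    using integrable_translate[OF C1c_integrable(1)[OF C1c]] C1c_integrable(1)[OF C1c] by auto
  have "\<bar>(\<integral>y. indicator Q y * w (x + y) \<partial>lborel) - (\<integral>y. indicator Q y * w (x' + y) \<partial>lborel)\<bar>
     = \<bar>\<integral>y. indicator Q y * w (x + y) - indicator Q y * w (x' + y) \<partial>lborel\<bar>"
    using int_shift_Q by simp
  also have "\<dots> \<le> (\<integral>y. \<bar>indicator Q y * w (x + y) - indicator Q y * w (x' + y)\<bar> \<partial>lborel)"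
    by (rule integral_abs_bound)
  also have "\<dots> \<le> (\<integral>y. \<bar>w (y + x' + (x - x')) - w (y + x')\<bar> \<partial>lborel)"
    using integrable_translate[OF i, of x']
    by (intro integral_mono') (auto simp: indicator_def add.commute)
  also have "\<dots> = (\<integral>y. \<bar>w (y + (x - x')) - w y\<bar> \<partial>lborel)"
    using integral_translate[OF i, of x'] by simp
  also have "\<dots> \<le> norm (x - x') * (\<integral>y. norm (g y) \<partial>lborel)" by (rule C1c_translate_le[OF C1c])
  finally show ?thesis using cball_measure_pos unfolding ball_avg_def
    by (simp add: diff_divide_distrib[symmetric] divide_right_mono abs_divide)
qed

lemma ball_avg_measurable: "ball_avg \<epsilon> w \<in> borel_measurable borel"
proof -
  let ?C = "(\<integral>y. norm (g y) \<partial>lborel) / measure lborel Q"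
  have "?C-lipschitz_on UNIV (ball_avg \<epsilon> w)"
    using ball_avg_lipschitz by (intro lipschitz_onI) (auto simp: dist_norm mult.commute)
  then show ?thesis by (intro borel_measurable_continuous_onI lipschitz_on_continuous_on)
qed

text \<open>Exchanging the order of integration leaves, for every \<open>y\<close> in the ball, the
  translation estimate with \<open>norm y \<le> \<epsilon>\<close>. Nonnegative integrals allow the
  exchange without prior joint integrability.\<close>

lemma ball_avg_L1:
  "(\<integral>\<^sup>+x. ennreal \<bar>ball_avg \<epsilon> w x - w x\<bar> \<partial>lborel) \<le> ennreal (\<epsilon> * (\<integral>y. norm (g y) \<partial>lborel))"
proof -
  let ?m = "measure lborel Q"
  have m: "?m > 0" by (rule cball_measure_pos)
  have [measurable]: "w \<in> borel_measurable borel" "Q \<in> sets borel" using w_meas by auto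
  have em: "emeasure lborel Q = ennreal ?m"
    by (intro emeasure_eq_ennreal_measure) (use emeasure_bounded_finite[of Q] in auto)
  have iQ: "integrable lborel (\<lambda>y. indicator Q y * (w (x + y) - w x))" for x
    using int_shift_Q[of x] emeasure_bounded_finite[of Q] by (auto simp: right_diff_distrib)
  have pt: "ennreal \<bar>ball_avg \<epsilon> w x - w x\<bar> \<le> (\<integral>\<^sup>+y. ennreal (1 / ?m * (indicator Q y * \<bar>w (x + y) - w x\<bar>)) \<partial>lborel)" for x
  proof -
    have "ball_avg \<epsilon> w x - w x = (\<integral>y. indicator Q y * (w (x + y) - w x) \<partial>lborel) / ?m"
      using int_shift_Q[of x] emeasure_bounded_finite[of Q] m
      by (simp add: right_diff_distrib ball_avg_def diff_divide_distrib)
    then have "\<bar>ball_avg \<epsilon> w x - w x\<bar> = 1 / ?m * \<bar>\<integral>y. indicator Q y * (w (x + y) - w x) \<partial>lborel\<bar>" by simp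
    also have "\<dots> \<le> 1 / ?m * (\<integral>y. \<bar>indicator Q y * (w (x + y) - w x)\<bar> \<partial>lborel)"
      by (intro mult_left_mono integral_abs_bound) auto
    also have "\<dots> = (\<integral>y. 1 / ?m * (indicator Q y * \<bar>w (x + y) - w x\<bar>) \<partial>lborel)" by (simp add: abs_mult)
    finally have le: "\<bar>ball_avg \<epsilon> w x - w x\<bar> \<le> (\<integral>y. 1 / ?m * (indicator Q y * \<bar>w (x + y) - w x\<bar>) \<partial>lborel)" .
    have "integrable lborel (\<lambda>y. 1 / ?m * (indicator Q y * \<bar>w (x + y) - w x\<bar>))"
      using integrable_abs[OF iQ[of x]] by (intro integrable_mult_right) (simp add: abs_mult)
    then show ?thesis using le by (subst nn_integral_eq_integral) (auto intro: ennreal_leI)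
  qed
  have "(\<integral>\<^sup>+x. ennreal \<bar>ball_avg \<epsilon> w x - w x\<bar> \<partial>lborel) \<le> (\<integral>\<^sup>+x. \<integral>\<^sup>+y. ennreal (1 / ?m * (indicator Q y * \<bar>w (x + y) - w x\<bar>)) \<partial>lborel \<partial>lborel)"
    by (intro nn_integral_mono pt)
  also have "\<dots> = (\<integral>\<^sup>+y. \<integral>\<^sup>+x. ennreal (1 / ?m * (indicator Q y * \<bar>w (x + y) - w x\<bar>)) \<partial>lborel \<partial>lborel)"
    by (rule lborel_pair.Fubini'[symmetric]) measurable
  also have "\<dots> \<le> (\<integral>\<^sup>+y. ennreal (1 / ?m * (\<epsilon> * (\<integral>y. norm (g y) \<partial>lborel))) * indicator Q y \<partial>lborel)"
  proof (rule nn_integral_mono)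
    fix y
    have i: "integrable lborel (\<lambda>x. \<bar>w (x + y) - w x\<bar>)"
      using integrable_translate[OF C1c_integrable(1)[OF C1c]] C1c_integrable(1)[OF C1c] by auto
    show "(\<integral>\<^sup>+x. ennreal (1 / ?m * (indicator Q y * \<bar>w (x + y) - w x\<bar>)) \<partial>lborel) \<le> ennreal (1 / ?m * (\<epsilon> * (\<integral>y. norm (g y) \<partial>lborel))) * indicator Q y"
    proof (cases "y \<in> Q")
      case True
      have "(\<integral>\<^sup>+x. ennreal (1 / ?m * (indicator Q y * \<bar>w (x + y) - w x\<bar>)) \<partial>lborel) = ennreal (\<integral>x. 1 / ?m * \<bar>w (x + y) - w x\<bar> \<partial>lborel)"
        using i True by (subst nn_integral_eq_integral[symmetric]) auto
      also have "\<dots> \<le> ennreal (1 / ?m * (\<epsilon> * (\<integral>y. norm (g y) \<partial>lborel)))"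
      proof (rule ennreal_leI)
        have "(\<integral>x. \<bar>w (x + y) - w x\<bar> \<partial>lborel) \<le> norm y * (\<integral>y. norm (g y) \<partial>lborel)" by (rule C1c_translate_le[OF C1c])
        also have "\<dots> \<le> \<epsilon> * (\<integral>y. norm (g y) \<partial>lborel)" using True by (intro mult_right_mono) auto
        finally show "(\<integral>x. 1 / ?m * \<bar>w (x + y) - w x\<bar> \<partial>lborel) \<le> 1 / ?m * (\<epsilon> * (\<integral>y. norm (g y) \<partial>lborel))"
          using m by (simp add: divide_right_mono)
      qed
      finally show ?thesis using True by simp
    qed simp
  qed
  also have "\<dots> = ennreal (1 / ?m * (\<epsilon> * (\<integral>y. norm (g y) \<partial>lborel))) * ennreal ?m"
    by (subst nn_integral_cmult) (auto simp: em)
  also have "\<dots> = ennreal (\<epsilon> * (\<integral>y. norm (g y) \<partial>lborel))"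
    using m e by (subst ennreal_mult[symmetric]) auto
  finally show ?thesis .
qed

end

section \<open>The Sobolev inequality for limits of test functions\<close>

context sobolev_domain
begin

text \<open>Fatou's lemma along an almost everywhere convergent subsequence of the approximating
  test functions. It gives membership in \<open>L^ps\<close> at the same time, which approximation
  in \<open>L^p\<close> alone does not.\<close>

lemma sob_sobolev:
  assumes n: "DIM('a) \<ge> 2" and pn: "p < real DIM('a)"
  defines "ps \<equiv> crit_exp TYPE('a) p"
  obtains C where "C > 0" "\<And>u g. sob u g \<Longrightarrow> lp L ps u"
    "\<And>u g. sob u g \<Longrightarrow> (\<integral>x. \<bar>u x\<bar> powr ps \<partial>L) \<le> C * (\<integral>x. norm (g x) powr p \<partial>L) powr (ps / p)"
proof -
  obtain C0 where C0: "C0 > 0" "\<And>K (w :: 'a \<Rightarrow> real) g. C1c K w g \<Longrightarrow> (\<integral>x. \<bar>w x\<bar> powr ps \<partial>lborel) \<le> C0 * (\<integral>x. norm (g x) powr p \<partial>lborel) powr (ps / p)"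
    using sobolev_inequality_C1c[OF n p1 pn] unfolding ps_def by metis
  have ps0: "ps > 0" using p1 pn n by (simp add: ps_def crit_exp_def)
  have p0: "p > 0" "p \<ge> 0" using p1 by auto
  \<comment> \<open>The factor \<open>2 powr p\<close> stems from the quasi-triangle inequality for
    \<open>p\<close>-th powers. The value is immaterial, since the sharp constant enters only
    through the infimum \<open>sobolev_const\<close>.\<close>
  define C where "C = C0 * (2 powr p) powr (ps / p)"
  have key: "lp L ps u \<and> (\<integral>x. \<bar>u x\<bar> powr ps \<partial>L) \<le> C * (\<integral>x. norm (g x) powr p \<partial>L) powr (ps / p)" if s: "sob u g" for u g
  proof -
    obtain \<phi> where \<phi>: "\<And>n. \<phi> n \<in> T" "lp_tendsto L p \<phi> u" "lp_tendsto L p (\<lambda>n. grad (\<phi> n)) g"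
      "\<And>n. lp L p (\<phi> n)" "\<And>n. lp L p (grad (\<phi> n))" using sob_approx[OF s] by metis
    note lps = sob_lp[OF s]
    define Y where "Y = (\<integral>x. norm (g x) powr p \<partial>L)"
    have Y0: "Y \<ge> 0" by (simp add: Y_def)
    have test: "(\<integral>x. norm (\<phi> n x) powr ps \<partial>L) \<le> C0 * (\<integral>x. norm (grad (\<phi> n) x) powr p \<partial>L) powr (ps / p)" for n
    proof -
      obtain K where K: "C1c K (\<phi> n) (grad (\<phi> n))" using test_functions_C1c[OF \<phi>(1)[of n]] by blast
      show ?thesis using C0(2)[OF K] unfolding test_lp(3)[OF \<phi>(1) ps0] test_lp(4)[OF \<phi>(1) p0(1)] by simp
    qed
    have main: "lp L ps u \<and> (\<integral>x. norm (u x) powr ps \<partial>L) \<le> C0 * (2 powr p * (\<delta> + Y)) powr (ps / p)" if \<delta>: "\<delta> > 0" for \<delta>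
    proof -
      have "\<forall>\<^sub>F n in sequentially. (\<integral>x. norm (grad (\<phi> n) x - g x) powr p \<partial>L) < \<delta>"
        using \<phi>(3) \<delta> unfolding lp_tendsto_def by (intro order_tendstoD(2)) auto
      then obtain N where N: "\<And>n. n \<ge> N \<Longrightarrow> (\<integral>x. norm (grad (\<phi> n) x - g x) powr p \<partial>L) < \<delta>"
        by (auto simp: eventually_sequentially)
      have bd: "(\<integral>x. norm (\<phi> n x) powr ps \<partial>L) \<le> C0 * (2 powr p * (\<delta> + Y)) powr (ps / p)" if "n \<ge> N" for n
      proof -
        note i = lp_integrable[OF lp_diff[OF \<phi>(5)[of n] lps(2) p0(2)]] lp_integrable[OF lps(2)] lp_integrable[OF \<phi>(5)[of n]]
        have "norm (grad (\<phi> n) x) powr p \<le> 2 powr p * (norm (grad (\<phi> n) x - g x) powr p + norm (g x) powr p)" for x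
          using norm_add_powr_le[OF p0(2), of "grad (\<phi> n) x - g x" "g x"] by simp
        then have "(\<integral>x. norm (grad (\<phi> n) x) powr p \<partial>L) \<le> (\<integral>x. 2 powr p * (norm (grad (\<phi> n) x - g x) powr p + norm (g x) powr p) \<partial>L)"
          using i by (intro integral_mono) auto
        also have "\<dots> \<le> 2 powr p * (\<delta> + Y)" using i N[OF that] by (simp add: Y_def)
        finally have "(\<integral>x. norm (grad (\<phi> n) x) powr p \<partial>L) powr (ps / p) \<le> (2 powr p * (\<delta> + Y)) powr (ps / p)"
          using ps0 p0 by (intro powr_mono2) auto
        then have "C0 * (\<integral>x. norm (grad (\<phi> n) x) powr p \<partial>L) powr (ps / p) \<le> C0 * (2 powr p * (\<delta> + Y)) powr (ps / p)"
          using C0(1) by (intro mult_left_mono) auto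
        with test[of n] show ?thesis by linarith
      qed
      obtain t where t: "strict_mono t" "AE x in L. (\<lambda>n. \<phi> (t n) x) \<longlonglongrightarrow> u x"
        using lp_tendsto_AE_subseq[OF \<phi>(2,4) lps(1) p0(1)] by blast
      have t': "AE x in L. (\<lambda>n. \<phi> (t (n + N)) x) \<longlonglongrightarrow> u x"
        using t(2) by eventually_elim (rule LIMSEQ_ignore_initial_segment)
      have tN: "t (n + N) \<ge> N" for n using seq_suble[OF t(1), of "n + N"] by linarith
      show ?thesis using lp_fatou[OF test_lp(1)[OF \<phi>(1) ps0] bd[OF tN] t' lp_measurable[OF lps(1)] ps0] by blast
    qed
    have "((\<lambda>\<delta>. C0 * (2 powr p * (\<delta> + Y)) powr (ps / p)) \<longlongrightarrow> C0 * (2 powr p * (0 + Y)) powr (ps / p)) (at_right 0)"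
      using ps0 p0 Y0 by (intro tendsto_intros tendsto_powr2) (auto simp: eventually_at_filter intro!: always_eventually)
    then have "(\<integral>x. norm (u x) powr ps \<partial>L) \<le> C0 * (2 powr p * (0 + Y)) powr (ps / p)"
      by (rule tendsto_lowerbound) (use main in \<open>auto simp: eventually_at_filter intro!: always_eventually\<close>)
    also have "\<dots> = C * Y powr (ps / p)" using Y0 by (simp add: C_def powr_mult)
    finally show ?thesis using main[of 1] by (simp add: Y_def)
  qed
  have "C > 0" using C0(1) by (simp add: C_def)
  with key show ?thesis using that by blast
qed

end

section \<open>The theorem of Rellich\<close>

context sobolev_domain
begin

text \<open>At each scale the ball averages are bounded and equi-Lipschitz in \<open>j\<close>, so
  along a diagonal subsequence they converge pointwise, and by boundedness in \<open>L^1\<close>.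
  They are \<open>L^1\<close>-close to the functions uniformly in \<open>j\<close>, hence the
  functions are Cauchy in \<open>L^1\<close>.\<close>

lemma rellich_test:
  assumes \<phi>: "\<And>j. \<phi> j \<in> T"
    and G: "\<And>j. (\<integral>x. norm (grad (\<phi> j) x) \<partial>lborel) \<le> G" and W: "\<And>j. (\<integral>x. \<bar>\<phi> j x\<bar> \<partial>lborel) \<le> W"
  obtains v s where "strict_mono (s :: nat \<Rightarrow> nat)" "v \<in> borel_measurable L" "AE x in L. (\<lambda>j. \<phi> (s j) x) \<longlonglongrightarrow> v x"
proof -
  have "\<forall>j. \<exists>K. K \<subseteq> \<Omega> \<and> C1c K (\<phi> j) (grad (\<phi> j))" using test_functions_C1c[OF \<phi>] by metis
  from choice[OF this] obtain K where K: "\<forall>j. K j \<subseteq> \<Omega> \<and> C1c (K j) (\<phi> j) (grad (\<phi> j))" by (elim exE)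
  then have C: "C1c (K j) (\<phi> j) (grad (\<phi> j))" for j by simp
  have G0: "G \<ge> 0" using G[of 0] by (rule order_trans[rotated]) simp
  define \<epsilon> where "\<epsilon> m = 1 / real (Suc m)" for m
  have e: "\<epsilon> m > 0" for m by (simp add: \<epsilon>_def)
  define A where "A m j = ball_avg (\<epsilon> m) (\<phi> j)" for m j
  define \<mu> where "\<mu> m = measure lborel (cball (0::'a) (\<epsilon> m))" for m
  have \<mu>: "\<mu> m > 0" for m unfolding \<mu>_def by (rule cball_measure_pos[OF C e])
  have Ab: "\<bar>A m j x\<bar> \<le> W / \<mu> m" for m j x
    using ball_avg_bound[OF C[of j] e[of m], of x] divide_right_mono[OF W[of j], of "\<mu> m"] \<mu>[of m]
    by (simp add: A_def \<mu>_def)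
  have Al: "\<bar>A m j x - A m j y\<bar> \<le> norm (x - y) * (G / \<mu> m)" for m j x y
  proof -
    have "\<bar>A m j x - A m j y\<bar> \<le> norm (x - y) * (\<integral>x. norm (grad (\<phi> j) x) \<partial>lborel) / \<mu> m"
      unfolding A_def \<mu>_def by (rule ball_avg_lipschitz[OF C e])
    also have "\<dots> \<le> norm (x - y) * G / \<mu> m"
      using \<mu>[of m] by (intro divide_right_mono mult_left_mono G) auto
    finally show ?thesis by simp
  qed
  have Am: "A m j \<in> borel_measurable L" for m j
    unfolding A_def by (intro measurable_restrict_space1 measurable_completion) (simp add: ball_avg_measurable[OF C e])
  have \<phi>m [measurable]: "\<phi> j \<in> borel_measurable L" for j
    by (rule continuous_measurable[OF C1c_facts(6)[OF C]])
  have \<phi>i: "integrable L (\<phi> j)" for j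
    using continuous_support(1)[OF C1c_facts(6,1)[OF C] _ C1c_facts(4)[OF C]] K by blast
  have Ai: "integrable L (A m j)" for m j
    by (rule integrable_const_bound[OF _ Am]) (use Ab in auto)
  have close: "(\<integral>x. \<bar>A m j x - \<phi> j x\<bar> \<partial>L) \<le> \<epsilon> m * G" for m j
  proof -
    have [measurable]: "A m j \<in> borel_measurable borel" "\<phi> j \<in> borel_measurable borel"
      unfolding A_def using ball_avg_measurable[OF C e] C1c_facts(6)[OF C] borel_measurable_continuous_onI by blast+
    have "ennreal (\<integral>x. \<bar>A m j x - \<phi> j x\<bar> \<partial>L) = (\<integral>\<^sup>+x. ennreal \<bar>A m j x - \<phi> j x\<bar> \<partial>L)"
      using Ai \<phi>i by (intro nn_integral_eq_integral[symmetric]) auto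
    also have "\<dots> \<le> (\<integral>\<^sup>+x. ennreal \<bar>A m j x - \<phi> j x\<bar> \<partial>lebesgue)"
      by (simp add: nn_integral_restrict_space) (intro nn_integral_mono, auto simp: indicator_def)
    also have "\<dots> = (\<integral>\<^sup>+x. ennreal \<bar>A m j x - \<phi> j x\<bar> \<partial>lborel)" by (rule nn_integral_completion) measurable
    also have "\<dots> \<le> ennreal (\<epsilon> m * (\<integral>x. norm (grad (\<phi> j) x) \<partial>lborel))" unfolding A_def by (rule ball_avg_L1[OF C e])
    also have "\<dots> \<le> ennreal (\<epsilon> m * G)" using e[of m] by (intro ennreal_leI mult_left_mono G) auto
    finally show ?thesis using e[of m] G0 by (subst (asm) ennreal_le_iff) auto
  qed
  obtain D :: "'a set" where D: "countable D" "\<And>x e. e > 0 \<Longrightarrow> \<exists>d\<in>D. dist x d < e"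
  proof -
    obtain D :: "'a set" where D: "countable D" "\<And>X. open X \<Longrightarrow> X \<noteq> {} \<Longrightarrow> \<exists>d\<in>D. d \<in> X" using countable_dense_setE by blast
    have "\<exists>d\<in>D. dist x d < e" if "e > 0" for x e using D(2)[of "ball x e"] that by auto
    with D(1) show ?thesis by (rule that)
  qed
  have Dne: "D \<noteq> {}" using D(2)[of 1] by auto
  \<comment> \<open>One numerical sequence for every pair of a scale and a point of the countable
    dense set, the pairs being coded by natural numbers.\<close>
  define a where "a i j = A (fst (prod_decode i)) j (from_nat_into D (snd (prod_decode i)))" for i j
  have "bounded (range (a i))" for i unfolding bounded_iff a_def using Ab by auto
  then obtain s where s: "strict_mono s" "\<And>i. convergent (\<lambda>j. a i (s j))" using diagonal_convergent by metis
  have convD: "convergent (\<lambda>j. A m (s j) d)" if dD: "d \<in> D" for m d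
  proof -
    obtain k where k: "from_nat_into D k = d" using from_nat_into_surj[OF D(1) dD] by blast
    have "a (prod_encode (m, k)) = (\<lambda>j. A m j d)" by (auto simp: a_def k)
    with s(2)[of "prod_encode (m, k)"] show ?thesis by simp
  qed
  \<comment> \<open>Convergence on the dense set spreads to all points, because at a fixed scale the
    Lipschitz constant does not depend on \<open>j\<close>.\<close>
  have conv: "convergent (\<lambda>j. A m (s j) x)" for m x
  proof (rule Cauchy_convergent, rule CauchyI)
    fix e :: real assume e: "e > 0"
    define c where "c = G / \<mu> m"
    have c0: "c \<ge> 0" using G0 \<mu>[of m] by (simp add: c_def)
    have "e / (3 * (c + 1)) > 0" using e c0 by simp
    then obtain d where d: "d \<in> D" "dist x d < e / (3 * (c + 1))" using D(2) by blast
    have dc: "norm (x - d) * c < e / 3"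
    proof -
      have "norm (x - d) * c \<le> norm (x - d) * (c + 1)" by (intro mult_left_mono) auto
      also have "\<dots> < e / 3" using d(2) c0 by (simp add: dist_norm pos_less_divide_eq field_simps)
      finally show ?thesis .
    qed
    have "Cauchy (\<lambda>j. A m (s j) d)" using convD[OF d(1)] by (rule convergent_Cauchy)
    then obtain M where M: "\<And>i j. i \<ge> M \<Longrightarrow> j \<ge> M \<Longrightarrow> norm (A m (s i) d - A m (s j) d) < e / 3"
      using e CauchyD[of "\<lambda>j. A m (s j) d" "e / 3"] by auto
    have "norm (A m (s i) x - A m (s j) x) < e" if "i \<ge> M" "j \<ge> M" for i j
      using M[OF that] Al[of m "s i" x d] Al[of m "s j" x d] dc unfolding c_def real_norm_def by argo
    then show "\<exists>M. \<forall>i\<ge>M. \<forall>j\<ge>M. norm (A m (s i) x - A m (s j) x) < e" by blast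
  qed
  define B where "B m x = lim (\<lambda>j. A m (s j) x)" for m x
  have limB: "(\<lambda>j. A m (s j) x) \<longlonglongrightarrow> B m x" for m x
    using conv[of m x] by (simp add: B_def convergent_LIMSEQ_iff)
  have Bm: "B m \<in> borel_measurable L" for m by (rule borel_measurable_LIMSEQ_real[OF limB Am])
  have L1: "(\<lambda>j. \<integral>x. \<bar>A m (s j) x - B m x\<bar> \<partial>L) \<longlonglongrightarrow> 0" for m
  proof -
    have Bb: "\<bar>B m x\<bar> \<le> W / \<mu> m" for x
      by (rule LIMSEQ_le_const2[OF tendsto_rabs[OF limB]]) (use Ab in auto)
    have "(\<lambda>j. \<integral>x. \<bar>A m (s j) x - B m x\<bar> \<partial>L) \<longlonglongrightarrow> (\<integral>x. 0 \<partial>L)"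
    proof (rule integral_dominated_convergence[where w = "\<lambda>_. W / \<mu> m + W / \<mu> m"])
      show "AE x in L. norm \<bar>A m (s j) x - B m x\<bar> \<le> W / \<mu> m + W / \<mu> m" for j
      proof (rule AE_I2)
        fix x show "norm \<bar>A m (s j) x - B m x\<bar> \<le> W / \<mu> m + W / \<mu> m"
          using Ab[of m "s j" x] Bb[of x] by (simp only: real_norm_def abs_abs)
      qed
      show "AE x in L. (\<lambda>j. \<bar>A m (s j) x - B m x\<bar>) \<longlonglongrightarrow> 0"
        using tendsto_rabs_zero[OF LIM_zero[OF limB[of m]]] by auto
    qed (use Am Bm in auto)
    then show ?thesis by simp
  qed
  have Bi: "integrable L (B m)" for m
  proof (rule integrable_const_bound[OF _ Bm])
    have "\<bar>B m x\<bar> \<le> W / \<mu> m" for x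
      by (rule LIMSEQ_le_const2[OF tendsto_rabs[OF limB]]) (use Ab in auto)
    then show "AE x in L. norm (B m x) \<le> W / \<mu> m" by auto
  qed
  have lp1: "lp L 1 (\<phi> (s j))" for j using \<phi>i by (simp add: lp_def)
  have Cau: "lp_Cauchy L 1 (\<lambda>j. \<phi> (s j))" unfolding lp_Cauchy_def
  proof (intro allI impI)
    fix e :: real assume e0: "e > 0"
    \<comment> \<open>The scale is fixed before the indices: the error of averaging is uniform in
      \<open>j\<close>, and convergence of the averages is then needed at this single scale.\<close>
    obtain m where m: "\<epsilon> m * G < e / 4"
    proof -
      have "(\<lambda>m. \<epsilon> m * G) \<longlonglongrightarrow> 0 * G" unfolding \<epsilon>_def using LIMSEQ_Suc[OF lim_1_over_n] by (intro tendsto_intros)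
      then have "\<forall>\<^sub>F m in sequentially. \<epsilon> m * G < e / 4" using e0 by (intro order_tendstoD(2)) auto
      then show ?thesis using that by (auto simp: eventually_sequentially)
    qed
    have "\<forall>\<^sub>F j in sequentially. (\<integral>x. \<bar>A m (s j) x - B m x\<bar> \<partial>L) < e / 4" using L1[of m] e0 by (intro order_tendstoD(2)) auto
    then obtain N where N: "\<And>j. j \<ge> N \<Longrightarrow> (\<integral>x. \<bar>A m (s j) x - B m x\<bar> \<partial>L) < e / 4" by (auto simp: eventually_sequentially)
    have near: "(\<integral>x. \<bar>\<phi> (s j) x - B m x\<bar> \<partial>L) < e / 2" if "j \<ge> N" for j
    proof -
      have "(\<integral>x. \<bar>\<phi> (s j) x - B m x\<bar> \<partial>L) \<le> (\<integral>x. \<bar>A m (s j) x - \<phi> (s j) x\<bar> + \<bar>A m (s j) x - B m x\<bar> \<partial>L)"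
        using Ai Bi \<phi>i by (intro integral_mono) auto
      also have "\<dots> = (\<integral>x. \<bar>A m (s j) x - \<phi> (s j) x\<bar> \<partial>L) + (\<integral>x. \<bar>A m (s j) x - B m x\<bar> \<partial>L)"
        using Ai Bi \<phi>i by simp
      finally show ?thesis using close[of m "s j"] N[OF that] m by simp
    qed
    have "(\<integral>x. norm (\<phi> (s i) x - \<phi> (s j) x) powr 1 \<partial>L) < e" if "i \<ge> N" "j \<ge> N" for i j
    proof -
      have "(\<integral>x. norm (\<phi> (s i) x - \<phi> (s j) x) powr 1 \<partial>L) \<le> (\<integral>x. \<bar>\<phi> (s i) x - B m x\<bar> + \<bar>\<phi> (s j) x - B m x\<bar> \<partial>L)"
        using Bi \<phi>i by (intro integral_mono) auto
      also have "\<dots> = (\<integral>x. \<bar>\<phi> (s i) x - B m x\<bar> \<partial>L) + (\<integral>x. \<bar>\<phi> (s j) x - B m x\<bar> \<partial>L)" using Bi \<phi>i by simp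
      finally show ?thesis using near[OF that(1)] near[OF that(2)] by simp
    qed
    then show "\<exists>N. \<forall>i\<ge>N. \<forall>j\<ge>N. (\<integral>x. norm (\<phi> (s i) x - \<phi> (s j) x) powr 1 \<partial>L) < e" by blast
  qed
  obtain v t where v: "lp L 1 v" "lp_tendsto L 1 (\<lambda>j. \<phi> (s j)) v" "strict_mono (t :: nat \<Rightarrow> nat)"
    "AE x in L. (\<lambda>n. \<phi> (s (t n)) x) \<longlonglongrightarrow> v x"
    by (rule lp_complete[OF lp1 Cau zero_less_one])
  show ?thesis
    by (rule that[of "s \<circ> t" v]) (use v s(1) in \<open>auto simp: lp_def strict_mono_o\<close>)
qed

end

context sobolev_domain
begin

text \<open>Each \<open>u j\<close> is replaced by a test function that is close in function and
  gradient. The energy bound and the Sobolev inequality bound the \<open>L^1\<close> norms of these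
  on the bounded domain. The replacement errors tend to 0 in \<open>L^p\<close>, so a further
  subsequence returns the almost everywhere limit to \<open>u\<close>.\<close>

lemma rellich:
  assumes n: "DIM('a) \<ge> 2" "p < real DIM('a)"
    and s: "\<And>j. sob (u j) (g j)" and B: "\<And>j. (\<integral>x. norm (g j x) powr p \<partial>L) \<le> B"
  obtains v s where "strict_mono (s :: nat \<Rightarrow> nat)" "v \<in> borel_measurable L" "AE x in L. (\<lambda>j. u (s j) x) \<longlonglongrightarrow> v x"
proof -
  define ps where "ps = crit_exp TYPE('a) p"
  obtain C where C: "C > 0" "\<And>u g. sob u g \<Longrightarrow> lp L ps u"
    "\<And>u g. sob u g \<Longrightarrow> (\<integral>x. \<bar>u x\<bar> powr ps \<partial>L) \<le> C * (\<integral>x. norm (g x) powr p \<partial>L) powr (ps / p)"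
    using sob_sobolev[OF n] unfolding ps_def by metis
  have p0: "p > 0" "p \<ge> 0" using p1 by auto
  have ps1: "ps > 1"
  proof -
    have "real DIM('a) * 1 < real DIM('a) * p" using p1 n by (intro mult_strict_left_mono) auto
    then have "real DIM('a) - p < real DIM('a) * p" using p0 by linarith
    then show ?thesis using p0 n by (simp add: ps_def crit_exp_def less_divide_eq)
  qed
  have "\<exists>\<phi>\<in>T. (\<integral>x. norm (\<phi> x - u j x) powr p \<partial>L) < 1 / Suc j \<and> (\<integral>x. norm (grad \<phi> x - g j x) powr p \<partial>L) < 1 / Suc j" for j
  proof -
    obtain \<phi> where \<phi>: "\<And>k. \<phi> k \<in> T" "lp_tendsto L p \<phi> (u j)" "lp_tendsto L p (\<lambda>n. grad (\<phi> n)) (g j)"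
      using sob_approx[OF s[of j]] by metis
    have "\<forall>\<^sub>F k in sequentially. (\<integral>x. norm (\<phi> k x - u j x) powr p \<partial>L) < 1 / Suc j"
      "\<forall>\<^sub>F k in sequentially. (\<integral>x. norm (grad (\<phi> k) x - g j x) powr p \<partial>L) < 1 / Suc j"
      using \<phi>(2,3) unfolding lp_tendsto_def by (auto intro!: order_tendstoD(2)[where y = 0])
    then have "\<forall>\<^sub>F k in sequentially. (\<integral>x. norm (\<phi> k x - u j x) powr p \<partial>L) < 1 / Suc j \<and> (\<integral>x. norm (grad (\<phi> k) x - g j x) powr p \<partial>L) < 1 / Suc j"
      by (rule eventually_conj)
    then show ?thesis using \<phi>(1) unfolding eventually_sequentially by blast
  qed
  then have "\<forall>j. \<exists>\<phi>. \<phi> \<in> T \<and> (\<integral>x. norm (\<phi> x - u j x) powr p \<partial>L) < 1 / Suc j \<and> (\<integral>x. norm (grad \<phi> x - g j x) powr p \<partial>L) < 1 / Suc j"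
    by blast
  from choice[OF this] obtain \<phi> where "\<forall>j. \<phi> j \<in> T \<and> (\<integral>x. norm (\<phi> j x - u j x) powr p \<partial>L) < 1 / Suc j \<and>
    (\<integral>x. norm (grad (\<phi> j) x - g j x) powr p \<partial>L) < 1 / Suc j" by (elim exE)
  then have \<phi>: "\<phi> j \<in> T" "(\<integral>x. norm (\<phi> j x - u j x) powr p \<partial>L) < 1 / Suc j"
    "(\<integral>x. norm (grad (\<phi> j) x - g j x) powr p \<partial>L) < 1 / Suc j" for j by simp_all
  note l\<phi> = test_lp[OF \<phi>(1) p0(1)]
  have YB: "(\<integral>x. norm (grad (\<phi> j) x) powr p \<partial>L) \<le> 2 powr p * (1 + B)" for j
  proof -
    note i = lp_integrable[OF lp_diff[OF l\<phi>(2)[of j] sob_lp(2)[OF s[of j]] p0(2)]] lp_integrable[OF sob_lp(2)[OF s[of j]]]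
    have "norm (grad (\<phi> j) x) powr p \<le> 2 powr p * (norm (grad (\<phi> j) x - g j x) powr p + norm (g j x) powr p)" for x
      using norm_add_powr_le[OF p0(2), of "grad (\<phi> j) x - g j x" "g j x"] by simp
    then have "(\<integral>x. norm (grad (\<phi> j) x) powr p \<partial>L) \<le> (\<integral>x. 2 powr p * (norm (grad (\<phi> j) x - g j x) powr p + norm (g j x) powr p) \<partial>L)"
      using i lp_integrable[OF l\<phi>(2)[of j]] by (intro integral_mono) auto
    also have "\<dots> = 2 powr p * ((\<integral>x. norm (grad (\<phi> j) x - g j x) powr p \<partial>L) + (\<integral>x. norm (g j x) powr p \<partial>L))" using i by simp
    also have "\<dots> \<le> 2 powr p * (1 + B)"
    proof (intro mult_left_mono add_mono B)
      have "1 / real (Suc j) \<le> 1" by simp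
      then show "(\<integral>x. norm (grad (\<phi> j) x - g j x) powr p \<partial>L) \<le> 1" using \<phi>(3)[of j] by linarith
    qed simp
    finally show ?thesis .
  qed
  have L1: "(\<integral>x. norm (f x) \<partial>lborel) \<le> measure L (space L) + Y"
    if "lp L r f" "(\<integral>x. norm (f x) powr r \<partial>L) \<le> Y" "r > 1" "(\<integral>x. norm (f x) powr 1 \<partial>L) = (\<integral>x. norm (f x) powr 1 \<partial>lborel)"
    for f :: "'a \<Rightarrow> 'b::euclidean_space" and r Y
  proof -
    have "norm (f x) \<le> 1 + norm (f x) powr r" for x
    proof (cases "norm (f x) \<le> 1")
      case False
      then have "norm (f x) powr 1 \<le> norm (f x) powr r" using that(3) by (intro powr_mono) auto
      then show ?thesis using False by (simp add: abs_if split: if_splits)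
    qed (auto intro: add_increasing2)
    then have "(\<integral>x. norm (f x) \<partial>L) \<le> (\<integral>x. 1 + norm (f x) powr r \<partial>L)"
      using lp_integrable[OF that(1)] by (intro integral_mono') auto
    also have "\<dots> \<le> measure L (space L) + Y" using lp_integrable[OF that(1)] that(2) by simp
    finally show ?thesis using that(4) by simp
  qed
  obtain v t where t: "strict_mono (t :: nat \<Rightarrow> nat)" "v \<in> borel_measurable L" "AE x in L. (\<lambda>j. \<phi> (t j) x) \<longlonglongrightarrow> v x"
  proof (rule rellich_test[OF \<phi>(1)])
    show "(\<integral>x. norm (grad (\<phi> j) x) \<partial>lborel) \<le> measure L (space L) + 2 powr p * (1 + B)" for j
      by (rule L1[OF l\<phi>(2) YB p1]) (use test_lp(4)[OF \<phi>(1), of 1 j] in simp)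
    show "(\<integral>x. \<bar>\<phi> j x\<bar> \<partial>lborel) \<le> measure L (space L) + C * (2 powr p * (1 + B)) powr (ps / p)" for j
    proof -
      have "(\<integral>x. \<bar>\<phi> j x\<bar> powr ps \<partial>L) \<le> C * (\<integral>x. norm (grad (\<phi> j) x) powr p \<partial>L) powr (ps / p)"
        by (rule C(3)[OF sob_test[OF \<phi>(1)]])
      also have "\<dots> \<le> C * (2 powr p * (1 + B)) powr (ps / p)"
        using C(1) ps1 p0 by (intro mult_left_mono powr_mono2 YB) auto
      finally show ?thesis
        using L1[OF C(2)[OF sob_test[OF \<phi>(1)[of j]]] _ ps1] test_lp(3)[OF \<phi>(1), of 1 j] by simp
    qed
  qed
  have lz: "lp L p (\<lambda>_. 0 :: real)" by (simp add: lp_def)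
  have inv: "(\<lambda>n. 1 / real (Suc n)) \<longlonglongrightarrow> 0" using LIMSEQ_Suc[OF lim_1_over_n] by simp
  have "lp_tendsto L p (\<lambda>j x. \<phi> j x - u j x) (\<lambda>_. 0)"
    unfolding lp_tendsto_def diff_zero
    by (rule tendsto_sandwich[OF _ _ tendsto_const inv])
      (use less_imp_le[OF \<phi>(2)] in \<open>auto intro!: always_eventually\<close>)
  from lp_tendsto_AE_subseq[OF lp_tendsto_subseq[OF this t(1)] lp_diff[OF l\<phi>(1) sob_lp(1)[OF s] p0(2)] lz p0(1)]
  obtain r where r: "strict_mono r" "AE x in L. (\<lambda>n. \<phi> (t (r n)) x - u (t (r n)) x) \<longlonglongrightarrow> 0" by blast
  have "AE x in L. (\<lambda>n. u (t (r n)) x) \<longlonglongrightarrow> v x" using r(2) t(3)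
  proof eventually_elim
    case (elim x)
    have "(\<lambda>n. \<phi> (t (r n)) x) \<longlonglongrightarrow> v x" using LIMSEQ_subseq_LIMSEQ[OF elim(2) r(1)] by (simp add: o_def)
    from tendsto_diff[OF this elim(1)] show ?case by simp
  qed
  then show ?thesis by (intro that[of "t \<circ> r" v]) (use t r in \<open>auto simp: strict_mono_o\<close>)
qed

text \<open>
  A substitute for Mazur's lemma: instead of convex combinations of the sequence one minimises the energy
  over midpoint-convex sets of competitors shrinking to the limit, so that no weak compactness is needed.
\<close>

lemma mazur:
  assumes s: "\<And>j. sob (u j) (g j)" and B: "\<And>j. (\<integral>x. norm (g j x) powr p \<partial>L) \<le> B"
    and v: "lp L p v" "lp_tendsto L p u v"
    and Q: "\<And>j. g j \<in> Q" "\<And>f h. f \<in> Q \<Longrightarrow> h \<in> Q \<Longrightarrow> lp L p f \<Longrightarrow> lp L p h \<Longrightarrow> (\<lambda>x. (1/2) *\<^sub>R (f x + h x)) \<in> Q"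
  obtains h k where "sob v h" "\<And>n::nat. k n \<in> Q" "\<And>n. lp L p (k n)" "lp_tendsto L p k h"
proof -
  \<comment> \<open>A competitor is a gradient whose function is close to \<open>v\<close>. The set
    \<open>Q\<close> stands for an additional condition stable under midpoints, to be exploited by
    passing to the limit.\<close>
  define K where "K n = {h. h \<in> Q \<and> (\<exists>w. sob w h \<and> (\<integral>x. norm (w x - v x) powr p \<partial>L) \<le> 1 / Suc n) \<and> (\<integral>x. norm (h x) powr p \<partial>L) \<le> B}" for n
  have p0: "p > 0" "p \<ge> 0" using p1 by auto
  have ne: "K n \<noteq> {}" for n
  proof -
    have "\<forall>\<^sub>F j in sequentially. (\<integral>x. norm (u j x - v x) powr p \<partial>L) < 1 / Suc n"
      using v(2) unfolding lp_tendsto_def by (intro order_tendstoD(2)) auto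
    then obtain j where "(\<integral>x. norm (u j x - v x) powr p \<partial>L) < 1 / Suc n" by (auto simp: eventually_sequentially)
    then have "g j \<in> K n" using s B Q(1) less_imp_le unfolding K_def by blast
    then show ?thesis by blast
  qed
  have dec: "K n \<subseteq> K m" if "m \<le> n" for m n
  proof -
    have "1 / real (Suc n) \<le> 1 / real (Suc m)" using that by (intro divide_left_mono) auto
    then show ?thesis unfolding K_def using order_trans by blast
  qed
  have half: "(\<integral>x. norm ((1/2) *\<^sub>R (f x + h x)) powr p \<partial>L) \<le> c"
    if "lp L p f" "lp L p h" "(\<integral>x. norm (f x) powr p \<partial>L) \<le> c" "(\<integral>x. norm (h x) powr p \<partial>L) \<le> c"
    for f h :: "'a \<Rightarrow> 'b::euclidean_space" and c
  proof -
    note i = lp_integrable[OF that(1)] lp_integrable[OF that(2)]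
    have "(\<integral>x. norm ((1/2) *\<^sub>R (f x + h x)) powr p \<partial>L) \<le> (\<integral>x. (norm (f x) powr p + norm (h x) powr p) / 2 \<partial>L)"
      using i by (intro integral_mono' norm_powr_midpoint[OF p1]) auto
    also have "\<dots> = ((\<integral>x. norm (f x) powr p \<partial>L) + (\<integral>x. norm (h x) powr p \<partial>L)) / 2" using i by simp
    finally show ?thesis using that(3,4) by argo
  qed
  have mid: "(\<lambda>x. (1/2) *\<^sub>R (f x + h x)) \<in> K n" if fh: "f \<in> K n" "h \<in> K n" for n f h
  proof -
    from fh obtain w z where w: "sob w f" "(\<integral>x. norm (w x - v x) powr p \<partial>L) \<le> 1 / Suc n"
      and z: "sob z h" "(\<integral>x. norm (z x - v x) powr p \<partial>L) \<le> 1 / Suc n" unfolding K_def by blast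
    have s': "sob (\<lambda>x. (1/2) * w x + (1/2) * z x) (\<lambda>x. (1/2) *\<^sub>R (f x + h x))"
      using sob_linear[OF w(1) z(1), of "1/2" "1/2"] by (simp add: scaleR_add_right)
    have "(\<integral>x. norm ((1/2) *\<^sub>R ((w x - v x) + (z x - v x))) powr p \<partial>L) \<le> 1 / Suc n"
      by (intro half lp_diff sob_lp(1)[OF w(1)] sob_lp(1)[OF z(1)] v p0 w z)
    also have "(\<lambda>x. norm ((1/2) *\<^sub>R ((w x - v x) + (z x - v x))) powr p) = (\<lambda>x. norm (((1/2) * w x + (1/2) * z x) - v x) powr p)"
      by (rule ext, rule arg_cong[where f = "\<lambda>t. norm t powr p"]) (simp add: field_simps)
    finally have d: "(\<integral>x. norm (((1/2) * w x + (1/2) * z x) - v x) powr p \<partial>L) \<le> 1 / Suc n" .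
    have E: "(\<integral>x. norm ((1/2) *\<^sub>R (f x + h x)) powr p \<partial>L) \<le> B"
      using fh by (intro half sob_lp(2)[OF w(1)] sob_lp(2)[OF z(1)]) (auto simp: K_def)
    have "(\<lambda>x. (1/2) *\<^sub>R (f x + h x)) \<in> Q"
      using fh sob_lp(2)[OF w(1)] sob_lp(2)[OF z(1)] by (intro Q(2)) (auto simp: K_def)
    with s' d E show ?thesis unfolding K_def by blast
  qed
  have lpK: "lp L p f" "(\<integral>x. norm (f x) powr p \<partial>L) \<le> B" if "f \<in> K n" for n f
    using that sob_lp(2) unfolding K_def by blast+
  have "\<exists>k. (\<forall>n. k n \<in> K n) \<and> lp_Cauchy L p k"
  proof (rule minimizing_Cauchy[where K = K and M = L and B = B, OF p1 ne])
    show "K n \<subseteq> K m" if "m \<le> n" for m n by (rule dec[OF that])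
    show "(\<lambda>x. (1/2) *\<^sub>R (f x + h x)) \<in> K n" if "f \<in> K n" "h \<in> K n" for n f h by (rule mid[OF that])
    show "lp L p f" "(\<integral>x. norm (f x) powr p \<partial>L) \<le> B" if "f \<in> K n" for n f by (rule lpK[OF that])+
    show "\<exists>k. (\<forall>n. k n \<in> K n) \<and> lp_Cauchy L p k" if "\<And>n. k n \<in> K n" "lp_Cauchy L p k" for k
      using that by blast
  qed
  then obtain k where k: "\<And>n. k n \<in> K n" "lp_Cauchy L p k" by blast
  then have "\<forall>n. \<exists>w. sob w (k n) \<and> (\<integral>x. norm (w x - v x) powr p \<partial>L) \<le> 1 / Suc n" unfolding K_def by blast
  from choice[OF this] obtain w where "\<forall>n. sob (w n) (k n) \<and> (\<integral>x. norm (w n x - v x) powr p \<partial>L) \<le> 1 / Suc n" by (elim exE)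
  then have w: "sob (w n) (k n)" "(\<integral>x. norm (w n x - v x) powr p \<partial>L) \<le> 1 / Suc n" for n by simp_all
  have lk: "lp L p (k n)" for n by (rule sob_lp(2)[OF w(1)])
  obtain h t where h: "lp L p h" "lp_tendsto L p k h" and "strict_mono (t :: nat \<Rightarrow> nat)" "AE x in L. (\<lambda>n. k (t n) x) \<longlonglongrightarrow> h x"
    by (rule lp_complete[OF lk k(2) p0(1)])
  have inv: "(\<lambda>n. 1 / real (Suc n)) \<longlonglongrightarrow> 0" using LIMSEQ_Suc[OF lim_1_over_n] by simp
  \<comment> \<open>The functions of the minimising gradients tend to \<open>v\<close> by the choice
    of \<open>K n\<close>, and the gradients converge strongly to \<open>h\<close>, so closedness of
    \<open>sob\<close> makes \<open>h\<close> a gradient of \<open>v\<close>.\<close>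
  have "lp_tendsto L p w v" unfolding lp_tendsto_def
    by (rule tendsto_sandwich[OF _ _ tendsto_const inv]) (use w(2) in \<open>auto intro!: always_eventually\<close>)
  then have "sob v h" by (rule sob_closed[OF w(1) v(1) _ h])
  moreover have "k n \<in> Q" for n using k(1) unfolding K_def by blast
  ultimately show ?thesis using lk h(2) that by blast
qed

text \<open>The chain rule for the approximating test functions passes to the limit in two pieces:
  the bounded factor times the error of the gradients is small in \<open>L^p\<close>, and the change
  of the factor in front of the fixed \<open>h\<close> is handled by dominated convergence. The
  latter needs almost everywhere convergence, hence the subsequence.\<close>

lemma sob_arctan:
  assumes "sob w h"
  shows "sob (\<lambda>x. arctan (w x)) (\<lambda>x. inverse (1 + (w x)\<^sup>2) *\<^sub>R h x)"
proof -
  obtain \<phi>0 where \<phi>0: "\<And>n. \<phi>0 n \<in> T" "lp_tendsto L p \<phi>0 w" "lp_tendsto L p (\<lambda>n. grad (\<phi>0 n)) h"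
    "\<And>n. lp L p (\<phi>0 n)" "\<And>n. lp L p (grad (\<phi>0 n))" using sob_approx[OF assms] by metis
  have p0: "p > 0" "p \<ge> 0" using p1 by auto
  note lps = sob_lp[OF assms]
  obtain t where t: "strict_mono t" "AE x in L. (\<lambda>n. \<phi>0 (t n) x) \<longlonglongrightarrow> w x"
    using lp_tendsto_AE_subseq[OF \<phi>0(2,4) lps(1) p0(1)] by blast
  define \<phi> where "\<phi> n = \<phi>0 (t n)" for n
  have \<phi>: "\<And>n. \<phi> n \<in> T" "lp_tendsto L p \<phi> w" "lp_tendsto L p (\<lambda>n. grad (\<phi> n)) h"
    "\<And>n. lp L p (\<phi> n)" "\<And>n. lp L p (grad (\<phi> n))" "AE x in L. (\<lambda>n. \<phi> n x) \<longlonglongrightarrow> w x"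
    using \<phi>0 t lp_tendsto_subseq[OF \<phi>0(2) t(1)] lp_tendsto_subseq[OF \<phi>0(3) t(1)] by (auto simp: \<phi>_def[abs_def])
  define d where "d y = inverse (1 + y\<^sup>2)" for y :: real
  have db: "0 \<le> d y" "\<bar>d y\<bar> \<le> 1" for y
  proof -
    have "1 + y\<^sup>2 > 0" by (simp add: add_pos_nonneg)
    then show "0 \<le> d y" by (simp add: d_def)
    then show "\<bar>d y\<bar> \<le> 1" using \<open>1 + y\<^sup>2 > 0\<close> by (simp add: d_def inverse_le_1_iff)
  qed
  have dc: "continuous_on UNIV d" unfolding d_def
    by (intro continuous_intros) (metis add.commute less_irrefl sum_power2_gt_zero_iff one_power2 zero_neq_one)
  have [measurable]: "d \<in> borel_measurable borel" using dc by (rule borel_measurable_continuous_onI)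
  have [measurable]: "w \<in> borel_measurable L" "h \<in> borel_measurable L" "\<phi> n \<in> borel_measurable L" for n
    using lps \<phi>(4) by (auto simp: lp_def)
  have ga: "grad (\<lambda>x. arctan (\<phi> n x)) x = d (\<phi> n x) *\<^sub>R grad (\<phi> n) x" for n x
  proof (rule grad_unique)
    obtain K where K: "C1c K (\<phi> n) (grad (\<phi> n))" using test_functions_C1c[OF \<phi>(1)] by blast
    have "(arctan has_derivative (\<lambda>y. d (\<phi> n x) * y)) (at (\<phi> n x))"
      using DERIV_arctan[of "\<phi> n x"] by (simp add: has_field_derivative_def d_def)
    from has_derivative_compose[OF C1c_facts(2)[OF K] this]
    show "((\<lambda>x. arctan (\<phi> n x)) has_derivative (\<lambda>ha. (d (\<phi> n x) *\<^sub>R grad (\<phi> n) x) \<bullet> ha)) (at x)" by simp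
  qed
  have lip: "\<bar>arctan a - arctan b\<bar> \<le> \<bar>a - b\<bar>" for a b
  proof -
    have "norm (arctan a - arctan b) \<le> 1 * norm (a - b)"
    proof (rule field_differentiable_bound[of UNIV arctan "\<lambda>y. inverse (1 + y\<^sup>2)"])
      show "norm (inverse (1 + y\<^sup>2)) \<le> 1" for y :: real using db(2)[of y] by (simp add: d_def)
    qed (auto intro: DERIV_arctan)
    then show ?thesis by simp
  qed
  have ta: "(\<lambda>x. arctan (\<phi> n x)) \<in> T" for n by (rule test_functions_arctan[OF \<phi>(1)])
  have la: "lp L p (\<lambda>x. arctan (w x))"
    using lip[of "w _" 0] by (intro lp_dom[OF lps(1)]) (auto simp: p0 intro!: AE_I2)
  have lh: "lp L p (\<lambda>x. d (w x) *\<^sub>R h x)" by (rule lp_mult_bounded[OF lps(2) _ _ p0(2)]) (use db in auto)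
  have t1: "lp_tendsto L p (\<lambda>n x. arctan (\<phi> n x)) (\<lambda>x. arctan (w x))"
    by (rule lp_tendsto_squeeze[OF \<phi>(2)[unfolded lp_tendsto_def]])
      (use lip p0 lp_integrable[OF lp_diff[OF \<phi>(4) lps(1) p0(2)]] in \<open>auto intro!: powr_mono2\<close>)
  have lhd: "lp L p (\<lambda>x. d (\<phi> n x) *\<^sub>R h x)" for n by (rule lp_mult_bounded[OF lps(2) _ _ p0(2)]) (use db in auto)
  have lgd: "lp L p (\<lambda>x. d (\<phi> n x) *\<^sub>R grad (\<phi> n) x)" for n by (rule lp_mult_bounded[OF \<phi>(5) _ _ p0(2)]) (use db in auto)
  have t2: "lp_tendsto L p (\<lambda>n x. d (\<phi> n x) *\<^sub>R h x) (\<lambda>x. d (w x) *\<^sub>R h x)"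
  proof -
    have "(\<lambda>n. \<integral>x. norm (d (\<phi> n x) *\<^sub>R h x - d (w x) *\<^sub>R h x) powr p \<partial>L) \<longlonglongrightarrow> (\<integral>x. 0 \<partial>L)"
    proof (rule integral_dominated_convergence[where w = "\<lambda>x. norm (h x) powr p"])
      show "integrable L (\<lambda>x. norm (h x) powr p)" by (rule lp_integrable[OF lps(2)])
      show "AE x in L. (\<lambda>n. norm (d (\<phi> n x) *\<^sub>R h x - d (w x) *\<^sub>R h x) powr p) \<longlonglongrightarrow> 0" using \<phi>(6)
      proof eventually_elim
        case (elim x)
        have "(\<lambda>n. d (\<phi> n x)) \<longlonglongrightarrow> d (w x)" using continuous_on_tendsto_compose[OF dc elim] by simp
        then have "(\<lambda>n. norm (d (\<phi> n x) *\<^sub>R h x - d (w x) *\<^sub>R h x) powr p) \<longlonglongrightarrow> norm (d (w x) *\<^sub>R h x - d (w x) *\<^sub>R h x) powr p"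
          using p0 by (intro tendsto_powr2 tendsto_intros) auto
        then show ?case by simp
      qed
      show "AE x in L. norm (norm (d (\<phi> n x) *\<^sub>R h x - d (w x) *\<^sub>R h x) powr p) \<le> norm (h x) powr p" for n
      proof (rule AE_I2)
        fix x
        have "\<bar>d (\<phi> n x) - d (w x)\<bar> \<le> 1" using db[of "\<phi> n x"] db[of "w x"] by linarith
        then have "norm (d (\<phi> n x) *\<^sub>R h x - d (w x) *\<^sub>R h x) \<le> norm (h x)"
          by (simp add: scaleR_diff_left[symmetric] mult_left_le_one_le)
        then show "norm (norm (d (\<phi> n x) *\<^sub>R h x - d (w x) *\<^sub>R h x) powr p) \<le> norm (h x) powr p"
          using p0 by (simp add: powr_mono2)
      qed
    qed measurable
    then show ?thesis by (simp add: lp_tendsto_def)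
  qed
  have t3: "lp_tendsto L p (\<lambda>n x. d (\<phi> n x) *\<^sub>R grad (\<phi> n) x - d (\<phi> n x) *\<^sub>R h x) (\<lambda>_. 0)"
  proof (rule lp_tendsto_squeeze[OF \<phi>(3)[unfolded lp_tendsto_def]])
    show "AE x in L. norm (d (\<phi> n x) *\<^sub>R grad (\<phi> n) x - d (\<phi> n x) *\<^sub>R h x - 0) powr p \<le> norm (grad (\<phi> n) x - h x) powr p" for n
      using db p0 by (auto simp: scaleR_diff_right[symmetric] intro!: AE_I2 powr_mono2 mult_left_le_one_le)
  qed (rule lp_integrable[OF lp_diff[OF \<phi>(5) lps(2) p0(2)]])
  have lz: "lp L p (\<lambda>_. 0 :: 'a)" by (simp add: lp_def)
  have "lp_tendsto L p (\<lambda>n x. (d (\<phi> n x) *\<^sub>R grad (\<phi> n) x - d (\<phi> n x) *\<^sub>R h x) + d (\<phi> n x) *\<^sub>R h x) (\<lambda>x. 0 + d (w x) *\<^sub>R h x)"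
    by (rule lp_tendsto_add[OF t3 t2 lp_diff[OF lgd lhd p0(2)] lhd lz lh p0(2)])
  then have t4: "lp_tendsto L p (\<lambda>n x. d (\<phi> n x) *\<^sub>R grad (\<phi> n) x) (\<lambda>x. d (w x) *\<^sub>R h x)" by simp
  have geq: "(\<lambda>n. grad (\<lambda>x. arctan (\<phi> n x))) = (\<lambda>n x. d (\<phi> n x) *\<^sub>R grad (\<phi> n) x)" by (intro ext ga)
  have "sob (\<lambda>x. arctan (w x)) (\<lambda>x. d (w x) *\<^sub>R h x)" unfolding sob_def
    by (intro conjI exI[of _ "\<lambda>n x. arctan (\<phi> n x)"] allI la lh ta t1) (unfold geq, rule t4)
  then show ?thesis by (simp add: d_def)
qed

text \<open>The homogeneous estimate gives a Young inequality with a free \<open>\<epsilon>\<close>,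
  which takes the place of the Hoelder inequality and the conjugate exponent: pairing with the flux
  of \<open>U\<close> is a continuous functional on \<open>L^p\<close>.\<close>

lemma dual_pow_pairing:
  fixes U :: "'a \<Rightarrow> 'b::euclidean_space"
  assumes U: "lp L p U"
  shows "lp L p h \<Longrightarrow> integrable L (\<lambda>x. dual_pow p (U x) \<bullet> h x)"
    and "(\<And>n. lp L p (k n)) \<Longrightarrow> lp L p h \<Longrightarrow> lp_tendsto L p k h \<Longrightarrow>
      (\<lambda>n. \<integral>x. dual_pow p (U x) \<bullet> k n x \<partial>L) \<longlonglongrightarrow> (\<integral>x. dual_pow p (U x) \<bullet> h x \<partial>L)"
proof -
  have p0: "p > 0" "p \<ge> 0" using p1 by auto
  have young: "\<exists>C\<ge>0. \<forall>v u :: 'b. \<bar>dual_pow p v \<bullet> u\<bar> \<le> \<epsilon> * norm v powr p + C * norm u powr p" if "\<epsilon> > 0" for \<epsilon>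
    by (rule brezis_lieb_pointwise[OF _ _ _ p0(1) that])
      (auto intro!: continuous_intros continuous_dual_pow_compose[OF p1] simp: dual_pow_pair_scale simp del: inner_scaleR_right)
  have [measurable]: "(dual_pow p :: 'b \<Rightarrow> 'b) \<in> borel_measurable borel"
    by (intro borel_measurable_continuous_onI continuous_dual_pow p1)
  have [measurable]: "U \<in> borel_measurable L" using U by (simp add: lp_def)
  have int: "integrable L (\<lambda>x. dual_pow p (U x) \<bullet> h x)" if h: "lp L p h" for h
  proof -
    have [measurable]: "h \<in> borel_measurable L" using h by (simp add: lp_def)
    obtain C where C: "C \<ge> 0" "\<And>v u :: 'b. \<bar>dual_pow p v \<bullet> u\<bar> \<le> 1 * norm v powr p + C * norm u powr p"
      using young[of 1] by auto
    have i: "integrable L (\<lambda>x. 1 * norm (U x) powr p + C * norm (h x) powr p)"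
      using lp_integrable[OF U] lp_integrable[OF h] by auto
    show ?thesis
    proof (rule Bochner_Integration.integrable_bound[OF i])
      show "AE x in L. norm (dual_pow p (U x) \<bullet> h x) \<le> norm (1 * norm (U x) powr p + C * norm (h x) powr p)"
      proof (rule AE_I2)
        fix x
        show "norm (dual_pow p (U x) \<bullet> h x) \<le> norm (1 * norm (U x) powr p + C * norm (h x) powr p)"
          unfolding real_norm_def by (rule order_trans[OF C(2) abs_ge_self])
      qed
    qed measurable
  qed
  show "lp L p h \<Longrightarrow> integrable L (\<lambda>x. dual_pow p (U x) \<bullet> h x)" by (rule int)
  assume k: "\<And>n. lp L p (k n)" and h: "lp L p h" and kh: "lp_tendsto L p k h"
  note lkh = lp_diff[OF k h p0(2)]
  show "(\<lambda>n. \<integral>x. dual_pow p (U x) \<bullet> k n x \<partial>L) \<longlonglongrightarrow> (\<integral>x. dual_pow p (U x) \<bullet> h x \<partial>L)"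
  proof (rule LIM_zero_cancel, rule LIMSEQ_I)
    fix e :: real assume e: "e > 0"
    define Y where "Y = (\<integral>x. norm (U x) powr p \<partial>L)"
    have Y0: "Y \<ge> 0" by (simp add: Y_def)
    define \<epsilon> where "\<epsilon> = e / (2 * (Y + 1))"
    have \<epsilon>: "\<epsilon> > 0" using e Y0 by (simp add: \<epsilon>_def)
    have \<epsilon>Y: "\<epsilon> * Y < e" using e Y0 by (auto simp: \<epsilon>_def field_simps intro!: add_nonneg_pos)
    obtain C where C: "C \<ge> 0" "\<And>v u :: 'b. \<bar>dual_pow p v \<bullet> u\<bar> \<le> \<epsilon> * norm v powr p + C * norm u powr p"
      using young[OF \<epsilon>] by auto
    have le: "norm ((\<integral>x. dual_pow p (U x) \<bullet> k n x \<partial>L) - (\<integral>x. dual_pow p (U x) \<bullet> h x \<partial>L)) \<le> \<epsilon> * Y + C * (\<integral>x. norm (k n x - h x) powr p \<partial>L)" for n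
    proof -
      have "(\<integral>x. dual_pow p (U x) \<bullet> k n x \<partial>L) - (\<integral>x. dual_pow p (U x) \<bullet> h x \<partial>L) = (\<integral>x. dual_pow p (U x) \<bullet> (k n x - h x) \<partial>L)"
        using int[OF k] int[OF h] by (simp add: inner_diff_right)
      also have "norm \<dots> \<le> (\<integral>x. \<bar>dual_pow p (U x) \<bullet> (k n x - h x)\<bar> \<partial>L)" unfolding real_norm_def by (rule integral_abs_bound)
      also have "\<dots> \<le> (\<integral>x. \<epsilon> * norm (U x) powr p + C * norm (k n x - h x) powr p \<partial>L)"
        using int[OF lkh] C(2) lp_integrable[OF U] lp_integrable[OF lkh] by (intro integral_mono) auto
      also have "\<dots> = \<epsilon> * Y + C * (\<integral>x. norm (k n x - h x) powr p \<partial>L)"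
        using lp_integrable[OF U] lp_integrable[OF lkh] by (simp add: Y_def)
      finally show ?thesis .
    qed
    have "(\<lambda>n. \<epsilon> * Y + C * (\<integral>x. norm (k n x - h x) powr p \<partial>L)) \<longlonglongrightarrow> \<epsilon> * Y + C * 0"
      using kh unfolding lp_tendsto_def by (intro tendsto_intros)
    then have "\<forall>\<^sub>F n in sequentially. \<epsilon> * Y + C * (\<integral>x. norm (k n x - h x) powr p \<partial>L) < e"
      using \<epsilon>Y by (intro order_tendstoD(2)) auto
    then obtain N where N: "\<And>n. n \<ge> N \<Longrightarrow> \<epsilon> * Y + C * (\<integral>x. norm (k n x - h x) powr p \<partial>L) < e" by (auto simp: eventually_sequentially)
    show "\<exists>N. \<forall>n\<ge>N. norm ((\<integral>x. dual_pow p (U x) \<bullet> k n x \<partial>L) - (\<integral>x. dual_pow p (U x) \<bullet> h x \<partial>L) - 0) < e"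
    proof (intro exI[of _ N] allI impI)
      fix n assume "n \<ge> N"
      from le_less_trans[OF le N[OF this]]
      show "norm ((\<integral>x. dual_pow p (U x) \<bullet> k n x \<partial>L) - (\<integral>x. dual_pow p (U x) \<bullet> h x \<partial>L) - 0) < e" by simp
    qed
  qed
qed

text \<open>Otherwise, after changes of sign, gradients with arbitrarily late indices lie in the
  half space where the pairing is at least \<open>\<delta>\<close>. This half space is stable under
  midpoints, so \<open>mazur\<close> yields a gradient of the zero function whose pairing is still
  at least \<open>\<delta>\<close>.\<close>

lemma weak_convergence:
  assumes s: "\<And>j. sob (w j) (g j)" and B: "\<And>j. (\<integral>x. norm (g j x) powr p \<partial>L) \<le> B"
    and w0: "lp_tendsto L p w (\<lambda>_. 0)" and U: "lp L p U"
  shows "(\<lambda>j. \<integral>x. dual_pow p (U x) \<bullet> g j x \<partial>L) \<longlonglongrightarrow> 0"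
proof (rule ccontr)
  have p0: "p > 0" "p \<ge> 0" using p1 by auto
  define l where "l h = (\<integral>x. dual_pow p (U x) \<bullet> h x \<partial>L)" for h
  assume "\<not> ?thesis"
  then obtain \<delta> where \<delta>: "\<delta> > 0" "\<forall>N. \<exists>j\<ge>N. \<bar>l (g j)\<bar> \<ge> \<delta>"
    unfolding LIMSEQ_iff l_def by (auto simp: not_less)
  \<comment> \<open>These indices form no strictly increasing sequence in general;
    \<open>r N \<ge> N\<close> is enough for the selected functions to tend to 0.\<close>
  define r where "r N = (SOME j. j \<ge> N \<and> \<bar>l (g j)\<bar> \<ge> \<delta>)" for N
  have r: "r N \<ge> N" "\<bar>l (g (r N))\<bar> \<ge> \<delta>" for N
    using someI_ex[OF \<delta>(2)[rule_format, of N, unfolded Bex_def]] unfolding r_def by auto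
  define \<sigma> where "\<sigma> N = sgn (l (g (r N)))" for N
  have \<sigma>: "\<bar>\<sigma> N\<bar> = 1" for N using r(2)[of N] \<delta>(1) by (auto simp: \<sigma>_def sgn_if)
  have ls: "l (\<lambda>x. c *\<^sub>R h x) = c * l h" for c h by (simp add: l_def)
  have s': "sob (\<lambda>x. \<sigma> N * w (r N) x) (\<lambda>x. \<sigma> N *\<^sub>R g (r N) x)" for N by (rule sob_scale[OF s])
  have B': "(\<integral>x. norm (\<sigma> N *\<^sub>R g (r N) x) powr p \<partial>L) \<le> B" for N using B by (simp add: \<sigma>)
  have lz: "lp L p (\<lambda>_. 0 :: real)" by (simp add: lp_def)
  have rlim: "filterlim r at_top sequentially"
    using r(1) by (intro filterlim_at_top_mono[OF filterlim_ident]) auto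
  have w0': "lp_tendsto L p (\<lambda>N x. \<sigma> N * w (r N) x) (\<lambda>_. 0)"
    using filterlim_compose[OF w0[unfolded lp_tendsto_def] rlim] by (simp add: lp_tendsto_def abs_mult \<sigma>)
  define Q where "Q = {h. lp L p h \<and> l h \<ge> \<delta>}"
  obtain h k where hk: "sob (\<lambda>_. 0) h" "\<And>n::nat. k n \<in> Q" "\<And>n. lp L p (k n)" "lp_tendsto L p k h"
  proof (rule mazur[OF s' B' lz w0', where Q = Q])
    show "(\<lambda>x. \<sigma> N *\<^sub>R g (r N) x) \<in> Q" for N
    proof -
      have "l (\<lambda>x. \<sigma> N *\<^sub>R g (r N) x) = \<bar>l (g (r N))\<bar>" unfolding ls \<sigma>_def by (simp add: sgn_if)
      then show ?thesis using r(2)[of N] sob_lp(2)[OF s'[of N]] by (simp add: Q_def)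
    qed
    show "(\<lambda>x. (1/2) *\<^sub>R (f x + h x)) \<in> Q" if fh: "f \<in> Q" "h \<in> Q" for f h
    proof -
      have lpfh: "lp L p f" "lp L p h" using fh by (auto simp: Q_def)
      have "l (\<lambda>x. (1/2) *\<^sub>R (f x + h x)) = (1/2) * (l f + l h)"
        unfolding ls using dual_pow_pairing(1)[OF U lpfh(1)] dual_pow_pairing(1)[OF U lpfh(2)] by (simp add: l_def inner_add_right)
      then show ?thesis using fh lpfh by (auto simp: Q_def intro!: lp_scaleR lp_add p0)
    qed
  qed (rule that, assumption+)
  \<comment> \<open>The zero function is 0 times itself, so uniqueness identifies its gradient
    \<open>h\<close> with 0 times \<open>h\<close>.\<close>
  have "AE x in L. h x = 0 *\<^sub>R h x" using sob_unique[OF hk(1) sob_scale[OF hk(1), of 0]] by simp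
  then have "AE x in L. h x = 0" by simp
  then have "l h = (\<integral>x. 0 \<partial>L)" unfolding l_def
    using borel_measurable_integrable[OF dual_pow_pairing(1)[OF U sob_lp(2)[OF hk(1)]]]
    by (intro integral_cong_AE) (auto elim: eventually_mono)
  moreover have "\<delta> \<le> l h"
    using dual_pow_pairing(2)[OF U hk(3) sob_lp(2)[OF hk(1)] hk(4)] hk(2)
    by (intro LIMSEQ_le_const[where X = "\<lambda>n. l (k n)"]) (auto simp: l_def Q_def)
  ultimately show False using \<delta>(1) by simp
qed

end

section \<open>Brezis-Lieb splitting and the Palais-Smale condition\<close>

text \<open>\<open>\<Phi>\<close> is a remainder that vanishes as soon as one argument does.
  Vanishing at \<open>u = 0\<close> puts the small factor on the bounded sequence and the large one
  on the fixed integrable \<open>U\<close>; vanishing at \<open>v = 0\<close> provides the pointwise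
  limit.\<close>

lemma brezis_lieb:
  fixes \<Phi> :: "'b::euclidean_space \<Rightarrow> 'b \<Rightarrow> real" and V :: "nat \<Rightarrow> 'a \<Rightarrow> 'b"
  assumes r: "r > 0" and c: "continuous_on UNIV (\<lambda>z. \<Phi> (fst z) (snd z))"
    and hom: "\<And>c a b. c > 0 \<Longrightarrow> \<Phi> (c *\<^sub>R a) (c *\<^sub>R b) = c powr r * \<Phi> a b"
    and zero: "\<And>a. \<Phi> a 0 = 0" "\<And>b. \<Phi> 0 b = 0"
    and V: "\<And>j. lp M r (V j)" "\<And>j. (\<integral>x. norm (V j x) powr r \<partial>M) \<le> K"
    and lim: "AE x in M. (\<lambda>j. V j x) \<longlonglongrightarrow> 0" and U: "lp M r U"
  shows "\<And>j. integrable M (\<lambda>x. \<Phi> (V j x) (U x))" "(\<lambda>j. \<integral>x. \<Phi> (V j x) (U x) \<partial>M) \<longlonglongrightarrow> 0"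
proof -
  have [measurable]: "V j \<in> borel_measurable M" "U \<in> borel_measurable M" for j using V U by (auto simp: lp_def)
  have "(\<lambda>z. \<Phi> (fst z) (snd z)) \<in> borel_measurable borel" by (rule borel_measurable_continuous_onI[OF c])
  then have meas: "(\<lambda>x. \<Phi> (V j x) (U x)) \<in> borel_measurable M" for j
    using measurable_compose[of "\<lambda>x. (V j x, U x)" M borel "\<lambda>z. \<Phi> (fst z) (snd z)" borel] by simp
  have bd: "\<exists>C\<ge>0. \<forall>v u. \<bar>\<Phi> v u\<bar> \<le> \<epsilon> * norm v powr r + C * norm u powr r" if "\<epsilon> > 0" for \<epsilon>
    by (rule brezis_lieb_pointwise[OF c _ zero(1) r that]) (rule hom)
  show "integrable M (\<lambda>x. \<Phi> (V j x) (U x))" for j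
  proof -
    obtain C where C: "C \<ge> 0" "\<And>v u. \<bar>\<Phi> v u\<bar> \<le> 1 * norm v powr r + C * norm u powr r" using bd[of 1] by auto
    have i: "integrable M (\<lambda>x. 1 * norm (V j x) powr r + C * norm (U x) powr r)"
      using lp_integrable[OF V(1)] lp_integrable[OF U] by auto
    show ?thesis
    proof (rule Bochner_Integration.integrable_bound[OF i meas], rule AE_I2)
      fix x show "norm (\<Phi> (V j x) (U x)) \<le> norm (1 * norm (V j x) powr r + C * norm (U x) powr r)"
        unfolding real_norm_def by (rule order_trans[OF C(2) abs_ge_self])
    qed
  qed
  show "(\<lambda>j. \<integral>x. \<Phi> (V j x) (U x) \<partial>M) \<longlonglongrightarrow> 0"
  proof (rule integral_vanishing[where A = "\<lambda>j x. norm (V j x) powr r" and B = "\<lambda>x. norm (U x) powr r"])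
    show "AE x in M. (\<lambda>j. \<Phi> (V j x) (U x)) \<longlonglongrightarrow> 0" using lim
    proof eventually_elim
      case (elim x)
      have "(\<lambda>j. (V j x, U x)) \<longlonglongrightarrow> (0, U x)" by (intro tendsto_Pair elim tendsto_const)
      from continuous_on_tendsto_compose[OF c this] show ?case by (simp add: zero)
    qed
    show "\<exists>C\<ge>0. \<forall>j. AE x in M. \<bar>\<Phi> (V j x) (U x)\<bar> \<le> \<epsilon> * norm (V j x) powr r + C * norm (U x) powr r" if e: "\<epsilon> > 0" for \<epsilon>
    proof -
      obtain C where C: "C \<ge> 0" "\<And>v u. \<bar>\<Phi> v u\<bar> \<le> \<epsilon> * norm v powr r + C * norm u powr r" using bd[OF e] by auto
      then show ?thesis by (intro exI[of _ C]) auto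
    qed
  qed (use V lp_integrable[OF V(1)] lp_integrable[OF U] in auto)
qed

text \<open>Paired with the vanishing part, the nonlinearity at \<open>V j + U\<close> sees only
  that part in the limit: the remainder
  \<open>dual_pow r (v + u) \<bullet> v - norm v powr r\<close> is 0 for \<open>u = 0\<close> and
  for \<open>v = 0\<close>. It is used with \<open>r = p\<close> on gradients and with
  \<open>r = ps\<close> on functions.\<close>

lemma brezis_lieb_dual_pow:
  fixes V :: "nat \<Rightarrow> 'a \<Rightarrow> 'b::euclidean_space"
  assumes r: "r > 1"
    and V: "\<And>j. lp M r (V j)" "\<And>j. (\<integral>x. norm (V j x) powr r \<partial>M) \<le> K"
    and lim: "AE x in M. (\<lambda>j. V j x) \<longlonglongrightarrow> 0" and U: "lp M r U"
  shows "(\<lambda>j. (\<integral>x. dual_pow r (V j x + U x) \<bullet> V j x \<partial>M) - (\<integral>x. norm (V j x) powr r \<partial>M)) \<longlonglongrightarrow> 0"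
proof -
  have r0: "r > 0" using r by simp
  note bl = brezis_lieb[OF r0, where \<Phi> = "\<lambda>v u. dual_pow r (v + u) \<bullet> v - norm v powr r", OF _ _ _ _ V lim U]
  have c: "continuous_on UNIV (\<lambda>z::'b\<times>'b. dual_pow r (fst z + snd z) \<bullet> fst z - norm (fst z) powr r)"
    using r by (intro continuous_intros continuous_dual_pow_compose continuous_norm_powr) auto
  have hom: "dual_pow r (c *\<^sub>R a + c *\<^sub>R b) \<bullet> c *\<^sub>R a - norm (c *\<^sub>R a) powr r = c powr r * (dual_pow r (a + b) \<bullet> a - norm a powr r)"
    if "c > 0" for c and a b :: 'b
    unfolding scaleR_add_right[symmetric] dual_pow_pair_scale[OF that] norm_powr_scaleR[OF that] by (simp add: algebra_simps)
  have i: "integrable M (\<lambda>x. dual_pow r (V j x + U x) \<bullet> V j x - norm (V j x) powr r)" for j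
    by (rule bl(1)) (use c hom r in \<open>auto simp: dual_pow_inner_self\<close>)
  have "(\<lambda>j. \<integral>x. dual_pow r (V j x + U x) \<bullet> V j x - norm (V j x) powr r \<partial>M) \<longlonglongrightarrow> 0"
    by (rule bl(2)) (use c hom r in \<open>auto simp: dual_pow_inner_self\<close>)
  moreover have "(\<integral>x. dual_pow r (V j x + U x) \<bullet> V j x - norm (V j x) powr r \<partial>M)
     = (\<integral>x. dual_pow r (V j x + U x) \<bullet> V j x \<partial>M) - (\<integral>x. norm (V j x) powr r \<partial>M)" for j
    using Bochner_Integration.integrable_add[OF i[of j] lp_integrable[OF V(1)[of j]]] lp_integrable[OF V(1)[of j]]
    by (intro Bochner_Integration.integral_diff) auto
  ultimately show ?thesis by (simp only:)
qed

lemma brezis_lieb_norm: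
  fixes V :: "nat \<Rightarrow> 'a \<Rightarrow> 'b::euclidean_space"
  assumes r: "r > 0"
    and V: "\<And>j. lp M r (V j)" "\<And>j. (\<integral>x. norm (V j x) powr r \<partial>M) \<le> K"
    and lim: "AE x in M. (\<lambda>j. V j x) \<longlonglongrightarrow> 0" and U: "lp M r U"
  shows "(\<lambda>j. (\<integral>x. norm (V j x + U x) powr r \<partial>M) - (\<integral>x. norm (V j x) powr r \<partial>M) - (\<integral>x. norm (U x) powr r \<partial>M)) \<longlonglongrightarrow> 0"
proof -
  note bl = brezis_lieb[OF r, where \<Phi> = "\<lambda>v u. norm (v + u) powr r - norm v powr r - norm u powr r", OF _ _ _ _ V lim U]
  have c: "continuous_on UNIV (\<lambda>z::'b\<times>'b. norm (fst z + snd z) powr r - norm (fst z) powr r - norm (snd z) powr r)"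
    using r by (intro continuous_on_diff continuous_norm_powr continuous_intros) auto
  have hom: "norm (c *\<^sub>R a + c *\<^sub>R b) powr r - norm (c *\<^sub>R a) powr r - norm (c *\<^sub>R b) powr r = c powr r * (norm (a + b) powr r - norm a powr r - norm b powr r)"
    if "c > 0" for c and a b :: 'b
    unfolding scaleR_add_right[symmetric] norm_powr_scaleR[OF that] by (simp add: algebra_simps)
  have "(\<lambda>j. \<integral>x. norm (V j x + U x) powr r - norm (V j x) powr r - norm (U x) powr r \<partial>M) \<longlonglongrightarrow> 0"
    by (rule bl(2)) (use c hom r in auto)
  moreover have "(\<integral>x. norm (V j x + U x) powr r - norm (V j x) powr r - norm (U x) powr r \<partial>M)
     = (\<integral>x. norm (V j x + U x) powr r \<partial>M) - (\<integral>x. norm (V j x) powr r \<partial>M) - (\<integral>x. norm (U x) powr r \<partial>M)" for j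
    using lp_integrable[OF V(1)[of j]] lp_integrable[OF U] lp_integrable[OF lp_add[OF V(1)[of j] U]] r by simp
  ultimately show ?thesis by (simp only:)
qed

text \<open>By coercivity the monotonicity defect controls \<open>V j\<close> up to small multiples
  of \<open>norm (V j) powr r\<close>, which is absorbed on the left, and of the fixed
  \<open>norm u powr r\<close>.\<close>

lemma dual_pow_tendsto:
  fixes V :: "nat \<Rightarrow> 'b::euclidean_space"
  assumes r: "r > 1" and lim: "(\<lambda>j. (dual_pow r (V j + u) - dual_pow r u) \<bullet> V j) \<longlonglongrightarrow> 0"
  shows "V \<longlonglongrightarrow> 0"
proof -
  have "(\<lambda>j. norm (V j) powr r) \<longlonglongrightarrow> 0"
  proof (rule LIMSEQ_I)
    fix e :: real assume e: "e > 0"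
    define Y where "Y = norm u powr r"
    have Y: "Y \<ge> 0" by (simp add: Y_def)
    \<comment> \<open>The bound \<open>1/2\<close> serves the absorption; the other bound makes the
      contribution of \<open>u\<close> at most \<open>e / 4\<close>, leaving a further
      \<open>e / 4\<close> for the defect.\<close>
    define \<epsilon> where "\<epsilon> = min (1/2) (e / (4 * (Y + 1)))"
    have \<epsilon>0: "\<epsilon> > 0" using e Y by (simp add: \<epsilon>_def)
    have "\<epsilon> \<le> 1/2" "\<epsilon> \<le> e / (4 * (Y + 1))"
      unfolding \<epsilon>_def by (rule min.cobounded1, rule min.cobounded2)
    note \<epsilon> = \<epsilon>0 this
    have \<epsilon>Y: "\<epsilon> * Y \<le> e / 4"
    proof -
      have "\<epsilon> * Y \<le> e / (4 * (Y + 1)) * (Y + 1)" using \<epsilon> Y e by (intro mult_mono) auto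
      also have "\<dots> = e / 4" using Y by (simp add: field_simps)
      finally show ?thesis .
    qed
    obtain C where C: "C \<ge> 0" "\<And>v u::'b. norm v powr r \<le> \<epsilon> * (norm v powr r + norm u powr r) + C * ((dual_pow r (v + u) - dual_pow r u) \<bullet> v)"
      using dual_pow_coercive[OF r \<epsilon>(1)] by metis
    have "(\<lambda>j. C * ((dual_pow r (V j + u) - dual_pow r u) \<bullet> V j)) \<longlonglongrightarrow> C * 0" by (intro tendsto_intros lim)
    then have "\<forall>\<^sub>F j in sequentially. C * ((dual_pow r (V j + u) - dual_pow r u) \<bullet> V j) < e / 4"
      using e by (intro order_tendstoD(2)) auto
    then obtain N where N: "\<And>j. j \<ge> N \<Longrightarrow> C * ((dual_pow r (V j + u) - dual_pow r u) \<bullet> V j) < e / 4"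
      by (auto simp: eventually_sequentially)
    have "norm (norm (V j) powr r - 0) < e" if "j \<ge> N" for j
    proof -
      have "\<epsilon> * norm (V j) powr r \<le> (1/2) * norm (V j) powr r" using \<epsilon> by (intro mult_right_mono) auto
      moreover have "norm (V j) powr r \<le> \<epsilon> * norm (V j) powr r + \<epsilon> * Y + C * ((dual_pow r (V j + u) - dual_pow r u) \<bullet> V j)"
        using C(2)[of "V j" u] by (simp add: Y_def distrib_left)
      ultimately have "norm (V j) powr r < e" using N[OF that] \<epsilon>Y by argo
      then show ?thesis by simp
    qed
    then show "\<exists>N. \<forall>j\<ge>N. norm (norm (V j) powr r - 0) < e" by blast
  qed
  then have "(\<lambda>j. (norm (V j) powr r) powr (1 / r)) \<longlonglongrightarrow> 0 powr (1 / r)"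
    using r by (intro tendsto_powr2 tendsto_const) auto
  then show ?thesis using r by (simp add: powr_powr tendsto_norm_zero_iff)
qed

text \<open>The growth bound and \<open>x powr (q - 1) * y \<le> x powr q + y powr q\<close> leave
  powers \<open>q\<close> and 1, both below \<open>s\<close>. Interpolation makes them a small
  multiple of the bounded \<open>s\<close>-th powers plus a constant, which is integrable on a
  finite measure space.\<close>

lemma integral_subcritical_vanishing:
  fixes u w :: "nat \<Rightarrow> 'a \<Rightarrow> real" and f :: "'a \<Rightarrow> real \<Rightarrow> real"
  assumes fin: "finite_measure M" and q: "1 < q" "q < s" and a: "a1 > 0" "a2 > 0"
    and growth: "AE x in M. \<forall>t. \<bar>f x t\<bar> \<le> a1 * \<bar>t\<bar> powr (q - 1) + a2"
    and u: "\<And>j. lp M s (u j)" "\<And>j. (\<integral>x. \<bar>u j x\<bar> powr s \<partial>M) \<le> K" "AE x in M. (\<lambda>j. u j x) \<longlonglongrightarrow> v x"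
    and w: "\<And>j. lp M s (w j)" "\<And>j. (\<integral>x. \<bar>w j x\<bar> powr s \<partial>M) \<le> K'" "AE x in M. (\<lambda>j. w j x) \<longlonglongrightarrow> 0"
  shows "(\<lambda>j. \<integral>x. f x (u j x) * w j x \<partial>M) \<longlonglongrightarrow> 0"
proof -
  interpret finite_measure M by fact
  note iu = lp_integrable[OF u(1), unfolded real_norm_def] and iw = lp_integrable[OF w(1), unfolded real_norm_def]
  show ?thesis
  proof (rule integral_vanishing[where A = "\<lambda>j x. \<bar>u j x\<bar> powr s + \<bar>w j x\<bar> powr s" and B = "\<lambda>_. 1" and K = "K + K'"])
    show "(\<integral>x. \<bar>u j x\<bar> powr s + \<bar>w j x\<bar> powr s \<partial>M) \<le> K + K'" for j
      using iu iw u(2)[of j] w(2)[of j] by simp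
    show "AE x in M. (\<lambda>j. f x (u j x) * w j x) \<longlonglongrightarrow> 0" using growth u(3) w(3)
    proof eventually_elim
      case (elim x)
      have P: "(\<lambda>j. \<bar>u j x\<bar> powr (q - 1)) \<longlonglongrightarrow> \<bar>v x\<bar> powr (q - 1)"
        using q elim(2) by (intro tendsto_powr2 tendsto_rabs tendsto_const) auto
      have "(\<lambda>j. (a1 * \<bar>u j x\<bar> powr (q - 1) + a2) * \<bar>w j x\<bar>) \<longlonglongrightarrow> (a1 * \<bar>v x\<bar> powr (q - 1) + a2) * \<bar>0\<bar>"
        by (intro tendsto_mult tendsto_add tendsto_const tendsto_rabs P elim(3))
      then have lim: "(\<lambda>j. (a1 * \<bar>u j x\<bar> powr (q - 1) + a2) * \<bar>w j x\<bar>) \<longlonglongrightarrow> 0" by (simp only: abs_zero mult_zero_right)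
      show ?case
      proof (rule Lim_null_comparison[OF always_eventually lim], rule allI)
        fix j show "norm (f x (u j x) * w j x) \<le> (a1 * \<bar>u j x\<bar> powr (q - 1) + a2) * \<bar>w j x\<bar>"
          using elim(1) unfolding real_norm_def abs_mult by (intro mult_right_mono) auto
      qed
    qed
    show "\<exists>C\<ge>0. \<forall>j. AE x in M. \<bar>f x (u j x) * w j x\<bar> \<le> \<epsilon> * (\<bar>u j x\<bar> powr s + \<bar>w j x\<bar> powr s) + C * 1" if \<epsilon>: "\<epsilon> > 0" for \<epsilon>
    proof -
      define \<delta> where "\<delta> = \<epsilon> / (a1 + a2)"
      have "a1 + a2 > 0" using a by simp
      then have \<delta>: "\<delta> > 0" "a1 * \<delta> + a2 * \<delta> = \<epsilon>"
        using \<epsilon> unfolding distrib_right[symmetric] by (simp_all add: \<delta>_def)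
      obtain C1 where C1: "C1 \<ge> 0" "\<And>t. t \<ge> 0 \<Longrightarrow> t powr q \<le> \<delta> * t powr s + C1"
        using powr_le_interpolate[of q s \<delta>] q \<delta> by auto
      obtain C2 where C2: "C2 \<ge> 0" "\<And>t. t \<ge> 0 \<Longrightarrow> t powr 1 \<le> \<delta> * t powr s + C2"
        using powr_le_interpolate[of 1 s \<delta>] q \<delta> by auto
      define C where "C = a1 * (2 * C1) + a2 * C2"
      have mix: "x powr (q - 1) * y \<le> x powr q + y powr q" if "x \<ge> 0" "y \<ge> 0" for x y :: real
      proof (cases "x \<le> y")
        case True
        then have "x powr (q - 1) * y \<le> y powr (q - 1) * y" using that q by (intro mult_right_mono powr_mono2) auto
        also have "\<dots> = y powr q" using that powr_mult_base[of y "q-1"] by (simp add: mult.commute)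
        finally show ?thesis using powr_ge_zero[of x q] by linarith
      next
        case False
        then have "x powr (q - 1) * y \<le> x powr (q - 1) * x" by (intro mult_left_mono) auto
        also have "\<dots> = x powr q" using that powr_mult_base[of x "q-1"] by (simp add: mult.commute)
        finally show ?thesis using powr_ge_zero[of y q] by linarith
      qed
      have "\<bar>f x (u j x) * w j x\<bar> \<le> \<epsilon> * (\<bar>u j x\<bar> powr s + \<bar>w j x\<bar> powr s) + C * 1"
        if g: "\<forall>t. \<bar>f x t\<bar> \<le> a1 * \<bar>t\<bar> powr (q - 1) + a2" for x j
      proof -
        let ?U = "\<bar>u j x\<bar>" and ?W = "\<bar>w j x\<bar>"
        have "\<bar>f x (u j x) * w j x\<bar> \<le> (a1 * ?U powr (q - 1) + a2) * ?W"
          using g unfolding abs_mult by (intro mult_right_mono) auto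
        also have "\<dots> = a1 * (?U powr (q - 1) * ?W) + a2 * ?W powr 1" by (simp add: algebra_simps)
        also have "\<dots> \<le> a1 * ((\<delta> * ?U powr s + C1) + (\<delta> * ?W powr s + C1)) + a2 * (\<delta> * ?W powr s + C2)"
          using a mix[of ?U ?W] C1(2)[of ?U] C1(2)[of ?W] C2(2)[of ?W]
          by (intro add_mono mult_left_mono) auto
        also have "\<dots> = (a1 * \<delta>) * ?U powr s + (a1 * \<delta> + a2 * \<delta>) * ?W powr s + C" by (simp add: C_def algebra_simps)
        also have "\<dots> \<le> (a1 * \<delta> + a2 * \<delta>) * ?U powr s + (a1 * \<delta> + a2 * \<delta>) * ?W powr s + C"
          using a \<delta>(1) by (intro add_mono mult_right_mono) auto
        finally show ?thesis unfolding \<delta>(2) by (simp add: distrib_left)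
      qed
      then have "AE x in M. \<bar>f x (u j x) * w j x\<bar> \<le> \<epsilon> * (\<bar>u j x\<bar> powr s + \<bar>w j x\<bar> powr s) + C * 1" for j
        using growth by (auto elim: eventually_mono)
      moreover have "C \<ge> 0" using C1(1) C2(1) a by (simp add: C_def)
      ultimately show ?thesis by blast
    qed
  qed (use iu iw in auto)
qed

text \<open>A bounded test function leaves the power \<open>s - 1\<close> of \<open>u j\<close>,
  strictly below the exponent \<open>s\<close> of the available bound. With a test function bounded
  only in \<open>L^s\<close> the integrand would be of order \<open>s\<close> and mass could
  concentrate.\<close>

lemma integral_critical_bounded_vanishing:
  fixes u w :: "nat \<Rightarrow> 'a \<Rightarrow> real"
  assumes fin: "finite_measure M" and s: "1 < s"
    and u: "\<And>j. lp M s (u j)" "\<And>j. (\<integral>x. \<bar>u j x\<bar> powr s \<partial>M) \<le> K" "AE x in M. (\<lambda>j. u j x) \<longlonglongrightarrow> v x"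
    and w: "\<And>j x. \<bar>w j x\<bar> \<le> D" "AE x in M. (\<lambda>j. w j x) \<longlonglongrightarrow> 0"
  shows "(\<lambda>j. \<integral>x. dual_pow s (u j x) * w j x \<partial>M) \<longlonglongrightarrow> 0"
proof -
  interpret finite_measure M by fact
  note iu = lp_integrable[OF u(1), unfolded real_norm_def]
  have D: "D \<ge> 0" using w(1)[of 0 undefined] by linarith
  show ?thesis
  proof (rule integral_vanishing[where A = "\<lambda>j x. \<bar>u j x\<bar> powr s" and B = "\<lambda>_. 1" and K = K])
    show "AE x in M. (\<lambda>j. dual_pow s (u j x) * w j x) \<longlonglongrightarrow> 0" using u(3) w(2)
    proof eventually_elim
      case (elim x)
      have "(\<lambda>j. dual_pow s (u j x)) \<longlonglongrightarrow> dual_pow s (v x)"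
        using continuous_on_tendsto_compose[OF continuous_dual_pow[OF s] elim(1)] by simp
      from tendsto_mult[OF this elim(2)] show ?case by simp
    qed
    show "\<exists>C\<ge>0. \<forall>j. AE x in M. \<bar>dual_pow s (u j x) * w j x\<bar> \<le> \<epsilon> * \<bar>u j x\<bar> powr s + C * 1" if \<epsilon>: "\<epsilon> > 0" for \<epsilon>
    proof -
      define \<delta> where "\<delta> = \<epsilon> / (D + 1)"
      have \<delta>: "\<delta> > 0" "(D + 1) * \<delta> = \<epsilon>" using \<epsilon> D by (auto simp: \<delta>_def)
      obtain C where C: "C \<ge> 0" "\<And>t. t \<ge> 0 \<Longrightarrow> t powr (s - 1) \<le> \<delta> * t powr s + C"
        using powr_le_interpolate[of "s - 1" s \<delta>] s \<delta> by auto
      have "\<bar>dual_pow s (u j x) * w j x\<bar> \<le> \<epsilon> * \<bar>u j x\<bar> powr s + (D + 1) * C * 1" for j x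
      proof -
        have "\<bar>dual_pow s (u j x) * w j x\<bar> = \<bar>w j x\<bar> * \<bar>u j x\<bar> powr (s - 1)"
          using norm_dual_pow[of s "u j x"] by (simp add: abs_mult)
        also have "\<dots> \<le> (D + 1) * (\<delta> * \<bar>u j x\<bar> powr s + C)"
          using w(1)[of j x] C D by (intro mult_mono) auto
        also have "\<dots> = (D + 1) * \<delta> * \<bar>u j x\<bar> powr s + (D + 1) * C * 1" by (simp add: algebra_simps)
        finally show ?thesis unfolding \<delta>(2) .
      qed
      then show ?thesis using C D by (intro exI[of _ "(D + 1) * C"]) auto
    qed
  qed (use iu u in auto)
qed

section \<open>The best Sobolev constant and the derivative of the energy in terms of pairs\<close>

context sobolev_domain
begin

text \<open>The Sobolev inequality with some constant bounds all quotients below by a positive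
  number, and the pair \<open>w0\<close>, \<open>H0\<close> of positive energy guarantees that there
  is a quotient, since an infimum over the empty set would say nothing. Solving the quotient bound
  for the integral gives the inequality with the best constant.\<close>

lemma sobolev_const_bound:
  assumes n: "DIM('a) \<ge> 2" "p < real DIM('a)"
    and ex: "sob w0 H0" "(\<integral>x. norm (H0 x) powr p \<partial>L) > 0"
  defines "ps \<equiv> crit_exp TYPE('a) p"
  shows "sobolev_const \<Omega> p > 0"
    "sob w H \<Longrightarrow> (\<integral>x. \<bar>w x\<bar> powr ps \<partial>L) \<le> sobolev_const \<Omega> p powr (- (ps / p)) * (\<integral>x. norm (H x) powr p \<partial>L) powr (ps / p)"
proof -
  obtain C where C: "C > 0" "\<And>u g. sob u g \<Longrightarrow> lp L ps u"
    "\<And>u g. sob u g \<Longrightarrow> (\<integral>x. \<bar>u x\<bar> powr ps \<partial>L) \<le> C * (\<integral>x. norm (g x) powr p \<partial>L) powr (ps / p)"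
    using sob_sobolev[OF n] unfolding ps_def by metis
  have p0: "p > 0" using p1 by simp
  have ps0: "ps > 0" using p1 n by (simp add: ps_def crit_exp_def)
  define A where "A = {u \<in> W01p \<Omega> p. \<not> (AE x in L. u x = 0)}"
  define F where "F u = grad_energy \<Omega> p u / (\<integral>x. \<bar>u x\<bar> powr ps \<partial>L) powr (p / ps)" for u :: "'a \<Rightarrow> real"
  have S: "sobolev_const \<Omega> p = Inf (F ` A)"
    by (simp add: sobolev_const_def Let_def A_def F_def ps_def)
  have Xpos: "(\<integral>x. \<bar>u x\<bar> powr ps \<partial>L) > 0" if "sob u g" "\<not> (AE x in L. u x = 0)" for u g
  proof -
    have "(\<integral>x. \<bar>u x\<bar> powr ps \<partial>L) \<noteq> 0"
      using integral_nonneg_eq_0_iff_AE[OF lp_integrable[OF C(2)[OF that(1)]]] that(2) by auto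
    moreover have "(\<integral>x. \<bar>u x\<bar> powr ps \<partial>L) \<ge> 0" by simp
    ultimately show ?thesis by linarith
  qed
  have bound: "C powr (- (p / ps)) \<le> F u" if "u \<in> A" for u
  proof -
    have s: "sob u (weak_grad \<Omega> u)" and nz: "\<not> (AE x in L. u x = 0)" using that W01p_sob by (auto simp: A_def)
    define X Y where "X = (\<integral>x. \<bar>u x\<bar> powr ps \<partial>L)" and "Y = (\<integral>x. norm (weak_grad \<Omega> u x) powr p \<partial>L)"
    have X: "X > 0" using Xpos[OF s nz] by (simp add: X_def)
    have Y: "Y \<ge> 0" by (simp add: Y_def)
    have "X powr (p / ps) \<le> (C * Y powr (ps / p)) powr (p / ps)"
      using C(3)[OF s] X p0 ps0 by (intro powr_mono2) (auto simp: X_def Y_def)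
    also have "\<dots> = C powr (p / ps) * Y" using C(1) Y p0 ps0 by (simp add: powr_mult powr_powr)
    finally have "X powr (p / ps) \<le> C powr (p / ps) * Y" .
    then have "C powr (- (p / ps)) \<le> Y / X powr (p / ps)"
      using X C(1) by (simp add: powr_minus field_simps)
    then show ?thesis by (simp add: F_def X_def Y_def grad_energy_def)
  qed
  have A: "w0 \<in> A"
  proof -
    have "\<not> (AE x in L. w0 x = 0)"
    proof
      assume z: "AE x in L. w0 x = 0"
      then have "AE x in L. w0 x = 0 * w0 x" by simp
      from sob_unique[OF ex(1) sob_scale[OF ex(1), of 0] this] have "AE x in L. H0 x = 0" by simp
      then have "(\<integral>x. norm (H0 x) powr p \<partial>L) = (\<integral>x. 0 \<partial>L)"
        using borel_measurable_integrable[OF lp_integrable[OF sob_lp(2)[OF ex(1)]]]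
        by (intro integral_cong_AE) (auto elim: eventually_mono)
      then show False using ex(2) by simp
    qed
    then show ?thesis using sob_W01p(1)[OF ex(1)] by (simp add: A_def)
  qed
  have "C powr (- (p / ps)) \<le> Inf (F ` A)" using A bound by (intro cInf_greatest) auto
  moreover have "C powr (- (p / ps)) > 0" using C(1) by simp
  ultimately show S0: "sobolev_const \<Omega> p > 0" unfolding S by linarith
  have bdd: "bdd_below (F ` A)" using bound by (auto intro!: bdd_belowI[of _ "C powr (- (p / ps))"])
  assume s: "sob w H"
  define X Y where "X = (\<integral>x. \<bar>w x\<bar> powr ps \<partial>L)" and "Y = (\<integral>x. norm (H x) powr p \<partial>L)"
  have Y: "Y \<ge> 0" by (simp add: Y_def)
  let ?S = "sobolev_const \<Omega> p"
  have "X \<le> ?S powr (- (ps / p)) * Y powr (ps / p)"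
  proof (cases "AE x in L. w x = 0")
    case True
    then have "X = (\<integral>x. 0 \<partial>L)" unfolding X_def
      using borel_measurable_integrable[OF lp_integrable[OF C(2)[OF s]]]
      by (intro integral_cong_AE) (auto elim: eventually_mono)
    then show ?thesis by simp
  next
    case False
    then have wA: "w \<in> A" using sob_W01p(1)[OF s] by (simp add: A_def)
    have X: "X > 0" using Xpos[OF s False] by (simp add: X_def)
    have "?S \<le> F w" unfolding S using wA bdd by (intro cInf_lower) auto
    then have "?S \<le> Y / X powr (p / ps)" by (simp add: F_def X_def Y_def sob_W01p(3)[OF s])
    then have "X powr (p / ps) \<le> Y / ?S" using X S0 by (simp add: field_simps)
    then have "(X powr (p / ps)) powr (ps / p) \<le> (Y / ?S) powr (ps / p)"
      using p0 ps0 by (intro powr_mono2) auto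
    moreover have "(X powr (p / ps)) powr (ps / p) = X" using X p0 ps0 by (simp add: powr_powr)
    moreover have "(Y / ?S) powr (ps / p) = ?S powr (- (ps / p)) * Y powr (ps / p)"
      using Y S0 by (simp add: powr_divide powr_minus_divide)
    ultimately show ?thesis by simp
  qed
  then show "(\<integral>x. \<bar>w x\<bar> powr ps \<partial>L) \<le> ?S powr (- (ps / p)) * (\<integral>x. norm (H x) powr p \<partial>L) powr (ps / p)"
    by (simp add: X_def Y_def)
qed

text \<open>Any gradients known to belong to \<open>u\<close> and \<open>w\<close> may replace the
  selected ones, as they agree almost everywhere.\<close>

lemma energy_deriv_sob:
  fixes h :: "real \<Rightarrow> real" and f :: "'a \<Rightarrow> real \<Rightarrow> real"
  assumes u: "sob u X" and w: "sob w H"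
  shows "energy_deriv \<Omega> p h f u w = h (\<integral>x. norm (X x) powr p \<partial>L) * (\<integral>x. dual_pow p (X x) \<bullet> H x \<partial>L)
    - (\<integral>x. f x (u x) * w x \<partial>L) - (\<integral>x. dual_pow (crit_exp TYPE('a) p) (u x) * w x \<partial>L)"
proof -
  have wu: "weak_grad \<Omega> u \<in> borel_measurable L" "weak_grad \<Omega> w \<in> borel_measurable L"
    using sob_lp(2)[OF W01p_sob[OF sob_W01p(1)[OF u]]] sob_lp(2)[OF W01p_sob[OF sob_W01p(1)[OF w]]] by (auto simp: lp_def)
  have [measurable]: "(dual_pow p :: 'a \<Rightarrow> 'a) \<in> borel_measurable borel"
    by (intro borel_measurable_continuous_onI continuous_dual_pow p1)
  have [measurable]: "X \<in> borel_measurable L" "H \<in> borel_measurable L" using sob_lp(2)[OF u] sob_lp(2)[OF w] by (auto simp: lp_def)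
  note wu [measurable]
  have "(\<integral>x. norm (weak_grad \<Omega> u x) powr (p - 2) * (weak_grad \<Omega> u x \<bullet> weak_grad \<Omega> w x) \<partial>L)
    = (\<integral>x. dual_pow p (weak_grad \<Omega> u x) \<bullet> weak_grad \<Omega> w x \<partial>L)" by (simp add: dual_pow_def)
  also have "\<dots> = (\<integral>x. dual_pow p (X x) \<bullet> H x \<partial>L)"
  proof (rule integral_cong_AE)
    show "AE x in L. dual_pow p (weak_grad \<Omega> u x) \<bullet> weak_grad \<Omega> w x = dual_pow p (X x) \<bullet> H x"
      using sob_W01p(2)[OF u] sob_W01p(2)[OF w] by eventually_elim simp
  qed measurable
  finally show ?thesis
    by (simp add: energy_deriv_def Let_def sob_W01p(3)[OF u] dual_pow_def)
qed

text \<open>The dual norm looks only at the unit ball, so the test functions of bounded energy are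
  scaled into it; the derivative is homogeneous in the direction.\<close>

lemma energy_deriv_tendsto:
  fixes h :: "real \<Rightarrow> real" and f :: "'a \<Rightarrow> real \<Rightarrow> real"
  assumes u: "\<And>j. sob (u j) (X j)" and w: "\<And>j. sob (w j) (H j)"
    and D: "\<And>j. (\<integral>x. norm (H j x) powr p \<partial>L) \<le> D"
    and dual: "(\<lambda>j. dual_norm \<Omega> p (energy_deriv \<Omega> p h f (u j))) \<longlonglongrightarrow> 0"
  shows "(\<lambda>j. energy_deriv \<Omega> p h f (u j) (w j)) \<longlonglongrightarrow> 0"
proof -
  have D0: "D \<ge> 0" using D[of 0] by (rule order_trans[rotated]) simp
  \<comment> \<open>The summand 1 keeps the scaling factor positive even if \<open>D\<close> is
    0.\<close>
  define R where "R = (D + 1) powr (1 / p)"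
  have R: "R > 0" using D0 by (simp add: R_def)
  have Rp: "R powr p = D + 1" using D0 p1 by (simp add: R_def powr_powr)
  have sc: "energy_deriv \<Omega> p h f (u j) (\<lambda>x. (1 / R) * w j x) = (1 / R) * energy_deriv \<Omega> p h f (u j) (w j)" for j
  proof -
    have 1: "(\<integral>x. f x (u j x) * ((1 / R) * w j x) \<partial>L) = (1 / R) * (\<integral>x. f x (u j x) * w j x \<partial>L)"
      by (subst Bochner_Integration.integral_mult_right_zero[symmetric]) (simp add: mult_ac)
    have 2: "(\<integral>x. dual_pow (crit_exp TYPE('a) p) (u j x) * ((1 / R) * w j x) \<partial>L) = (1 / R) * (\<integral>x. dual_pow (crit_exp TYPE('a) p) (u j x) * w j x \<partial>L)"
      by (subst Bochner_Integration.integral_mult_right_zero[symmetric]) (simp add: mult_ac)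
    have 3: "(\<integral>x. dual_pow p (X j x) \<bullet> ((1 / R) *\<^sub>R H j x) \<partial>L) = (1 / R) * (\<integral>x. dual_pow p (X j x) \<bullet> H j x \<partial>L)"
      by (simp only: inner_scaleR_right Bochner_Integration.integral_mult_right_zero)
    show ?thesis unfolding energy_deriv_sob[OF u sob_scale[OF w]] energy_deriv_sob[OF u w] 1 2 3
      by (simp add: algebra_simps)
  qed
  have le: "ennreal \<bar>energy_deriv \<Omega> p h f (u j) (\<lambda>x. (1 / R) * w j x)\<bar> \<le> dual_norm \<Omega> p (energy_deriv \<Omega> p h f (u j))" for j
    unfolding dual_norm_def
  proof (rule SUP_upper, rule CollectI, rule conjI)
    note s = sob_scale[OF w[of j], of "1 / R"]
    show "(\<lambda>x. (1 / R) * w j x) \<in> W01p \<Omega> p" by (rule sob_W01p(1)[OF s])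
    have "grad_energy \<Omega> p (\<lambda>x. (1 / R) * w j x) = (1 / R) powr p * (\<integral>x. norm (H j x) powr p \<partial>L)"
      using R unfolding sob_W01p(3)[OF s] by (simp add: powr_mult powr_divide)
    also have "\<dots> = (\<integral>x. norm (H j x) powr p \<partial>L) / (D + 1)" using R by (simp add: powr_divide Rp)
    also have "\<dots> \<le> 1" using D[of j] D0 by simp
    finally have "grad_energy \<Omega> p (\<lambda>x. (1 / R) * w j x) \<le> 1" .
    moreover have "0 \<le> grad_energy \<Omega> p (\<lambda>x. (1 / R) * w j x)" by (simp add: grad_energy_def)
    ultimately show "W01p_norm \<Omega> p (\<lambda>x. (1 / R) * w j x) \<le> 1"
      using p1 powr_mono2[of "1 / p" "grad_energy \<Omega> p (\<lambda>x. (1 / R) * w j x)" 1] by (simp add: W01p_norm_def)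
  qed
  have "(\<lambda>j. ennreal \<bar>energy_deriv \<Omega> p h f (u j) (\<lambda>x. (1 / R) * w j x)\<bar>) \<longlonglongrightarrow> 0"
    by (rule tendsto_sandwich[OF _ _ tendsto_const dual]) (use le in auto)
  then have "(\<lambda>j. \<bar>energy_deriv \<Omega> p h f (u j) (\<lambda>x. (1 / R) * w j x)\<bar>) \<longlonglongrightarrow> 0"
    by (simp flip: ennreal_0 add: tendsto_ennreal_iff)
  then have "(\<lambda>j. (1 / R) * energy_deriv \<Omega> p h f (u j) (w j)) \<longlonglongrightarrow> 0"
    unfolding sc by (rule tendsto_rabs_zero_cancel)
  from tendsto_mult_left[OF this, of R] show ?thesis using R by simp
qed

end

section \<open>Excluding a loss of energy under the growth threshold\<close>

theorem theorem1p1: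
  fixes \<Omega> :: "'a::euclidean_space set"
    and p q a1 a2 :: real
    and h :: "real \<Rightarrow> real"
    and f :: "'a \<Rightarrow> real \<Rightarrow> real"
    and u :: "nat \<Rightarrow> 'a \<Rightarrow> real"
  defines "ps \<equiv> crit_exp TYPE('a) p"
  assumes "DIM('a) \<ge> 2"
    and "open \<Omega>" "connected \<Omega>" "\<Omega> \<noteq> {}" "bounded \<Omega>"
    and "1 < p" "p < real DIM('a)"
    and "continuous_on {0..} h" "mono_on {0..} h" "\<And>t. t \<ge> 0 \<Longrightarrow> h t \<ge> 0"
    and "caratheodory \<Omega> f"
    and "a1 > 0" "a2 > 0" "1 < q" "q < ps"
    and "AE x in lebesgue_on \<Omega>. \<forall>t. \<bar>f x t\<bar> \<le> a1 * \<bar>t\<bar> powr (q - 1) + a2"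
    and "\<And>t. t > 0 \<Longrightarrow> h t > sobolev_const \<Omega> p powr (- (ps / p)) * t powr (ps / p - 1)"
    and "\<And>j. u j \<in> W01p \<Omega> p"
    and "\<exists>C. \<forall>j. W01p_norm \<Omega> p (u j) \<le> C"
    and "(\<lambda>j. dual_norm \<Omega> p (energy_deriv \<Omega> p h f (u j))) \<longlonglongrightarrow> 0"
  shows "\<exists>r w. strict_mono (r :: nat \<Rightarrow> nat) \<and> w \<in> W01p \<Omega> p \<and>
           (\<lambda>k. W01p_norm \<Omega> p (\<lambda>x. u (r k) x - w x)) \<longlonglongrightarrow> 0"
proof -
  note n = assms(2,8) and hc = assms(9) and hm = assms(10) and a = assms(13,14) and q = assms(15,16)
    and growth = assms(17) and hS = assms(18) and uW = assms(19) and ubd = assms(20) and dual = assms(21)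
  interpret sobolev_domain \<Omega> p using assms by unfold_locales auto
  have p0: "p > 0" "p \<ge> 0" using p1 by auto
  have psp: "p < ps"
  proof -
    have "p * (real DIM('a) - p) < p * real DIM('a)" using p0 by (intro mult_strict_left_mono) auto
    then show ?thesis using n by (simp add: ps_def crit_exp_def less_divide_eq mult.commute)
  qed
  then have ps1: "ps > 1" using p1 by simp
  obtain C where C: "C > 0" "\<And>u g. sob u g \<Longrightarrow> lp L ps u"
    "\<And>u g. sob u g \<Longrightarrow> (\<integral>x. \<bar>u x\<bar> powr ps \<partial>L) \<le> C * (\<integral>x. norm (g x) powr p \<partial>L) powr (ps / p)"
    using sob_sobolev[OF n] unfolding ps_def by metis
  have su: "sob (u j) (weak_grad \<Omega> (u j))" for j by (rule W01p_sob[OF uW])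
  have Ege: "0 \<le> grad_energy \<Omega> p w" for w by (simp add: grad_energy_def)
  obtain B where B: "\<And>j. grad_energy \<Omega> p (u j) \<le> B"
  proof -
    obtain D where D: "\<And>j. W01p_norm \<Omega> p (u j) \<le> D" using ubd by blast
    have "grad_energy \<Omega> p (u j) \<le> D powr p" for j
    proof -
      have "(grad_energy \<Omega> p (u j) powr (1 / p)) powr p \<le> D powr p"
        using D[of j] p0 by (intro powr_mono2) (auto simp: W01p_norm_def)
      then show ?thesis using p0 Ege by (simp add: powr_powr)
    qed
    then show ?thesis by (rule that)
  qed
  have bdL: "(\<integral>x. \<bar>w x\<bar> powr ps \<partial>L) \<le> C * Y powr (ps / p)"
    if "sob w H" "(\<integral>x. norm (H x) powr p \<partial>L) \<le> Y" for w H Y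
  proof -
    have "(\<integral>x. norm (H x) powr p \<partial>L) powr (ps / p) \<le> Y powr (ps / p)"
      using that(2) ps1 p0 by (intro powr_mono2) auto
    then show ?thesis using C(3)[OF that(1)] C(1) by (meson mult_left_mono less_imp_le order_trans)
  qed
  have EB: "(\<integral>x. norm (weak_grad \<Omega> (u j) x) powr p \<partial>L) \<le> B" for j using B[of j] by (simp add: grad_energy_def)
  obtain v s0 where s0: "strict_mono (s0 :: nat \<Rightarrow> nat)" and v: "v \<in> borel_measurable L"
    and ae0: "AE x in L. (\<lambda>j. u (s0 j) x) \<longlonglongrightarrow> v x"
    by (rule rellich[OF n su EB])
  \<comment> \<open>The energies are the arguments of \<open>h\<close>; fixing their limit
    \<open>e\<close> along a subsequence makes the factors in front of the flux converge by
    continuity.\<close>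
  obtain e s1 where s1: "strict_mono (s1 :: nat \<Rightarrow> nat)" and elim0: "(\<lambda>j. grad_energy \<Omega> p (u (s0 (s1 j)))) \<longlonglongrightarrow> e"
  proof -
    have "bounded (range (\<lambda>j. grad_energy \<Omega> p (u (s0 j))))"
      unfolding bounded_iff using B Ege by (auto intro!: exI[of _ B])
    from bounded_imp_convergent_subsequence[OF this] show ?thesis using that by (auto simp: o_def)
  qed
  define s where "s j = s0 (s1 j)" for j
  have sm: "strict_mono s" unfolding s_def using strict_mono_o[OF s0 s1] by (simp add: o_def)
  define y where "y j = u (s j)" for j
  define X where "X j = weak_grad \<Omega> (y j)" for j
  have sy: "sob (y j) (X j)" for j unfolding y_def X_def by (rule su)
  have XB: "(\<integral>x. norm (X j x) powr p \<partial>L) \<le> B" for j unfolding X_def y_def by (rule EB)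
  have Xe: "(\<lambda>j. \<integral>x. norm (X j x) powr p \<partial>L) \<longlonglongrightarrow> e"
    using elim0 by (simp add: X_def y_def s_def grad_energy_def)
  have yv: "AE x in L. (\<lambda>j. y j x) \<longlonglongrightarrow> v x" using ae0
    by eventually_elim (use LIMSEQ_subseq_LIMSEQ[OF _ s1] in \<open>force simp: y_def s_def o_def\<close>)
  define Ky where "Ky = C * B powr (ps / p)"
  have yK: "(\<integral>x. \<bar>y j x\<bar> powr ps \<partial>L) \<le> Ky" for j unfolding Ky_def by (rule bdL[OF sy XB])
  have lv: "lp L ps v" using lp_fatou[OF C(2)[OF sy] _ yv v, of Ky] yK ps1 by simp
  have yvp: "lp_tendsto L p y v"
    by (rule lp_tendsto_interpolate[OF finite_L p0(1) psp C(2)[OF sy] _ yv v]) (use yK in simp)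
  have lvp: "lp L p v"
  proof (rule lpI_bound[OF v])
    show "integrable L (\<lambda>x. 1 + norm (v x) powr ps)" using lp_integrable[OF lv] by auto
    show "AE x in L. norm (v x) powr p \<le> 1 + norm (v x) powr ps"
    proof (rule AE_I2)
      fix x show "norm (v x) powr p \<le> 1 + norm (v x) powr ps"
      proof (cases "norm (v x) \<le> 1")
        case True
        then have "norm (v x) powr p \<le> 1 powr p" using p0 by (intro powr_mono2) auto
        then show ?thesis by (simp add: add_increasing2)
      next
        case False
        then have "norm (v x) powr p \<le> norm (v x) powr ps" using psp by (intro powr_mono) auto
        then show ?thesis by linarith
      qed
    qed
  qed
  \<comment> \<open>With no additional condition \<open>mazur\<close> just says that the almost
    everywhere limit belongs to the space; \<open>U\<close> is its gradient.\<close>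
  obtain U where sv: "sob v U"
    by (rule mazur[OF sy XB lvp yvp, where Q = UNIV]) auto
  have concl: ?thesis if r: "strict_mono (r :: nat \<Rightarrow> nat)" and w: "sob w W"
    and lim: "(\<lambda>k. \<integral>x. norm (X (r k) x - W x) powr p \<partial>L) \<longlonglongrightarrow> 0" for r w W
  proof (intro exI conjI)
    show "strict_mono (\<lambda>k. s (r k))" using strict_mono_o[OF sm r] by (simp add: o_def)
    show "w \<in> W01p \<Omega> p" by (rule sob_W01p(1)[OF w])
    have "W01p_norm \<Omega> p (\<lambda>x. u (s (r k)) x - w x) = (\<integral>x. norm (X (r k) x - W x) powr p \<partial>L) powr (1 / p)" for k
      using sob_W01p(3)[OF sob_diff[OF sy[of "r k"] w]] by (simp add: W01p_norm_def y_def)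
    moreover have "(\<lambda>k. (\<integral>x. norm (X (r k) x - W x) powr p \<partial>L) powr (1 / p)) \<longlonglongrightarrow> 0 powr (1 / p)"
      using p0 by (intro tendsto_powr2 lim tendsto_const) auto
    ultimately show "(\<lambda>k. W01p_norm \<Omega> p (\<lambda>x. u (s (r k)) x - w x)) \<longlonglongrightarrow> 0" by simp
  qed
  have e0: "e \<ge> 0" by (rule LIMSEQ_le_const[OF Xe]) auto
  \<comment> \<open>The growth assumption makes \<open>h\<close> positive at positive arguments
    only, and \<open>h 0\<close> may be 0. So the factor \<open>h e\<close> can be divided out only
    for \<open>e > 0\<close>; if \<open>e = 0\<close>, the gradients already tend to 0.\<close>
  show ?thesis
  proof (cases "e = 0")
    case True
    have "sob (\<lambda>_. 0) (\<lambda>_. 0)" using sob_scale[OF sv, of 0] by simp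
    from concl[OF strict_mono_id this] show ?thesis using Xe True by simp
  next
    case False
    then have ep: "e > 0" using e0 by simp
    have hlim: "(\<lambda>j. h (\<integral>x. norm (X j x) powr p \<partial>L)) \<longlonglongrightarrow> h e"
      by (rule continuous_on_tendsto_compose[OF hc Xe]) (use e0 in auto)
    have he: "h e > 0"
    proof -
      have "0 \<le> sobolev_const \<Omega> p powr (- (ps / p)) * e powr (ps / p - 1)" by simp
      then show ?thesis using hS[OF ep] by linarith
    qed
    have dual': "(\<lambda>j. dual_norm \<Omega> p (energy_deriv \<Omega> p h f (y j))) \<longlonglongrightarrow> 0"
      using LIMSEQ_subseq_LIMSEQ[OF dual sm] by (simp add: y_def o_def)
    define z where "z j x = y j x - v x" for j x
    define V where "V j x = X j x - U x" for j x
    have sz: "sob (z j) (V j)" for j unfolding z_def[abs_def] V_def[abs_def] by (rule sob_diff[OF sy sv])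
    have lpV: "lp L p (V j)" for j by (rule sob_lp(2)[OF sz])
    note lpX = sob_lp(2)[OF sy] and lpU = sob_lp(2)[OF sv]
    define BV where "BV = 2 powr p * (B + (\<integral>x. norm (U x) powr p \<partial>L))"
    have VB: "(\<integral>x. norm (V j x) powr p \<partial>L) \<le> BV" for j
    proof -
      have "norm (V j x) powr p \<le> 2 powr p * (norm (X j x) powr p + norm (U x) powr p)" for x
        using norm_add_powr_le[OF p0(2), of "X j x" "- U x"] by (simp add: V_def)
      then have "(\<integral>x. norm (V j x) powr p \<partial>L) \<le> (\<integral>x. 2 powr p * (norm (X j x) powr p + norm (U x) powr p) \<partial>L)"
        using lp_integrable[OF lpV] lp_integrable[OF lpX] lp_integrable[OF lpU] by (intro integral_mono) auto
      also have "\<dots> = 2 powr p * ((\<integral>x. norm (X j x) powr p \<partial>L) + (\<integral>x. norm (U x) powr p \<partial>L))"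
        using lp_integrable[OF lpX] lp_integrable[OF lpU] by simp
      also have "\<dots> \<le> BV" unfolding BV_def by (intro mult_left_mono add_mono XB) auto
      finally show ?thesis .
    qed
    define Kz where "Kz = C * BV powr (ps / p)"
    have zK: "(\<integral>x. \<bar>z j x\<bar> powr ps \<partial>L) \<le> Kz" for j unfolding Kz_def by (rule bdL[OF sz VB])
    have z0: "AE x in L. (\<lambda>j. z j x) \<longlonglongrightarrow> 0" using yv
      by eventually_elim (simp add: z_def LIM_zero)
    define w where "w j x = arctan (z j x)" for j x
    define d where "d j x = inverse (1 + (z j x)\<^sup>2)" for j x
    have sw: "sob (w j) (\<lambda>x. d j x *\<^sub>R V j x)" for j
      unfolding w_def[abs_def] d_def[abs_def] by (rule sob_arctan[OF sz])
    have d01: "0 < d j x" "d j x \<le> 1" for j x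
    proof -
      have "1 + (z j x)\<^sup>2 > 0" by (simp add: add_pos_nonneg)
      then show "0 < d j x" "d j x \<le> 1" by (simp_all add: d_def inverse_le_1_iff)
    qed
    have dB: "(\<integral>x. norm (d j x *\<^sub>R V j x) powr p \<partial>L) \<le> BV" for j
    proof -
      have "norm (d j x *\<^sub>R V j x) powr p \<le> norm (V j x) powr p" for x
        using d01[of j x] p0 by (intro powr_mono2) (auto simp: mult_left_le_one_le)
      then have "(\<integral>x. norm (d j x *\<^sub>R V j x) powr p \<partial>L) \<le> (\<integral>x. norm (V j x) powr p \<partial>L)"
        using lp_integrable[OF sob_lp(2)[OF sw]] lp_integrable[OF lpV] by (intro integral_mono) auto
      then show ?thesis using VB[of j] by linarith
    qed
    have wK: "(\<integral>x. \<bar>w j x\<bar> powr ps \<partial>L) \<le> Kz" for j unfolding Kz_def by (rule bdL[OF sw dB])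
    have w0: "AE x in L. (\<lambda>j. w j x) \<longlonglongrightarrow> 0" using z0
    proof eventually_elim
      case (elim x)
      from tendsto_arctan[OF elim] show ?case by (simp add: w_def)
    qed
    have wb: "\<bar>w j x\<bar> \<le> pi / 2" for j x
      unfolding w_def using less_imp_le[OF arctan_ubound[of "z j x"]] less_imp_le[OF arctan_lbound[of "z j x"]]
      by (intro abs_leI) (simp, metis minus_le_iff)
    have Fw: "(\<lambda>j. \<integral>x. f x (y j x) * w j x \<partial>L) \<longlonglongrightarrow> 0"
      by (rule integral_subcritical_vanishing[OF finite_L q a growth C(2)[OF sy] yK yv C(2)[OF sw] wK w0])
    have Fz: "(\<lambda>j. \<integral>x. f x (y j x) * z j x \<partial>L) \<longlonglongrightarrow> 0"
      by (rule integral_subcritical_vanishing[OF finite_L q a growth C(2)[OF sy] yK yv C(2)[OF sz] zK z0])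
    have Cw: "(\<lambda>j. \<integral>x. dual_pow ps (y j x) * w j x \<partial>L) \<longlonglongrightarrow> 0"
      by (rule integral_critical_bounded_vanishing[OF finite_L ps1 C(2)[OF sy] yK yv wb w0])
    have Ew: "(\<lambda>j. energy_deriv \<Omega> p h f (y j) (w j)) \<longlonglongrightarrow> 0"
      by (rule energy_deriv_tendsto[OF sy sw dB dual'])
    have Ez: "(\<lambda>j. energy_deriv \<Omega> p h f (y j) (z j)) \<longlonglongrightarrow> 0"
      by (rule energy_deriv_tendsto[OF sy sz VB dual'])
    text \<open>
      Testing with \<open>arctan (u\<^sub>j - v)\<close> removes the critical term and yields almost everywhere convergence
      of the gradients by the strict monotonicity of the \<open>p\<close>-Laplacian.
    \<close>
    have Xw: "(\<lambda>j. \<integral>x. dual_pow p (X j x) \<bullet> (d j x *\<^sub>R V j x) \<partial>L) \<longlonglongrightarrow> 0"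
    proof -
      define H where "H j = h (\<integral>x. norm (X j x) powr p \<partial>L)" for j
      define I where "I j = (\<integral>x. dual_pow p (X j x) \<bullet> (d j x *\<^sub>R V j x) \<partial>L)" for j
      have "(\<lambda>j. energy_deriv \<Omega> p h f (y j) (w j) + (\<integral>x. f x (y j x) * w j x \<partial>L) + (\<integral>x. dual_pow ps (y j x) * w j x \<partial>L)) \<longlonglongrightarrow> 0 + 0 + 0"
        by (intro tendsto_add Ew Fw Cw)
      then have HI: "(\<lambda>j. H j * I j) \<longlonglongrightarrow> 0"
        unfolding energy_deriv_sob[OF sy sw] by (simp add: H_def I_def ps_def)
      have Hl: "H \<longlonglongrightarrow> h e" using hlim by (simp add: H_def[abs_def])
      have "(\<lambda>j. (H j * I j) / H j) \<longlonglongrightarrow> 0 / h e" using he by (intro tendsto_divide HI Hl) auto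
      then have lim: "(\<lambda>j. (H j * I j) / H j) \<longlonglongrightarrow> 0" by simp
      have "\<forall>\<^sub>F j in sequentially. H j > 0" using Hl he by (rule order_tendstoD(1))
      then have "\<forall>\<^sub>F j in sequentially. (H j * I j) / H j = I j" by eventually_elim simp
      with lim have "I \<longlonglongrightarrow> 0" by (rule Lim_transform_eventually)
      then show ?thesis by (simp add: I_def[abs_def])
    qed
    have wp0: "lp_tendsto L p w (\<lambda>_. 0)"
      by (rule lp_tendsto_interpolate[OF finite_L p0(1) psp C(2)[OF sw] _ w0]) (use wK in auto)
    \<comment> \<open>The functions \<open>w j\<close> tend to 0 in \<open>L^p\<close> with bounded
      energies, hence their gradients tend weakly to 0. The flux of \<open>U\<close> can therefore
      be subtracted from the flux of \<open>X j\<close>, which creates the monotonicity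
      defect.\<close>
    have Uw: "(\<lambda>j. \<integral>x. dual_pow p (U x) \<bullet> (d j x *\<^sub>R V j x) \<partial>L) \<longlonglongrightarrow> 0"
      by (rule weak_convergence[OF sw dB wp0 lpU])
    \<comment> \<open>The nonnegative monotonicity defect between \<open>X j\<close> and
      \<open>U\<close>. Its integral with the weight \<open>d j\<close> is the difference of the two
      preceding integrals, so it tends to 0 in \<open>L^1\<close>.\<close>
    define m where "m j x = (dual_pow p (V j x + U x) - dual_pow p (U x)) \<bullet> V j x" for j x
    have m0: "m j x \<ge> 0" for j x using dual_pow_strict_mono(1)[OF p1, of "V j x + U x" "U x"] by (simp add: m_def)
    note lpdV = sob_lp(2)[OF sw]
    have split: "d j x * m j x = dual_pow p (X j x) \<bullet> (d j x *\<^sub>R V j x) - dual_pow p (U x) \<bullet> (d j x *\<^sub>R V j x)" for j x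
      by (simp add: m_def V_def inner_diff_left right_diff_distrib)
    have dmi: "integrable L (\<lambda>x. d j x * m j x)" for j
      unfolding split using dual_pow_pairing(1)[OF lpX lpdV] dual_pow_pairing(1)[OF lpU lpdV] by auto
    have "(\<lambda>j. \<integral>x. norm (d j x * m j x) \<partial>L) \<longlonglongrightarrow> 0"
    proof -
      have "(\<integral>x. norm (d j x * m j x) \<partial>L) = (\<integral>x. dual_pow p (X j x) \<bullet> (d j x *\<^sub>R V j x) \<partial>L) - (\<integral>x. dual_pow p (U x) \<bullet> (d j x *\<^sub>R V j x) \<partial>L)" for j
      proof -
        have "norm (d j x * m j x) = d j x * m j x" for x using d01(1)[of j x] m0[of j x] by simp
        then show ?thesis unfolding split
          using dual_pow_pairing(1)[OF lpX lpdV] dual_pow_pairing(1)[OF lpU lpdV] by (simp only: Bochner_Integration.integral_diff)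
      qed
      with tendsto_diff[OF Xw Uw] show ?thesis by simp
    qed
    from tendsto_L1_AE_subseq[OF dmi this]
    obtain r where r: "strict_mono r" "AE x in L. (\<lambda>j. d (r j) x * m (r j) x) \<longlonglongrightarrow> 0" by blast
    have Vae: "AE x in L. (\<lambda>j. V (r j) x) \<longlonglongrightarrow> 0" using r(2) z0
    proof eventually_elim
      case (elim x)
      have "(\<lambda>j. z (r j) x) \<longlonglongrightarrow> 0" using LIMSEQ_subseq_LIMSEQ[OF elim(2) r(1)] by (simp add: o_def)
      \<comment> \<open>The weight came from the derivative of \<open>arctan\<close>. Its reciprocal
        tends to 1, because \<open>z\<close> tends to 0 at this point, so the weight can be
        removed.\<close>
      then have "(\<lambda>j. (d (r j) x * m (r j) x) * (1 + (z (r j) x)\<^sup>2)) \<longlonglongrightarrow> 0 * (1 + 0\<^sup>2)"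
        by (intro tendsto_mult tendsto_add tendsto_const tendsto_power elim(1))
      moreover have "(d (r j) x * m (r j) x) * (1 + (z (r j) x)\<^sup>2) = m (r j) x" for j
      proof -
        have "d (r j) x * (1 + (z (r j) x)\<^sup>2) = 1" using d01(1)[of "r j" x] by (simp add: d_def)
        then show ?thesis by (metis mult.commute mult.left_commute mult_1)
      qed
      ultimately have "(\<lambda>j. m (r j) x) \<longlonglongrightarrow> 0" by simp
      then show ?case unfolding m_def by (rule dual_pow_tendsto[OF p1])
    qed
    define P where "P j = (\<integral>x. norm (V (r j) x) powr p \<partial>L)" for j
    define R where "R j = (\<integral>x. \<bar>z (r j) x\<bar> powr ps \<partial>L)" for j
    have XVU: "X j x = V j x + U x" "y j x = z j x + v x" for j x by (simp_all add: V_def z_def)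
    have z0r: "AE x in L. (\<lambda>j. z (r j) x) \<longlonglongrightarrow> 0" using z0
      by eventually_elim (use LIMSEQ_subseq_LIMSEQ[OF _ r(1)] in \<open>force simp: o_def\<close>)
    have T1: "(\<lambda>j. (\<integral>x. dual_pow p (X (r j) x) \<bullet> V (r j) x \<partial>L) - P j) \<longlonglongrightarrow> 0"
      unfolding P_def XVU by (rule brezis_lieb_dual_pow[OF p1 lpV VB Vae lpU])
    have T2: "(\<lambda>j. (\<integral>x. dual_pow ps (y (r j) x) * z (r j) x \<partial>L) - R j) \<longlonglongrightarrow> 0"
      using brezis_lieb_dual_pow[OF ps1 C(2)[OF sz] _ z0r lv, of Kz] zK by (simp add: R_def XVU)
    have T3: "(\<lambda>j. (\<integral>x. norm (X (r j) x) powr p \<partial>L) - P j - (\<integral>x. norm (U x) powr p \<partial>L)) \<longlonglongrightarrow> 0"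
      unfolding P_def XVU by (rule brezis_lieb_norm[OF p0(1) lpV VB Vae lpU])
    have Xer: "(\<lambda>j. \<integral>x. norm (X (r j) x) powr p \<partial>L) \<longlonglongrightarrow> e"
      using LIMSEQ_subseq_LIMSEQ[OF Xe r(1)] by (simp add: o_def)
    \<comment> \<open>By the splitting of the norm the energies of \<open>V\<close> converge to what
      the energies of \<open>X\<close> exceed that of the limit by. In particular
      \<open>t \<le> e\<close>.\<close>
    define t where "t = e - (\<integral>x. norm (U x) powr p \<partial>L)"
    have Pt: "P \<longlonglongrightarrow> t"
      using tendsto_diff[OF Xer tendsto_add[OF T3 tendsto_const[of "\<integral>x. norm (U x) powr p \<partial>L"]]] by (simp add: t_def)
    have t0: "t \<ge> 0" by (rule LIMSEQ_le_const[OF Pt]) (auto simp: P_def)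
    have te: "t \<le> e" by (simp add: t_def)
    have "t = 0"
    proof (rule ccontr)
      assume "t \<noteq> 0"
      then have tp: "t > 0" using t0 by simp
      have "\<forall>\<^sub>F j in sequentially. P j > 0" using Pt tp by (rule order_tendstoD(1))
      \<comment> \<open>A gradient of positive energy is what makes the infimum defining
        \<open>sobolev_const\<close> range over a nonempty class.\<close>
      then obtain j0 where "P j0 > 0" by (auto simp: eventually_sequentially)
      then have nz: "(\<integral>x. norm (V (r j0) x) powr p \<partial>L) > 0" by (simp add: P_def)
      note SC = sobolev_const_bound[OF n sz nz, folded ps_def]
      let ?S = "sobolev_const \<Omega> p powr (- (ps / p))"
      define H where "H j = h (\<integral>x. norm (X (r j) x) powr p \<partial>L)" for j
      have Hl: "H \<longlonglongrightarrow> h e" using LIMSEQ_subseq_LIMSEQ[OF hlim r(1)] by (simp add: o_def H_def[abs_def])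
      define Q where "Q j = (\<integral>x. dual_pow p (X (r j) x) \<bullet> V (r j) x \<partial>L)" for j
      have "(\<lambda>j. energy_deriv \<Omega> p h f (y (r j)) (z (r j)) + (\<integral>x. f x (y (r j) x) * z (r j) x \<partial>L)
          + ((\<integral>x. dual_pow ps (y (r j) x) * z (r j) x \<partial>L) - R j)) \<longlonglongrightarrow> 0 + 0 + 0"
        using LIMSEQ_subseq_LIMSEQ[OF Ez r(1)] LIMSEQ_subseq_LIMSEQ[OF Fz r(1)] by (intro tendsto_add T2) (simp_all add: o_def)
      then have HQ: "(\<lambda>j. H j * Q j - R j) \<longlonglongrightarrow> 0"
        unfolding energy_deriv_sob[OF sy sz] by (simp add: H_def Q_def ps_def)
      have Qt: "Q \<longlonglongrightarrow> t" using tendsto_add[OF T1 Pt] by (simp add: Q_def[abs_def])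
      \<comment> \<open>The critical mass of the lost part balances its energy, weighted by
        \<open>h\<close> at the full limit energy \<open>e\<close>. Together with the limit of the
        Sobolev inequality this bounds \<open>h e * t\<close>.\<close>
      have Rl: "R \<longlonglongrightarrow> h e * t" using tendsto_diff[OF tendsto_mult[OF Hl Qt] HQ] by simp
      have "R j \<le> ?S * P j powr (ps / p)" for j unfolding R_def P_def by (rule SC(2)[OF sz])
      moreover have "(\<lambda>j. ?S * P j powr (ps / p)) \<longlonglongrightarrow> ?S * t powr (ps / p)"
        using tp by (intro tendsto_mult tendsto_const tendsto_powr Pt) auto
      ultimately have "h e * t \<le> ?S * t powr (ps / p)"
        using Rl by (intro LIMSEQ_le[of R]) auto
      also have "\<dots> = (?S * t powr (ps / p - 1)) * t"
        using tp powr_add[of t "ps / p - 1" 1] by simp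
      finally have "h e \<le> ?S * t powr (ps / p - 1)" using tp by simp
      \<comment> \<open>The bound just obtained concerns \<open>h e\<close>, whereas the power on
        its right is taken at \<open>t\<close>; monotonicity moves the bound to \<open>h t\<close>,
        where it contradicts the growth assumption.\<close>
      moreover have "h t \<le> h e" using hm t0 te by (auto simp: mono_on_def)
      ultimately show False using hS[OF tp] by linarith
    qed
    then have "(\<lambda>k. \<integral>x. norm (X (r k) x - U x) powr p \<partial>L) \<longlonglongrightarrow> 0"
      using Pt by (simp add: P_def[abs_def] V_def)
    from concl[OF r(1) sv this] show ?thesis .
  qed
qed

end
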